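(* Let $(\Omega,\Sigma,\mu)$ be a complete finite measure space, let $X$ be a complete $B$-locally convex space, and let $M:\Sigma\to ck(X)$ be a strong multimeasure for which there is a set $Q\in ck(X)$ such that $M(E)\subset\mu(E)Q$ for all $E\in\Sigma$. Then there exists a Pettis integrable multifunction $F:\Omega\to ck(X)$ such that: (i) for every countably additive selector $m$ of $M$ there is an integrable by seminorm selector $f$ of $F$ such that $m$ is the indefinite integral of $f$, i.e. $m(E)=\int_E f\,d\mu$ for every $E\in\Sigma$; (ii) for every $E\in\Sigma$, $$M(E)=(P)\int_E F\,d\mu=I(E),$$ where $I(E)=\left\{\int_E f\,d\mu : f \text{ is an integrable by seminorm selector of } F\right\}$.
   Context: $(\Omega,\Sigma,\mu)$ is a fixed complete finite measure space, $X$ is a (real) Hausdorff locally convex space with topology $\tau$, and $\mathscr{P}$ is the family of all $\tau$-continuous seminorms on $X$, directed by the pointwise order $\le$. $L_1(\mu)$ is the space of Lebesgue integrable functions $\Omega\to\mathbb{R}$. For $p\in\mathscr{P}$, $\varphi_p:X\to X/p^{-1}(0)$ is the canonical quotient map. $X^*$ is the topological dual of $X$, $2^X$ is the family of all nonempty subsets of $X$, and $ck(X)$ is the family of all nonempty convex compact subsets of $X$. For $C\subset X$ and $x^*\in X^*$, $\delta^*(x^*,C)=\sup\{x^*(x):x\in C\}$. A measurable simple function $g:\Omega\to X$ is a function with finitely many values $x_1,\dots,x_n$ such that $g^{-1}(x_i)\in\Sigma$ for each $i$; its integral over $E$ is $\sum_i \mu(E\cap g^{-1}(x_i))x_i$.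 $f:\Omega\to X$ is $p$-strongly measurable ($p\in\mathscr{P}$) if there are measurable simple functions $f_n^p:\Omega\to X$ and $Z_p\in\Sigma$ with $\mu(Z_p)=0$ such that $p(f_n^p(t)-f(t))\to0$ for all $t\in\Omega\setminus Z_p$. It is measurable by seminorm if it is $p$-strongly measurable for every $p\in\mathscr{P}$. $p$-Bochner integrability ($p\in\mathscr{P}$): $f:\Omega\to X$ is $p$-Bochner integrable if there are measurable simple functions $f_n^p:\Omega\to X$ and $Z_p\in\Sigma$ with $\mu(Z_p)=0$ such that (a) $p(f_n^p(t)-f(t))\to 0$ for all $t\in\Omega\setminus Z_p$; (b) $p(f_n^p(\cdot)-f(\cdot))\in L_1(\mu)$ and $\lim_n\int_\Omega p(f_n^p(t)-f(t))\,d\mu=0$; (c) for each $E\in\Sigma$ there is a vector $x_E^p(f)\in X$ with $\lim_n p\big(x_E^p(f)-\int_E f_n^p\,d\mu\big)=0$. Integrability by seminorm: $f:\Omega\to X$ is integrable by seminorm if for each $p\in\mathscr{P}$ there are $(f_n^p)$ and $Z_p$ satisfying (a), (b), and for each $E\in\Sigma$ there is a vector $x_E\in X$ (the same for all $p$) with $\lim_n p\big(x_E-\int_E f_n^p\,d\mu\big)=0$ for every $p\in\mathscr{P}$. One sets $\int_E f\,d\mu=x_E$. A net $(f_s)_{s\in\mathscr{P}}$ of functions $f_s:\Omega\to X$ is a net of pairwise almost the same functions if for all $p,q\in\mathscr{P}$ with $p\le q$ there is $Z_{pq}\in\Sigma$ with $\mu(Z_{pq})=0$ and $p(f_p(t)-f_q(t))=0$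 for all $t\in\Omega\setminus Z_{pq}$. It is a net of pairwise almost the same Bochner integrable functions if moreover each $f_s$ is $s$-Bochner integrable. The space $X$ is a $B$-locally convex space if for each net $(f_s)_{s\in\mathscr{P}}$ of pairwise almost the same Bochner integrable functions there is a function $f:\Omega\to X$ such that $s(f(\cdot)-f_s(\cdot))\in L_1(\mu)$ and $\int_\Omega s(f(t)-f_s(t))\,d\mu=0$ for every $s\in\mathscr{P}$. A multifunction $F:\Omega\to ck(X)$ is Pettis integrable if $t\mapsto\delta^*(x^*,F(t))$ is Lebesgue integrable for every $x^*\in X^*$, and for each $E\in\Sigma$ there is a set in $ck(X)$, denoted $(P)\int_E F\,d\mu$, such that $\delta^*\big(x^*,(P)\int_E F\,d\mu\big)=\int_E\delta^*(x^*,F(t))\,d\mu$ for every $x^*\in X^*$. For a sequence $(A_n)$ of subsets of $X$, $\sum_{n=1}^{+\infty}A_n$ is the set of all elements of $X$ that can be written as the sum of an unconditionally convergent series $\sum_{n=1}^{+\infty}x_n$ with $x_n\in A_n$ for every $n$. A multifunction $M:\Sigma\to 2^X$ is a strong multimeasure if $M(\emptyset)=\{0\}$ and $M\big(\bigcup_{n=1}^{+\infty}E_n\big)=\sum_{n=1}^{+\infty}M(E_n)$ for each disjoint sequence $(E_n)$ in $\Sigma$. A selector of $M$ is a function $m:\Sigma\to X$ with $m(E)\in M(E)$ for every $E\in\Sigma$. For a multifunction $F:\Omega\to ck(X)$, a function $f:\Omega\to X$ is a $p$-strongly measurable selector of $F$ if $f$ is $p$-strongly measurable and there is $Z_p\in\Sigma$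 with $\mu(Z_p)=0$ such that $\varphi_p(f(t))\in\varphi_p[F(t)]=\{\varphi_p(x):x\in F(t)\}$ for every $t\in\Omega\setminus Z_p$. $f$ is a measurable by seminorm selector of $F$ if it is measurable by seminorm and is a $p$-strongly measurable selector of $F$ for every $p\in\mathscr{P}$. $f$ is an integrable by seminorm selector of $F$ if $f$ is integrable by seminorm and is a measurable by seminorm selector of $F$. *)

theory Defs
  imports "HOL-Analysis.Analysis"
begin

section \<open>Locally convex spaces\<close>

text \<open>
  Real Hausdorff locally convex spaces. The superclass \<open>uniform_topological_group_add\<close> supplies
  the canonical translation-invariant uniformity, which is determined by the topology
  (\<open>uniformity = filtercomap (\<lambda>(x, y). y - x) (nhds 0)\<close>); hence it is no restriction, and
  \<open>complete (UNIV :: 'a set)\<close> is the usual completeness of a topological vector space.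
\<close>

class locally_convex_space = real_vector + uniform_topological_group_add + t2_space +
  assumes tendsto_scaleR_Pair:
    "LIM x (nhds (c::real) \<times>\<^sub>F nhds a). scaleR (fst x) (snd x) :> nhds (scaleR c a)"
  and locally_convex_unfolded:
    "open U \<Longrightarrow> 0 \<in> U \<Longrightarrow>
       \<exists>V. open V \<and> (\<forall>x\<in>V. \<forall>y\<in>V. \<forall>u\<ge>0. \<forall>v\<ge>0. u + v = 1 \<longrightarrow> scaleR u x + scaleR v y \<in> V) \<and>
           0 \<in> V \<and> V \<subseteq> U"

text \<open>A class axiom cannot mention \<open>convex\<close>, so its definition is unfolded above.\<close>

lemma locally_convex:
  fixes U :: "'a::locally_convex_space set"
  assumes "open U" "0 \<in> U"
  shows "\<exists>V. open V \<and> convex V \<and> 0 \<in> V \<and> V \<subseteq> U"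
  using locally_convex_unfolded[OF assms] unfolding convex_def .

definition seminorm :: "('a::real_vector \<Rightarrow> real) \<Rightarrow> bool" where
  "seminorm p \<longleftrightarrow> (\<forall>x y. p (x + y) \<le> p x + p y) \<and> (\<forall>c x. p (c *\<^sub>R x) = \<bar>c\<bar> * p x)"

definition continuous_seminorms :: "('a::locally_convex_space \<Rightarrow> real) set" where
  "continuous_seminorms = {p. seminorm p \<and> continuous_on UNIV p}"

text \<open>The canonical map onto the quotient by \<open>p -` {0}\<close>, with cosets as elements.\<close>

definition quot_map :: "('a::real_vector \<Rightarrow> real) \<Rightarrow> 'a \<Rightarrow> 'a set" where
  "quot_map p x = {y. y - x \<in> p -` {0}}"

definition topological_dual :: "('a::locally_convex_space \<Rightarrow> real) set" where
  "topological_dual = {\<xi>. linear \<xi> \<and> continuous_on UNIV \<xi>}"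

definition ck :: "'a::locally_convex_space set set" where
  "ck = {C. C \<noteq> {} \<and> convex C \<and> compact C}"

text \<open>Real-valued supremum: only meaningful when \<open>\<xi> ` C\<close> is nonempty and bounded above.\<close>

definition support_fun :: "('a::locally_convex_space \<Rightarrow> real) \<Rightarrow> 'a set \<Rightarrow> real" where
  "support_fun \<xi> C = (SUP x\<in>C. \<xi> x)"


section \<open>Measurability and integrability by seminorm\<close>

definition simple_integral_on :: "'w measure \<Rightarrow> 'w set \<Rightarrow> ('w \<Rightarrow> 'a::real_vector) \<Rightarrow> 'a" where
  "simple_integral_on \<mu> E g = (\<Sum>x\<in>g ` space \<mu>. measure \<mu> (E \<inter> g -` {x}) *\<^sub>R x)"

definition simple_approx_ae ::
  "'w measure \<Rightarrow> ('a::locally_convex_space \<Rightarrow> real) \<Rightarrow> ('w \<Rightarrow> 'a) \<Rightarrow> (nat \<Rightarrow> 'w \<Rightarrow> 'a) \<Rightarrow> bool" where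
  "simple_approx_ae \<mu> p f g \<longleftrightarrow>
     (\<forall>n. simple_function \<mu> (g n)) \<and>
     (\<exists>Z\<in>null_sets \<mu>. \<forall>t\<in>space \<mu> - Z. (\<lambda>n. p (g n t - f t)) \<longlonglongrightarrow> 0)"

definition simple_approx_L1 ::
  "'w measure \<Rightarrow> ('a::locally_convex_space \<Rightarrow> real) \<Rightarrow> ('w \<Rightarrow> 'a) \<Rightarrow> (nat \<Rightarrow> 'w \<Rightarrow> 'a) \<Rightarrow> bool" where
  "simple_approx_L1 \<mu> p f g \<longleftrightarrow>
     (\<forall>n. integrable \<mu> (\<lambda>t. p (g n t - f t))) \<and>
     (\<lambda>n. \<integral>t. p (g n t - f t) \<partial>\<mu>) \<longlonglongrightarrow> 0"

definition strongly_measurable_wrt ::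
  "'w measure \<Rightarrow> ('a::locally_convex_space \<Rightarrow> real) \<Rightarrow> ('w \<Rightarrow> 'a) \<Rightarrow> bool" where
  "strongly_measurable_wrt \<mu> p f \<longleftrightarrow> (\<exists>g. simple_approx_ae \<mu> p f g)"

definition measurable_by_seminorm :: "'w measure \<Rightarrow> ('w \<Rightarrow> 'a::locally_convex_space) \<Rightarrow> bool" where
  "measurable_by_seminorm \<mu> f \<longleftrightarrow> (\<forall>p\<in>continuous_seminorms. strongly_measurable_wrt \<mu> p f)"

definition Bochner_integrable_wrt ::
  "'w measure \<Rightarrow> ('a::locally_convex_space \<Rightarrow> real) \<Rightarrow> ('w \<Rightarrow> 'a) \<Rightarrow> bool" where
  "Bochner_integrable_wrt \<mu> p f \<longleftrightarrow>
     (\<exists>g. simple_approx_ae \<mu> p f g \<and> simple_approx_L1 \<mu> p f g \<and>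
          (\<forall>E\<in>sets \<mu>. \<exists>x. (\<lambda>n. p (x - simple_integral_on \<mu> E (g n))) \<longlonglongrightarrow> 0))"

text \<open>In the next two definitions \<open>g p\<close> is the approximating sequence for the seminorm \<open>p\<close>.\<close>

definition integrable_by_seminorm :: "'w measure \<Rightarrow> ('w \<Rightarrow> 'a::locally_convex_space) \<Rightarrow> bool" where
  "integrable_by_seminorm \<mu> f \<longleftrightarrow>
     (\<exists>g. (\<forall>p\<in>continuous_seminorms. simple_approx_ae \<mu> p f (g p) \<and> simple_approx_L1 \<mu> p f (g p)) \<and>
          (\<forall>E\<in>sets \<mu>. \<exists>x. \<forall>p\<in>continuous_seminorms.
             (\<lambda>n. p (x - simple_integral_on \<mu> E (g p n))) \<longlonglongrightarrow> 0))"

text \<open>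
  The vector is independent of the approximating sequences, because \<open>'a\<close> is Hausdorff.
\<close>

definition seminorm_integral ::
  "'w measure \<Rightarrow> 'w set \<Rightarrow> ('w \<Rightarrow> 'a::locally_convex_space) \<Rightarrow> 'a" where
  "seminorm_integral \<mu> E f =
     (THE x. \<exists>g. \<forall>p\<in>continuous_seminorms.
        simple_approx_ae \<mu> p f (g p) \<and> simple_approx_L1 \<mu> p f (g p) \<and>
        (\<lambda>n. p (x - simple_integral_on \<mu> E (g p n))) \<longlonglongrightarrow> 0)"


section \<open>B-locally convex spaces\<close>

text \<open>Nets are indexed by the continuous seminorms, directed by the pointwise order.\<close>

definition almost_same_net ::
  "'w measure \<Rightarrow> (('a::locally_convex_space \<Rightarrow> real) \<Rightarrow> 'w \<Rightarrow> 'a) \<Rightarrow> bool" where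
  "almost_same_net \<mu> f \<longleftrightarrow>
     (\<forall>p\<in>continuous_seminorms. \<forall>q\<in>continuous_seminorms. p \<le> q \<longrightarrow>
        (\<exists>Z\<in>null_sets \<mu>. \<forall>t\<in>space \<mu> - Z. p (f p t - f q t) = 0))"

definition almost_same_Bochner_net ::
  "'w measure \<Rightarrow> (('a::locally_convex_space \<Rightarrow> real) \<Rightarrow> 'w \<Rightarrow> 'a) \<Rightarrow> bool" where
  "almost_same_Bochner_net \<mu> f \<longleftrightarrow>
     almost_same_net \<mu> f \<and> (\<forall>s\<in>continuous_seminorms. Bochner_integrable_wrt \<mu> s (f s))"

text \<open>The property depends on the measure space as well as on the space \<open>'a\<close>.\<close>

definition B_locally_convex :: "'w measure \<Rightarrow> 'a::locally_convex_space itself \<Rightarrow> bool" where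
  "B_locally_convex \<mu> (_ :: 'a itself) \<longleftrightarrow>
     (\<forall>f :: ('a \<Rightarrow> real) \<Rightarrow> 'w \<Rightarrow> 'a. almost_same_Bochner_net \<mu> f \<longrightarrow>
        (\<exists>h :: 'w \<Rightarrow> 'a. \<forall>s\<in>continuous_seminorms.
           integrable \<mu> (\<lambda>t. s (h t - f s t)) \<and> (\<integral>t. s (h t - f s t) \<partial>\<mu>) = 0))"


section \<open>Multifunctions and multimeasures\<close>

definition is_Pettis_integral ::
  "'w measure \<Rightarrow> 'w set \<Rightarrow> ('w \<Rightarrow> 'a::locally_convex_space set) \<Rightarrow> 'a set \<Rightarrow> bool" where
  "is_Pettis_integral \<mu> E F C \<longleftrightarrow>
     C \<in> ck \<and>
     (\<forall>\<xi>\<in>topological_dual. support_fun \<xi> C = (\<integral>t\<in>E. support_fun \<xi> (F t) \<partial>\<mu>))"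

definition Pettis_integrable ::
  "'w measure \<Rightarrow> ('w \<Rightarrow> 'a::locally_convex_space set) \<Rightarrow> bool" where
  "Pettis_integrable \<mu> F \<longleftrightarrow>
     (\<forall>\<xi>\<in>topological_dual. integrable \<mu> (\<lambda>t. support_fun \<xi> (F t))) \<and>
     (\<forall>E\<in>sets \<mu>. \<exists>C. is_Pettis_integral \<mu> E F C)"

text \<open>A set in \<open>ck\<close> is determined by its support function (Hahn-Banach).\<close>

definition Pettis_integral ::
  "'w measure \<Rightarrow> 'w set \<Rightarrow> ('w \<Rightarrow> 'a::locally_convex_space set) \<Rightarrow> 'a set" where
  "Pettis_integral \<mu> E F = (THE C. is_Pettis_integral \<mu> E F C)"

definition unconditionally_convergent :: "(nat \<Rightarrow> 'a::locally_convex_space) \<Rightarrow> bool" where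
  "unconditionally_convergent x \<longleftrightarrow> (\<forall>\<pi>. bij \<pi> \<longrightarrow> summable (\<lambda>n. x (\<pi> n)))"

definition set_series :: "(nat \<Rightarrow> 'a::locally_convex_space set) \<Rightarrow> 'a set" where
  "set_series A = {s. \<exists>x. (\<forall>n. x n \<in> A n) \<and> unconditionally_convergent x \<and> x sums s}"

definition strong_multimeasure ::
  "'w measure \<Rightarrow> ('w set \<Rightarrow> 'a::locally_convex_space set) \<Rightarrow> bool" where
  "strong_multimeasure \<mu> M \<longleftrightarrow>
     (\<forall>E\<in>sets \<mu>. M E \<noteq> {}) \<and> M {} = {0} \<and>
     (\<forall>E :: nat \<Rightarrow> 'w set. range E \<subseteq> sets \<mu> \<longrightarrow> disjoint_family E \<longrightarrow>
        M (\<Union>n. E n) = set_series (\<lambda>n. M (E n)))"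

definition selector_of ::
  "'w measure \<Rightarrow> ('w set \<Rightarrow> 'a set) \<Rightarrow> ('w set \<Rightarrow> 'a) \<Rightarrow> bool" where
  "selector_of \<mu> M m \<longleftrightarrow> (\<forall>E\<in>sets \<mu>. m E \<in> M E)"

text \<open>The library's \<open>countably_additive\<close> is restricted to values in \<open>ennreal\<close>.\<close>

definition countably_additive_vec ::
  "'w measure \<Rightarrow> ('w set \<Rightarrow> 'a::locally_convex_space) \<Rightarrow> bool" where
  "countably_additive_vec \<mu> m \<longleftrightarrow>
     (\<forall>E :: nat \<Rightarrow> 'w set. range E \<subseteq> sets \<mu> \<longrightarrow> disjoint_family E \<longrightarrow>
        (\<lambda>n. m (E n)) sums m (\<Union>n. E n))"

definition strongly_measurable_selector ::
  "'w measure \<Rightarrow> ('a::locally_convex_space \<Rightarrow> real) \<Rightarrow> ('w \<Rightarrow> 'a set) \<Rightarrow> ('w \<Rightarrow> 'a) \<Rightarrow> bool" where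
  "strongly_measurable_selector \<mu> p F f \<longleftrightarrow>
     strongly_measurable_wrt \<mu> p f \<and>
     (\<exists>Z\<in>null_sets \<mu>. \<forall>t\<in>space \<mu> - Z. quot_map p (f t) \<in> quot_map p ` F t)"

definition measurable_by_seminorm_selector ::
  "'w measure \<Rightarrow> ('w \<Rightarrow> 'a::locally_convex_space set) \<Rightarrow> ('w \<Rightarrow> 'a) \<Rightarrow> bool" where
  "measurable_by_seminorm_selector \<mu> F f \<longleftrightarrow>
     measurable_by_seminorm \<mu> f \<and>
     (\<forall>p\<in>continuous_seminorms. strongly_measurable_selector \<mu> p F f)"

definition integrable_by_seminorm_selector ::
  "'w measure \<Rightarrow> ('w \<Rightarrow> 'a::locally_convex_space set) \<Rightarrow> ('w \<Rightarrow> 'a) \<Rightarrow> bool" where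
  "integrable_by_seminorm_selector \<mu> F f \<longleftrightarrow>
     integrable_by_seminorm \<mu> f \<and> measurable_by_seminorm_selector \<mu> F f"

end

theory Submission
  imports Defs "HOL-Probability.Conditional_Expectation"
begin

text \<open>
  The derivative \<open>F\<close> of the multimeasure \<open>M\<close> is built from its support functions. For a continuous
  functional \<open>\<xi>\<close>, the set function \<open>E \<mapsto> support_fun \<xi> (M E)\<close> is additive and dominated by a multiple
  of \<open>\<mu>\<close>, so it has a bounded density \<open>h\<^sub>\<xi>\<close>. If \<open>\<xi> \<mapsto> h\<^sub>\<xi> t\<close> were sublinear and below the
  support function of \<open>Q\<close> for every \<open>t\<close>, it would be the support function of a compact convex set
  \<open>F t \<subseteq> Q\<close> (\<open>sublinear_on_dual_is_support_fun\<close>), and \<open>M E\<close> would be the Pettis integral of \<open>F\<close>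
  over \<open>E\<close> by definition. But these inequalities hold only almost everywhere, and the exceptional sets
  depend on the functionals.
  
  The remedy is a lifting: an operator \<open>U\<close> that picks a representative in each class of essentially
  bounded functions such that inequalities almost everywhere become inequalities everywhere, and that is
  sublinear (\<open>sublinear_lifting_exists\<close>). It comes from a lower density, which is a choice of
  representatives of measurable sets that preserves intersections. Lower densities are
  extended from smaller to larger sigma-algebras by Zorn's lemma; the step for sequences of
  sigma-algebras rests on Levy's zero-one law for conditional probabilities.
  
  The lifting makes the construction of the derivative monotone in the set-valued measure
  (\<open>multimeasure_density\<close>). A countably additive selector \<open>m\<close> of \<open>M\<close> is a set-valued measure with
  one-point values contained in those of \<open>M\<close>, so its derivative is contained in \<open>F\<close> at every point. Any
  \<open>f\<close> that picks a point of the derivative of \<open>m\<close> at each \<open>t\<close> satisfies \<open>\<integral>\<^sub>E \<xi> \<circ> f = \<xi> (m E)\<close>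
  (\<open>point_valued_density\<close>), and having values in the compact set \<open>Q\<close> it is integrable by
  seminorm with integral \<open>m\<close> (\<open>ck_valued_integrable\<close>). This is the first claim.
  
  For the second claim, each \<open>x \<in> M E\<close> is the value at \<open>E\<close> of some additive selector of \<open>M\<close>, by
  Tychonoff's theorem (\<open>additive_selector_through_point\<close>), so it is an integral of a selector
  of \<open>F\<close>. Conversely, integrals over \<open>E\<close> of selectors of \<open>F\<close> satisfy all the inequalities
  that cut out \<open>M E\<close> (\<open>seminorm_integral_of_selector\<close>), by the Hahn-Banach separation theorem.
\<close>

section \<open>Conditional probabilities and the zero-one law\<close>

context finite_measure
begin

lemma integrable_indicator_finite: "A \<in> sets M \<Longrightarrow> integrable M (indicat_real A)"
  by (simp add: integrable_indicator_iff emeasure_eq_measure)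

definition sub_sigma_algebra :: "'a set set \<Rightarrow> bool" where
  "sub_sigma_algebra T \<longleftrightarrow> sigma_algebra (space M) T \<and> T \<subseteq> sets M"

definition cond_prob_of :: "'a set set \<Rightarrow> 'a set \<Rightarrow> 'a \<Rightarrow> real" where
  "cond_prob_of T A = real_cond_exp M (sigma (space M) T) (indicat_real A)"

lemma sub_sigma_algebra_subalgebra:
  assumes "sub_sigma_algebra T"
  shows "sets (sigma (space M) T) = T" "space (sigma (space M) T) = space M"
    "finite_measure_subalgebra M (sigma (space M) T)"
proof -
  show 1: "sets (sigma (space M) T) = T"
    using assms sigma_algebra.sets_measure_of_eq unfolding sub_sigma_algebra_def by blast
  show 2: "space (sigma (space M) T) = space M"
    by (simp add: space_measure_of_conv)
  show "finite_measure_subalgebra M (sigma (space M) T)"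
    using assms 1 2 unfolding sub_sigma_algebra_def
    by (intro finite_measure_subalgebra.intro finite_measure_axioms
        finite_measure_subalgebra_axioms.intro) (auto simp: subalgebra_def)
qed

lemma cond_prob_of_measurable:
  assumes "sub_sigma_algebra T"
  shows "cond_prob_of T A \<in> borel_measurable (sigma (space M) T)"
    "cond_prob_of T A \<in> borel_measurable M"
proof -
  interpret finite_measure_subalgebra M "sigma (space M) T"
    using sub_sigma_algebra_subalgebra(3)[OF assms] .
  show "cond_prob_of T A \<in> borel_measurable (sigma (space M) T)"
    unfolding cond_prob_of_def by (rule borel_measurable_cond_exp)
  show "cond_prob_of T A \<in> borel_measurable M"
    unfolding cond_prob_of_def by (rule borel_measurable_cond_exp2)
qed

lemma cond_prob_of_greater_set:
  assumes "sub_sigma_algebra T"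
  shows "{t \<in> space M. cond_prob_of T A t > c} \<in> T"
proof -
  have "{t \<in> space (sigma (space M) T). cond_prob_of T A t > c} \<in> sets (sigma (space M) T)"
    using cond_prob_of_measurable(1)[OF assms] by measurable
  then show ?thesis
    using sub_sigma_algebra_subalgebra(1,2)[OF assms] by simp
qed

lemma cond_prob_of_integrable:
  assumes "sub_sigma_algebra T" "A \<in> sets M"
  shows "integrable M (cond_prob_of T A)"
proof -
  interpret finite_measure_subalgebra M "sigma (space M) T"
    using sub_sigma_algebra_subalgebra(3)[OF assms(1)] .
  show ?thesis
    unfolding cond_prob_of_def using integrable_indicator_finite[OF assms(2)] by (intro real_cond_exp_int)
qed

lemma cond_prob_of_integral:
  assumes T: "sub_sigma_algebra T" and A: "A \<in> sets M" and C: "C \<in> T"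
  shows "(\<integral>t\<in>C. cond_prob_of T A t \<partial>M) = measure M (A \<inter> C)"
proof -
  interpret finite_measure_subalgebra M "sigma (space M) T"
    using sub_sigma_algebra_subalgebra(3)[OF T] .
  have "C \<in> sets M"
    using C T unfolding sub_sigma_algebra_def by blast
  have "(\<integral>t\<in>C. cond_prob_of T A t \<partial>M) = (\<integral>t\<in>C. indicat_real A t \<partial>M)"
    unfolding cond_prob_of_def
    by (rule real_cond_exp_intA[symmetric])
      (use A C sub_sigma_algebra_subalgebra(1)[OF T] integrable_indicator_finite in auto)
  also have "\<dots> = (\<integral>t. indicat_real (A \<inter> C) t \<partial>M)"
    unfolding set_lebesgue_integral_def
    by (rule Bochner_Integration.integral_cong) (auto simp: indicator_def)
  also have "\<dots> = measure M (A \<inter> C)"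
    using A \<open>C \<in> sets M\<close> by simp
  finally show ?thesis .
qed

lemma cond_prob_of_nonneg:
  assumes "sub_sigma_algebra T" "A \<in> sets M"
  shows "AE t in M. cond_prob_of T A t \<ge> 0"
proof -
  interpret finite_measure_subalgebra M "sigma (space M) T"
    using sub_sigma_algebra_subalgebra(3)[OF assms(1)] .
  show ?thesis
    unfolding cond_prob_of_def using assms(2) by (intro real_cond_exp_pos) auto
qed

lemma cond_prob_of_eq_indicator:
  assumes "sub_sigma_algebra T" "A \<in> T"
  shows "AE t in M. cond_prob_of T A t = indicat_real A t"
proof -
  interpret finite_measure_subalgebra M "sigma (space M) T"
    using sub_sigma_algebra_subalgebra(3)[OF assms(1)] .
  have "A \<in> sets M"
    using assms unfolding sub_sigma_algebra_def by blast
  then show ?thesis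
    unfolding cond_prob_of_def
    using assms(2) sub_sigma_algebra_subalgebra(1)[OF assms(1)]
    by (intro real_cond_exp_F_meas integrable_indicator_finite borel_measurable_indicator) auto
qed

lemma cond_prob_of_close:
  assumes T: "sub_sigma_algebra T" and A: "A \<in> sets M" and B: "B \<in> T"
  shows "AE t in M. \<bar>cond_prob_of T A t - indicat_real B t\<bar> \<le> cond_prob_of T (sym_diff A B) t"
proof -
  interpret finite_measure_subalgebra M "sigma (space M) T"
    using sub_sigma_algebra_subalgebra(3)[OF T] .
  let ?S = "sigma (space M) T"
  have B': "B \<in> sets M"
    using B T unfolding sub_sigma_algebra_def by blast
  have int: "integrable M (indicat_real A)" "integrable M (indicat_real B)"
    "integrable M (indicat_real (sym_diff A B))"
    using A B' by (auto intro!: integrable_indicator_finite)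
  have "AE t in M. real_cond_exp M ?S (\<lambda>t. indicat_real A t - indicat_real B t) t
      \<le> cond_prob_of T (sym_diff A B) t"
    unfolding cond_prob_of_def
    by (intro real_cond_exp_mono AE_I2 Bochner_Integration.integrable_diff
        Bochner_Integration.integrable_add int) (auto split: split_indicator)
  moreover have "AE t in M. real_cond_exp M ?S (\<lambda>t. indicat_real B t - indicat_real A t) t
      \<le> cond_prob_of T (sym_diff A B) t"
    unfolding cond_prob_of_def
    by (intro real_cond_exp_mono AE_I2 Bochner_Integration.integrable_diff
        Bochner_Integration.integrable_add int) (auto split: split_indicator)
  moreover have "AE t in M. real_cond_exp M ?S (\<lambda>t. indicat_real A t - indicat_real B t) t
      = cond_prob_of T A t - cond_prob_of T B t"
    unfolding cond_prob_of_def by (intro real_cond_exp_diff int)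
  moreover have "AE t in M. real_cond_exp M ?S (\<lambda>t. indicat_real B t - indicat_real A t) t
      = cond_prob_of T B t - cond_prob_of T A t"
    unfolding cond_prob_of_def by (intro real_cond_exp_diff int)
  moreover have "AE t in M. cond_prob_of T B t = indicat_real B t"
    by (rule cond_prob_of_eq_indicator[OF T B])
  ultimately show ?thesis
    by eventually_elim auto
qed

lemma cond_prob_of_Int:
  assumes T: "sub_sigma_algebra T" and A: "A \<in> sets M" and B: "B \<in> sets M"
  shows "AE t in M. cond_prob_of T A t + cond_prob_of T B t - 1 \<le> cond_prob_of T (A \<inter> B) t"
proof -
  interpret finite_measure_subalgebra M "sigma (space M) T"
    using sub_sigma_algebra_subalgebra(3)[OF T] .
  let ?S = "sigma (space M) T"
  have int: "integrable M (indicat_real A)" "integrable M (indicat_real B)"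
    "integrable M (indicat_real (A \<inter> B))" "integrable M (\<lambda>t. 1::real)"
    using A B by (auto intro!: integrable_indicator_finite)
  have "AE t in M. real_cond_exp M ?S (\<lambda>t. (indicat_real A t + indicat_real B t) - 1) t
      \<le> cond_prob_of T (A \<inter> B) t"
    unfolding cond_prob_of_def
    by (intro real_cond_exp_mono AE_I2 Bochner_Integration.integrable_diff
        Bochner_Integration.integrable_add int) (auto split: split_indicator)
  moreover have "AE t in M. real_cond_exp M ?S (\<lambda>t. (indicat_real A t + indicat_real B t) - 1) t
     = real_cond_exp M ?S (\<lambda>t. indicat_real A t + indicat_real B t) t - real_cond_exp M ?S (\<lambda>t. 1) t"
    by (intro real_cond_exp_diff int Bochner_Integration.integrable_add)
  moreover have "AE t in M. real_cond_exp M ?S (\<lambda>t. indicat_real A t + indicat_real B t) t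
     = cond_prob_of T A t + cond_prob_of T B t"
    unfolding cond_prob_of_def by (intro real_cond_exp_add int)
  moreover have "AE t in M. real_cond_exp M ?S (\<lambda>t. 1) t = 1"
    by (intro real_cond_exp_F_meas int) auto
  ultimately show ?thesis
    by eventually_elim auto
qed

text \<open>
  Doob's maximal inequality for the martingale of conditional probabilities. The sets
  \<open>disjointed D n\<close> on which the threshold \<open>d\<close> is first exceeded at time \<open>n\<close> lie in \<open>T n\<close>, so the
  conditional probability can be integrated over them: \<open>A\<close> fills at least the fraction \<open>d\<close> of each.
\<close>

lemma cond_prob_of_maximal:
  assumes T: "\<And>n::nat. sub_sigma_algebra (T n)" and inc: "\<And>n. T n \<subseteq> T (Suc n)"
    and A: "A \<in> sets M" and d: "d > 0"
  shows "d * measure M {t \<in> space M. \<exists>n. cond_prob_of (T n) A t > d} \<le> measure M A"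
proof -
  define D where "D n = {t \<in> space M. cond_prob_of (T n) A t > d}" for n
  have inc': "T m \<subseteq> T n" if "m \<le> n" for m n
    using that inc by (rule lift_Suc_mono_le[of T, rotated]) 
  have D: "D n \<in> T n" for n
    unfolding D_def by (rule cond_prob_of_greater_set[OF T])
  have dT: "disjointed D n \<in> T n" for n
  proof -
    interpret sigma_algebra "space M" "T n"
      using T unfolding sub_sigma_algebra_def by blast
    show ?thesis
      unfolding disjointed_def using D inc'[of _ n] by (intro Diff finite_UN) (auto dest: less_imp_le)
  qed
  have sub: "T n \<subseteq> sets M" for n
    using T unfolding sub_sigma_algebra_def by blast
  have dM: "range (disjointed D) \<subseteq> sets M"
    using dT sub by blast
  have each: "d * measure M (disjointed D n) \<le> measure M (A \<inter> disjointed D n)" for n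
  proof -
    have s: "disjointed D n \<in> sets M"
      using dM by blast
    have "d * measure M (disjointed D n) = (\<integral>t\<in>disjointed D n. d \<partial>M)"
      using s by (simp add: set_lebesgue_integral_def)
    also have "\<dots> \<le> (\<integral>t\<in>disjointed D n. cond_prob_of (T n) A t \<partial>M)"
    proof (rule set_integral_mono)
      show "set_integrable M (disjointed D n) (\<lambda>t. d)"
        using integrable_indicator_finite[OF s] by (simp add: set_integrable_def)
      show "set_integrable M (disjointed D n) (cond_prob_of (T n) A)"
        unfolding set_integrable_def
        using s cond_prob_of_integrable[OF T A] by (intro integrable_mult_indicator)
      show "d \<le> cond_prob_of (T n) A t" if "t \<in> disjointed D n" for t
        using that disjointed_subset[of D n] unfolding D_def by auto
    qed
    also have "\<dots> = measure M (A \<inter> disjointed D n)"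
      by (rule cond_prob_of_integral[OF T A dT])
    finally show ?thesis .
  qed
  have s1: "(\<lambda>n. d * measure M (disjointed D n)) sums (d * measure M (\<Union>n. disjointed D n))"
    using dM disjoint_family_disjointed by (intro sums_mult finite_measure_UNION)
  have s2: "(\<lambda>n. measure M (A \<inter> disjointed D n)) sums (measure M (\<Union>n. A \<inter> disjointed D n))"
    using dM A disjoint_family_disjointed[of D]
    by (intro finite_measure_UNION) (auto simp: disjoint_family_on_def)
  have "d * measure M (\<Union>n. disjointed D n) \<le> measure M (\<Union>n. A \<inter> disjointed D n)"
    by (rule sums_le[OF each s1 s2])
  also have "\<dots> \<le> measure M A"
    using A by (intro finite_measure_mono) auto
  also have "(\<Union>n. disjointed D n) = {t \<in> space M. \<exists>n. cond_prob_of (T n) A t > d}"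
    unfolding UN_disjointed_eq D_def by auto
  finally show ?thesis .
qed

text \<open>
  A set \<open>B\<close> of some \<open>T k\<close> that is close to \<open>A\<close> has its indicator as conditional probability from
  \<open>k\<close> on. Replacing \<open>A\<close> by \<open>B\<close> costs at most the conditional probabilities of the symmetric
  difference, and the maximal inequality bounds all of them at once outside a small set.
\<close>

lemma Levy_zero_one:
  assumes T: "\<And>n::nat. sub_sigma_algebra (T n)" and inc: "\<And>n. T n \<subseteq> T (Suc n)"
    and A: "A \<in> sets M"
    and approx: "\<And>e. e > 0 \<Longrightarrow> \<exists>n. \<exists>B\<in>T n. measure M (sym_diff A B) < e"
  shows "AE t in M. (\<lambda>n. cond_prob_of (T n) A t) \<longlonglongrightarrow> indicat_real A t"
proof -
  have sub: "T n \<subseteq> sets M" for n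
    using T unfolding sub_sigma_algebra_def by blast
  have meas[measurable]: "cond_prob_of (T n) C \<in> borel_measurable M" for n C
    by (rule cond_prob_of_measurable[OF T])
  note A[measurable]
  have inc': "T m \<subseteq> T n" if "m \<le> n" for m n
    using that inc by (rule lift_Suc_mono_le[of T, rotated]) 
  have ev: "AE t in M. \<exists>k. \<forall>m\<ge>k. \<bar>cond_prob_of (T m) A t - indicat_real A t\<bar> \<le> d"
    if d: "d > 0" for d :: real
  proof -
    \<comment> \<open>exceptional set for the accuracy \<open>d\<close>; its measure is at most \<open>e / d + e\<close> for every \<open>e\<close>\<close>
    define Bad where "Bad = {t \<in> space M. \<not> (\<exists>k. \<forall>m\<ge>k. \<bar>cond_prob_of (T m) A t - indicat_real A t\<bar> \<le> d)}"
    have Bad[measurable]: "Bad \<in> sets M"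
      unfolding Bad_def by measurable
    have "measure M Bad \<le> e / d + e" if e: "e > 0" for e
    proof -
      obtain k B where B: "B \<in> T k" "measure M (sym_diff A B) < e"
        using approx[OF e] by blast
      have BM[measurable]: "B \<in> sets M"
        using B sub by blast
      let ?S = "sym_diff A B"
      define P where "P = {t \<in> space M. \<exists>n. cond_prob_of (T n) ?S t > d}"
      have P[measurable]: "P \<in> sets M"
        unfolding P_def by measurable
      have "AE t in M. \<forall>m. m \<ge> k \<longrightarrow> \<bar>cond_prob_of (T m) A t - indicat_real B t\<bar> \<le> cond_prob_of (T m) ?S t"
        unfolding AE_all_countable
      proof
        fix m
        show "AE t in M. m \<ge> k \<longrightarrow> \<bar>cond_prob_of (T m) A t - indicat_real B t\<bar> \<le> cond_prob_of (T m) ?S t"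
        proof (cases "m \<ge> k")
          case True
          then have "B \<in> T m"
            using B inc' by blast
          from cond_prob_of_close[OF T A this] show ?thesis
            by eventually_elim auto
        qed auto
      qed
      then have "AE t in M. t \<in> Bad \<longrightarrow> t \<in> P \<union> ?S"
      proof (rule AE_mp, intro AE_I2 impI)
        fix t
        assume t: "t \<in> space M" "t \<in> Bad"
          and le: "\<forall>m. m \<ge> k \<longrightarrow> \<bar>cond_prob_of (T m) A t - indicat_real B t\<bar> \<le> cond_prob_of (T m) ?S t"
        show "t \<in> P \<union> ?S"
        proof (rule ccontr)
          assume n: "t \<notin> P \<union> ?S"
          then have "indicat_real A t = indicat_real B t"
            by (auto simp: indicator_def)
          moreover have "cond_prob_of (T m) ?S t \<le> d" for m
            using n t unfolding P_def by (auto simp: not_less)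
          ultimately have "\<forall>m\<ge>k. \<bar>cond_prob_of (T m) A t - indicat_real A t\<bar> \<le> d"
            using le order_trans by fastforce
          then show False
            using t unfolding Bad_def by blast
        qed
      qed
      then have "measure M Bad \<le> measure M (P \<union> ?S)"
        by (intro finite_measure_mono_AE) measurable
      also have "\<dots> \<le> measure M P + measure M ?S"
        by (rule measure_subadditive) (auto simp: emeasure_finite)
      also have "measure M P \<le> e / d"
      proof -
        have "d * measure M P \<le> measure M ?S"
          unfolding P_def by (rule cond_prob_of_maximal[where T=T, OF T inc _ d]) measurable
        then show ?thesis
          using B d by (simp add: field_simps)
      qed
      finally show ?thesis
        using B by simp
    qed
    then have "measure M Bad \<le> e" if "e > 0" for e
    proof -
      have "e / (1 / d + 1) > 0"
        using that d by (simp add: divide_simps add_pos_pos)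
      moreover have "e / (1 / d + 1) / d + e / (1 / d + 1) = e"
        using d by (simp add: divide_simps add_pos_pos) (simp add: algebra_simps)
      ultimately show ?thesis
        using \<open>\<And>e. e > 0 \<Longrightarrow> measure M Bad \<le> e / d + e\<close>[of "e / (1 / d + 1)"] by simp
    qed
    then have "measure M Bad \<le> 0"
      by (rule field_le_epsilon) simp
    then have "measure M Bad = 0"
      by (simp add: measure_le_0_iff)
    then have "Bad \<in> null_sets M"
      using Bad by (intro null_setsI) (auto simp: emeasure_eq_measure)
    then show ?thesis
      by (rule AE_I') (auto simp: Bad_def)
  qed
  have "AE t in M. \<forall>j::nat. \<exists>k. \<forall>m\<ge>k. \<bar>cond_prob_of (T m) A t - indicat_real A t\<bar> \<le> 1 / (Suc j)"
    unfolding AE_all_countable using ev by simp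
  then show ?thesis
  proof eventually_elim
    case (elim t)
    show ?case
    proof (rule LIMSEQ_I)
      fix r :: real
      assume "r > 0"
      then obtain j where "1 / real (Suc j) < r"
        using nat_approx_posE by (metis of_nat_Suc)
      moreover obtain k where "\<forall>m\<ge>k. \<bar>cond_prob_of (T m) A t - indicat_real A t\<bar> \<le> 1 / (Suc j)"
        using elim by blast
      ultimately show "\<exists>no. \<forall>n\<ge>no. norm (cond_prob_of (T n) A t - indicat_real A t) < r"
        by (metis le_less_trans real_norm_def)
    qed
  qed
qed

section \<open>Lower densities: adjoining one set\<close>

text \<open>
  A lower density chooses one representative \<open>A'\<close> from each class of measurable sets modulo null
  sets, compatibly with intersections. It is encoded by its graph: then an extension to a larger
  sigma-algebra (the domain) is an inclusion of graphs, and Zorn's lemma for \<open>\<subseteq>\<close> applies.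
\<close>

definition lower_density :: "('a set \<times> 'a set) set \<Rightarrow> bool" where
  "lower_density R \<longleftrightarrow> sub_sigma_algebra (Domain R) \<and>
     (\<forall>A A'. (A, A') \<in> R \<longrightarrow> A' \<subseteq> space M \<and> (AE t in M. t \<in> A' \<longleftrightarrow> t \<in> A)) \<and>
     (\<forall>A A' B B'. (A, A') \<in> R \<longrightarrow> (B, B') \<in> R \<longrightarrow> (AE t in M. t \<in> A \<longleftrightarrow> t \<in> B) \<longrightarrow> A' = B') \<and>
     (\<forall>A A' B B'. (A, A') \<in> R \<longrightarrow> (B, B') \<in> R \<longrightarrow> (A \<inter> B, A' \<inter> B') \<in> R) \<and>
     ({}, {}) \<in> R \<and> (space M, space M) \<in> R"

lemma lower_densityD:
  assumes "lower_density R"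
  shows "sub_sigma_algebra (Domain R)"
    "(A, A') \<in> R \<Longrightarrow> A' \<subseteq> space M"
    "(A, A') \<in> R \<Longrightarrow> AE t in M. t \<in> A' \<longleftrightarrow> t \<in> A"
    "(A, A') \<in> R \<Longrightarrow> (B, B') \<in> R \<Longrightarrow> (AE t in M. t \<in> A \<longleftrightarrow> t \<in> B) \<Longrightarrow> A' = B'"
    "(A, A') \<in> R \<Longrightarrow> (B, B') \<in> R \<Longrightarrow> (A \<inter> B, A' \<inter> B') \<in> R"
    "({}, {}) \<in> R" "(space M, space M) \<in> R"
  using assms unfolding lower_density_def by blast+

lemma lower_density_mono:
  assumes R: "lower_density R" and A: "(A, A') \<in> R" and B: "(B, B') \<in> R"
    and le: "AE t in M. t \<in> A \<longrightarrow> t \<in> B"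
  shows "A' \<subseteq> B'"
proof -
  have "AE t in M. t \<in> A \<inter> B \<longleftrightarrow> t \<in> A"
    using le by eventually_elim auto
  then have "A' \<inter> B' = A'"
    using lower_densityD(4)[OF R lower_densityD(5)[OF R A B] A] by simp
  then show ?thesis
    by blast
qed

definition density_set :: "('a set \<times> 'a set) set \<Rightarrow> 'a set \<Rightarrow> 'a set" where
  "density_set R A = (THE A'. (A, A') \<in> R)"

lemma density_set_eq:
  assumes R: "lower_density R" and A: "(A, A') \<in> R"
  shows "density_set R A = A'"
  unfolding density_set_def
  using A by (rule the_equality) (rule lower_densityD(4)[OF R _ A], auto)

lemma density_set_in:
  assumes R: "lower_density R" and A: "A \<in> Domain R"
  shows "(A, density_set R A) \<in> R"
  using A density_set_eq[OF R] by blast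

lemma density_set:
  assumes R: "lower_density R" and A: "A \<in> Domain R"
  shows "density_set R A \<subseteq> space M" "AE t in M. t \<in> density_set R A \<longleftrightarrow> t \<in> A"
    "B \<in> Domain R \<Longrightarrow> (AE t in M. t \<in> A \<longrightarrow> t \<in> B) \<Longrightarrow> density_set R A \<subseteq> density_set R B"
    "B \<in> Domain R \<Longrightarrow> (AE t in M. t \<in> A \<longleftrightarrow> t \<in> B) \<Longrightarrow> density_set R A = density_set R B"
    "B \<in> Domain R \<Longrightarrow> density_set R (A \<inter> B) = density_set R A \<inter> density_set R B"
proof -
  note in_R = density_set_in[OF R A]
  show "density_set R A \<subseteq> space M" "AE t in M. t \<in> density_set R A \<longleftrightarrow> t \<in> A"
    using lower_densityD(2,3)[OF R in_R] .
  assume B: "B \<in> Domain R"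
  note in_R' = density_set_in[OF R B]
  show "(AE t in M. t \<in> A \<longrightarrow> t \<in> B) \<Longrightarrow> density_set R A \<subseteq> density_set R B"
    by (rule lower_density_mono[OF R in_R in_R'])
  show "(AE t in M. t \<in> A \<longleftrightarrow> t \<in> B) \<Longrightarrow> density_set R A = density_set R B"
    by (rule lower_densityD(4)[OF R in_R in_R'])
  show "density_set R (A \<inter> B) = density_set R A \<inter> density_set R B"
    by (rule density_set_eq[OF R lower_densityD(5)[OF R in_R in_R']])
qed

lemma sub_sigma_algebraD:
  assumes "sub_sigma_algebra T"
  shows "{} \<in> T" "space M \<in> T" "A \<in> T \<Longrightarrow> space M - A \<in> T" "A \<in> T \<Longrightarrow> B \<in> T \<Longrightarrow> A \<union> B \<in> T"
    "A \<in> T \<Longrightarrow> B \<in> T \<Longrightarrow> A \<inter> B \<in> T" "A \<in> T \<Longrightarrow> B \<in> T \<Longrightarrow> A - B \<in> T"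
    "range (F::nat \<Rightarrow> _) \<subseteq> T \<Longrightarrow> (\<Union>n. F n) \<in> T" "A \<in> T \<Longrightarrow> A \<in> sets M"
proof -
  interpret sigma_algebra "space M" T
    using assms unfolding sub_sigma_algebra_def by blast
  show "{} \<in> T" "space M \<in> T" "A \<in> T \<Longrightarrow> space M - A \<in> T" "A \<in> T \<Longrightarrow> B \<in> T \<Longrightarrow> A \<union> B \<in> T"
    "A \<in> T \<Longrightarrow> B \<in> T \<Longrightarrow> A \<inter> B \<in> T" "A \<in> T \<Longrightarrow> B \<in> T \<Longrightarrow> A - B \<in> T"
    "range (F::nat \<Rightarrow> _) \<subseteq> T \<Longrightarrow> (\<Union>n. F n) \<in> T"
    by auto
  show "A \<in> T \<Longrightarrow> A \<in> sets M"
    using assms unfolding sub_sigma_algebra_def by blast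
qed

lemma sub_sigma_algebraI:
  assumes "T \<subseteq> sets M" "{} \<in> T" "\<And>A. A \<in> T \<Longrightarrow> space M - A \<in> T"
    "\<And>F. range (F::nat \<Rightarrow> _) \<subseteq> T \<Longrightarrow> (\<Union>n. F n) \<in> T"
  shows "sub_sigma_algebra T"
  using assms sets.space_closed unfolding sub_sigma_algebra_def sigma_algebra_iff2 by blast

text \<open>
  The hull of \<open>A\<close> in \<open>T\<close> is the set where the conditional probability of \<open>A\<close> is positive: over a
  set of \<open>T\<close> that misses \<open>A\<close>, this nonnegative function has integral zero.
\<close>

lemma sub_sigma_algebra_hull:
  assumes T: "sub_sigma_algebra T" and A: "A \<in> sets M"
  shows "\<exists>W\<in>T. (AE t in M. t \<in> A \<longrightarrow> t \<in> W) \<and>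
    (\<forall>C\<in>T. (AE t in M. \<not> (t \<in> C \<and> t \<in> A)) \<longrightarrow> (AE t in M. \<not> (t \<in> C \<and> t \<in> W)))"
proof (intro bexI conjI ballI impI)
  define W where "W = {t \<in> space M. cond_prob_of T A t > 0}"
  have nonneg: "AE t in M. cond_prob_of T A t \<ge> 0"
    by (rule cond_prob_of_nonneg[OF T A])
  have int: "integrable M (\<lambda>t. indicat_real C t * cond_prob_of T A t)" if "C \<in> T" for C
    using integrable_mult_indicator[OF sub_sigma_algebraD(8)[OF T that] cond_prob_of_integrable[OF T A]]
    by simp
  have zero: "(AE t in M. t \<in> C \<longrightarrow> cond_prob_of T A t = 0) \<longleftrightarrow> measure M (A \<inter> C) = 0" if C: "C \<in> T" for C
  proof -
    have "measure M (A \<inter> C) = (\<integral>t. indicat_real C t * cond_prob_of T A t \<partial>M)"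
      using cond_prob_of_integral[OF T A C] by (simp add: set_lebesgue_integral_def)
    also have "\<dots> = 0 \<longleftrightarrow> (AE t in M. indicat_real C t * cond_prob_of T A t = 0)"
      using nonneg by (intro integral_nonneg_eq_0_iff_AE int[OF C]) auto
    also have "\<dots> \<longleftrightarrow> (AE t in M. t \<in> C \<longrightarrow> cond_prob_of T A t = 0)"
      by (simp add: indicator_def)
    finally show ?thesis
      by simp
  qed
  have null: "measure M (A \<inter> C) = 0 \<longleftrightarrow> (AE t in M. \<not> (t \<in> C \<and> t \<in> A))" if C: "C \<in> T" for C
  proof -
    have "A \<inter> C \<in> sets M"
      using A sub_sigma_algebraD(8)[OF T C] by blast
    then have "measure M (A \<inter> C) = 0 \<longleftrightarrow> (AE t in M. t \<notin> A \<inter> C)"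
      by (subst AE_iff_null_sets[symmetric]) (auto simp: null_sets_def emeasure_eq_measure)
    also have "\<dots> \<longleftrightarrow> (AE t in M. \<not> (t \<in> C \<and> t \<in> A))"
      by (rule AE_cong) auto
    finally show ?thesis .
  qed
  show W: "W \<in> T"
    unfolding W_def by (rule cond_prob_of_greater_set[OF T])
  have "AE t in M. t \<in> space M - W \<longrightarrow> cond_prob_of T A t = 0"
    using nonneg by eventually_elim (auto simp: W_def)
  then have "AE t in M. \<not> (t \<in> space M - W \<and> t \<in> A)"
    using zero[of "space M - W"] null[of "space M - W"] sub_sigma_algebraD(3)[OF T W] by blast
  then show "AE t in M. t \<in> A \<longrightarrow> t \<in> W"
    using AE_space by eventually_elim auto
  fix C
  assume "C \<in> T" "AE t in M. \<not> (t \<in> C \<and> t \<in> A)"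
  then have "AE t in M. t \<in> C \<longrightarrow> cond_prob_of T A t = 0"
    using zero null by blast
  then show "AE t in M. \<not> (t \<in> C \<and> t \<in> W)"
    by eventually_elim (auto simp: W_def)
qed

text \<open>
  A set \<open>G\<close> generated by \<open>A\<close> and the domain \<open>T\<close> equals some \<open>B \<in> T\<close> on \<open>A\<close> and some \<open>C \<in> T\<close> off \<open>A\<close>,
  and its density should be that of \<open>B\<close> on \<open>A\<close> and that of \<open>C\<close> off \<open>A\<close>. This needs a canonical
  pair. Modulo null sets, \<open>G\<close> determines \<open>B\<close> on the hull \<open>W\<close> of \<open>A\<close> and \<open>C\<close> on the hull \<open>V\<close> of the
  complement, and nothing else. Requiring \<open>B = C\<close> off \<open>W \<inter> V\<close> makes the pair unique; for
  \<open>G \<in> T\<close> it is \<open>(G, G)\<close>, so the glued density extends the old one.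
\<close>

lemma lower_density_adjoin:
  assumes R: "lower_density R" and A: "A \<in> sets M"
  obtains S where "lower_density S" "R \<subseteq> S" "A \<in> Domain S"
proof -
  define T where "T = Domain R"
  have T: "sub_sigma_algebra T"
    using lower_densityD(1)[OF R] T_def by simp
  obtain W where W: "W \<in> T" "AE t in M. t \<in> A \<longrightarrow> t \<in> W"
    "\<And>C. C \<in> T \<Longrightarrow> (AE t in M. \<not> (t \<in> C \<and> t \<in> A)) \<Longrightarrow> AE t in M. \<not> (t \<in> C \<and> t \<in> W)"
    using sub_sigma_algebra_hull[OF T A] by blast
  obtain V where V: "V \<in> T" "AE t in M. t \<in> space M - A \<longrightarrow> t \<in> V"
    "\<And>C. C \<in> T \<Longrightarrow> (AE t in M. \<not> (t \<in> C \<and> t \<in> space M - A)) \<Longrightarrow> AE t in M. \<not> (t \<in> C \<and> t \<in> V)"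
    using sub_sigma_algebra_hull[OF T sets.compl_sets[OF A]] by blast
  define glues where "glues G B C \<longleftrightarrow> G \<in> sets M \<and> B \<in> T \<and> C \<in> T \<and>
      (AE t in M. t \<in> G \<longleftrightarrow> (if t \<in> A then t \<in> B else t \<in> C)) \<and>
      (AE t in M. t \<notin> W \<inter> V \<longrightarrow> (t \<in> B \<longleftrightarrow> t \<in> C))" for G B C
  define join where "join B C = (A \<inter> density_set R B) \<union> (density_set R C - A)" for B C
  define S where "S = {(G, join B C) | G B C. glues G B C}"
  have S_iff: "(G, G') \<in> S \<longleftrightarrow> (\<exists>B C. glues G B C \<and> G' = join B C)" for G G'
    unfolding S_def by blast
  have Dom: "Domain S = {G. \<exists>B C. glues G B C}"
    unfolding S_def by blast
  have unique: "join B C = join B2 C2"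
    if g1: "glues G B C" and g2: "glues G2 B2 C2" and eq: "AE t in M. t \<in> G \<longleftrightarrow> t \<in> G2"
    for G B C G2 B2 C2
  proof -
    have in_T: "B \<in> T" "C \<in> T" "B2 \<in> T" "C2 \<in> T"
      using g1 g2 unfolding glues_def by auto
    have g: "AE t in M. t \<in> G \<longleftrightarrow> (if t \<in> A then t \<in> B else t \<in> C)"
      "AE t in M. t \<notin> W \<inter> V \<longrightarrow> (t \<in> B \<longleftrightarrow> t \<in> C)"
      "AE t in M. t \<in> G2 \<longleftrightarrow> (if t \<in> A then t \<in> B2 else t \<in> C2)"
      "AE t in M. t \<notin> W \<inter> V \<longrightarrow> (t \<in> B2 \<longleftrightarrow> t \<in> C2)"
      using g1 g2 unfolding glues_def by auto
    have "AE t in M. \<not> (t \<in> sym_diff B B2 \<and> t \<in> A)"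
      using g(1,3) eq by eventually_elim auto
    then have 1: "AE t in M. \<not> (t \<in> sym_diff B B2 \<and> t \<in> W)"
      using in_T sub_sigma_algebraD[OF T] by (intro W(3)) auto
    have "AE t in M. \<not> (t \<in> sym_diff C C2 \<and> t \<in> space M - A)"
      using g(1,3) eq by eventually_elim auto
    then have 2: "AE t in M. \<not> (t \<in> sym_diff C C2 \<and> t \<in> V)"
      using in_T sub_sigma_algebraD[OF T] by (intro V(3)) auto
    have "AE t in M. t \<in> B \<longleftrightarrow> t \<in> B2"
      using 1 2 g W(2) V(2) AE_space by eventually_elim auto
    moreover have "AE t in M. t \<in> C \<longleftrightarrow> t \<in> C2"
      using 1 2 g W(2) V(2) AE_space by eventually_elim auto
    ultimately show ?thesis
      using in_T density_set(4)[OF R, of B B2] density_set(4)[OF R, of C C2]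
      unfolding join_def T_def by auto
  qed
  have ext: "(G, G') \<in> S" if "(G, G') \<in> R" for G G'
  proof -
    have "G \<in> T"
      using that T_def by blast
    then have "glues G G G"
      using sub_sigma_algebraD(8)[OF T] unfolding glues_def by auto
    moreover have "join G G = G'"
      using density_set_eq[OF R that] unfolding join_def by auto
    ultimately show ?thesis
      unfolding S_iff by blast
  qed
  have "lower_density S"
    unfolding lower_density_def
  proof (intro conjI allI impI)
    show "sub_sigma_algebra (Domain S)"
    proof (rule sub_sigma_algebraI)
      show "Domain S \<subseteq> sets M"
        unfolding Dom glues_def by blast
      show "{} \<in> Domain S"
        using ext lower_densityD(6)[OF R] by blast
    next
      fix G
      assume "G \<in> Domain S"
      then obtain B C where g: "glues G B C"
        unfolding Dom by blast
      have "glues (space M - G) (space M - B) (space M - C)"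
        unfolding glues_def
      proof (intro conjI)
        show "space M - G \<in> sets M" "space M - B \<in> T" "space M - C \<in> T"
          using g sub_sigma_algebraD(3)[OF T] unfolding glues_def by auto
        have g': "AE t in M. t \<in> G \<longleftrightarrow> (if t \<in> A then t \<in> B else t \<in> C)"
            "AE t in M. t \<notin> W \<inter> V \<longrightarrow> (t \<in> B \<longleftrightarrow> t \<in> C)"
          using g unfolding glues_def by auto
        show "AE t in M. t \<in> space M - G \<longleftrightarrow> (if t \<in> A then t \<in> space M - B else t \<in> space M - C)"
          using g'(1) by eventually_elim auto
        show "AE t in M. t \<notin> W \<inter> V \<longrightarrow> (t \<in> space M - B \<longleftrightarrow> t \<in> space M - C)"
          using g'(2) by eventually_elim auto
      qed
      then show "space M - G \<in> Domain S"
        unfolding Dom by blast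
    next
      fix F :: "nat \<Rightarrow> 'a set"
      assume "range F \<subseteq> Domain S"
      then have "\<forall>n. \<exists>B C. glues (F n) B C"
        unfolding Dom by blast
      then obtain B C where g: "\<And>n. glues (F n) (B n) (C n)"
        by metis
      have "glues (\<Union>n. F n) (\<Union>n. B n) (\<Union>n. C n)"
        unfolding glues_def
      proof (intro conjI)
        show "(\<Union>n. F n) \<in> sets M" "(\<Union>n. B n) \<in> T" "(\<Union>n. C n) \<in> T"
          using g sub_sigma_algebraD(7)[OF T] unfolding glues_def by auto
        have "AE t in M. \<forall>n. t \<in> F n \<longleftrightarrow> (if t \<in> A then t \<in> B n else t \<in> C n)"
          "AE t in M. \<forall>n. t \<notin> W \<inter> V \<longrightarrow> (t \<in> B n \<longleftrightarrow> t \<in> C n)"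
          unfolding AE_all_countable using g unfolding glues_def by auto
        then show "AE t in M. t \<in> (\<Union>n. F n) \<longleftrightarrow> (if t \<in> A then t \<in> (\<Union>n. B n) else t \<in> (\<Union>n. C n))"
          "AE t in M. t \<notin> W \<inter> V \<longrightarrow> (t \<in> (\<Union>n. B n) \<longleftrightarrow> t \<in> (\<Union>n. C n))"
          by (eventually_elim; auto)+
      qed
      then show "(\<Union>n. F n) \<in> Domain S"
        unfolding Dom by blast
    qed
    show "({}, {}) \<in> S" "(space M, space M) \<in> S"
      using ext lower_densityD(6,7)[OF R] by auto
  next
    fix G G'
    assume "(G, G') \<in> S"
    then obtain B C where g: "glues G B C" and G': "G' = join B C"
      unfolding S_iff by blast
    have in_T: "B \<in> Domain R" "C \<in> Domain R"
      using g unfolding glues_def T_def by auto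
    show "G' \<subseteq> space M"
      using density_set(1)[OF R] in_T unfolding G' join_def by auto
    have "AE t in M. t \<in> G \<longleftrightarrow> (if t \<in> A then t \<in> B else t \<in> C)"
      using g unfolding glues_def by auto
    then show "AE t in M. t \<in> G' \<longleftrightarrow> t \<in> G"
      using density_set(2)[OF R in_T(1)] density_set(2)[OF R in_T(2)]
      by eventually_elim (auto simp: G' join_def)
  next
    fix G G' H H'
    assume "(G, G') \<in> S" "(H, H') \<in> S"
    then obtain B C B2 C2 where g: "glues G B C" "glues H B2 C2" and G': "G' = join B C" "H' = join B2 C2"
      unfolding S_iff by blast
    show "AE t in M. t \<in> G \<longleftrightarrow> t \<in> H \<Longrightarrow> G' = H'"
      unfolding G' by (rule unique[OF g])
    have in_T: "B \<in> Domain R" "C \<in> Domain R" "B2 \<in> Domain R" "C2 \<in> Domain R"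
      using g unfolding glues_def T_def by auto
    have "glues (G \<inter> H) (B \<inter> B2) (C \<inter> C2)"
      unfolding glues_def
    proof (intro conjI)
      show "G \<inter> H \<in> sets M" "B \<inter> B2 \<in> T" "C \<inter> C2 \<in> T"
        using g sub_sigma_algebraD(5)[OF T] unfolding glues_def by auto
      have g': "AE t in M. t \<in> G \<longleftrightarrow> (if t \<in> A then t \<in> B else t \<in> C)"
        "AE t in M. t \<notin> W \<inter> V \<longrightarrow> (t \<in> B \<longleftrightarrow> t \<in> C)"
        "AE t in M. t \<in> H \<longleftrightarrow> (if t \<in> A then t \<in> B2 else t \<in> C2)"
        "AE t in M. t \<notin> W \<inter> V \<longrightarrow> (t \<in> B2 \<longleftrightarrow> t \<in> C2)"
        using g unfolding glues_def by auto
      show "AE t in M. t \<in> G \<inter> H \<longleftrightarrow> (if t \<in> A then t \<in> B \<inter> B2 else t \<in> C \<inter> C2)"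
        using g'(1,3) by eventually_elim auto
      show "AE t in M. t \<notin> W \<inter> V \<longrightarrow> (t \<in> B \<inter> B2 \<longleftrightarrow> t \<in> C \<inter> C2)"
        using g'(2,4) by eventually_elim auto
    qed
    moreover have "G' \<inter> H' = join (B \<inter> B2) (C \<inter> C2)"
      unfolding G' join_def density_set(5)[OF R in_T(1,3)] density_set(5)[OF R in_T(2,4)] by auto
    ultimately show "(G \<inter> H, G' \<inter> H') \<in> S"
      unfolding S_iff by blast
  qed
  moreover have "R \<subseteq> S"
    using ext by auto
  moreover have "glues A W (space M - V)"
    unfolding glues_def
  proof (intro conjI)
    show "A \<in> sets M" "W \<in> T" "space M - V \<in> T"
      using A W(1) V(1) sub_sigma_algebraD(3)[OF T] by auto
    show "AE t in M. t \<in> A \<longleftrightarrow> (if t \<in> A then t \<in> W else t \<in> space M - V)"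
      using W(2) V(2) by eventually_elim auto
    show "AE t in M. t \<notin> W \<inter> V \<longrightarrow> (t \<in> W \<longleftrightarrow> t \<in> space M - V)"
      using W(2) V(2) AE_space by eventually_elim auto
  qed
  then have "A \<in> Domain S"
    unfolding Dom by blast
  ultimately show ?thesis
    using that by blast
qed

section \<open>Lower densities: increasing sequences\<close>

text \<open>
  The closure in measure of \<open>\<Union>n. T n\<close> is the sigma-algebra on which the limit density will be
  defined: its members are the sets that satisfy the hypothesis of the zero-one law.
\<close>

lemma approximable_sets_sub_sigma_algebra:
  assumes T: "\<And>n::nat. sub_sigma_algebra (T n)" and inc: "\<And>n. T n \<subseteq> T (Suc n)"
  shows "sub_sigma_algebra {A \<in> sets M. \<forall>e>0. \<exists>n. \<exists>B\<in>T n. measure M (sym_diff A B) < e}"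
    (is "sub_sigma_algebra ?L")
proof (rule sub_sigma_algebraI)
  note TM = sub_sigma_algebraD(8)[OF T]
  have inc': "T m \<subseteq> T n" if "m \<le> n" for m n
    using that inc by (rule lift_Suc_mono_le[of T, rotated])
  show "?L \<subseteq> sets M"
    by blast
  show emp: "{} \<in> ?L"
    using sub_sigma_algebraD(1)[OF T] by (auto intro!: bexI[of _ "{}"])
  show "space M - A \<in> ?L" if A: "A \<in> ?L" for A
  proof (clarify, intro conjI allI impI)
    show "space M - A \<in> sets M"
      using A by blast
    fix e :: real
    assume "e > 0"
    then obtain n B where B: "B \<in> T n" "measure M (sym_diff A B) < e"
      using A by blast
    have "sym_diff (space M - A) (space M - B) = sym_diff A B"
      using A TM[OF B(1)] sets.sets_into_space by blast
    then show "\<exists>n. \<exists>B\<in>T n. measure M (sym_diff (space M - A) B) < e"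
      using B(2) sub_sigma_algebraD(3)[OF T B(1)] by (intro exI[of _ n] bexI[of _ "space M - B"]) simp_all
  qed
  have Un: "A \<union> A' \<in> ?L" if A: "A \<in> ?L" "A' \<in> ?L" for A A'
  proof (clarify, intro conjI allI impI)
    show "A \<union> A' \<in> sets M"
      using A by blast
    fix e :: real
    assume "e > 0"
    then have "e / 2 > 0"
      by simp
    then obtain n B n' B' where B: "B \<in> T n" "measure M (sym_diff A B) < e / 2"
      and B': "B' \<in> T n'" "measure M (sym_diff A' B') < e / 2"
      using A by blast
    have "measure M (sym_diff (A \<union> A') (B \<union> B')) \<le> measure M (sym_diff A B \<union> sym_diff A' B')"
      using A TM[OF B(1)] TM[OF B'(1)] by (intro finite_measure_mono) auto
    also have "\<dots> \<le> measure M (sym_diff A B) + measure M (sym_diff A' B')"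
      using A TM[OF B(1)] TM[OF B'(1)] by (intro measure_Un_le) auto
    also have "\<dots> < e"
      using B B' by simp
    finally have "measure M (sym_diff (A \<union> A') (B \<union> B')) < e" .
    moreover have "B \<union> B' \<in> T (max n n')"
      using B(1) B'(1) inc'[of n "max n n'"] inc'[of n' "max n n'"]
      by (intro sub_sigma_algebraD(4)[OF T]) auto
    ultimately show "\<exists>n. \<exists>B\<in>T n. measure M (sym_diff (A \<union> A') B) < e"
      by blast
  qed
  show "(\<Union>n. F n) \<in> ?L" if F: "range F \<subseteq> ?L" for F :: "nat \<Rightarrow> 'a set"
  proof (clarify, intro conjI allI impI)
    have FM: "F n \<in> sets M" for n
      using F by blast
    then show UF: "(\<Union>n. F n) \<in> sets M"
      by blast
    fix e :: real
    assume e: "e > 0"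
    define P where "P N = (\<Union>n<N. F n)" for N
    have PM: "P N \<in> sets M" for N
      unfolding P_def using FM by blast
    have PL: "P N \<in> ?L" for N
    proof (induction N)
      case 0
      then show ?case
        using emp by (simp add: P_def)
    next
      case (Suc N)
      have "P (Suc N) = P N \<union> F N"
        unfolding P_def by (auto simp: less_Suc_eq)
      then show ?case
        using Un[OF Suc, of "F N"] F by (simp add: image_subset_iff)
    qed
    have UP: "(\<Union>N. P N) = (\<Union>n. F n)"
      unfolding P_def by auto
    have "(\<lambda>N. measure M (P N)) \<longlonglongrightarrow> measure M (\<Union>N. P N)"
    proof (rule finite_Lim_measure_incseq)
      show "range P \<subseteq> sets M"
        using PM by blast
      show "incseq P"
        unfolding P_def by (intro monoI UN_mono) auto
    qed
    then obtain N where "\<bar>measure M (P N) - measure M (\<Union>n. F n)\<bar> < e / 2"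
      using e LIMSEQ_D[of _ _ "e/2"] unfolding UP by fastforce
    moreover have "measure M ((\<Union>n. F n) - P N) = measure M (\<Union>n. F n) - measure M (P N)"
      using UF PM by (intro finite_measure_Diff) (auto simp: P_def)
    ultimately have 1: "measure M ((\<Union>n. F n) - P N) < e / 2"
      by linarith
    obtain n B where B: "B \<in> T n" "measure M (sym_diff (P N) B) < e / 2"
      using PL[of N] half_gt_zero[OF e] by blast
    have "measure M (sym_diff (\<Union>n. F n) B) \<le> measure M (((\<Union>n. F n) - P N) \<union> sym_diff (P N) B)"
      using UF PM TM[OF B(1)] by (intro finite_measure_mono) (auto simp: P_def)
    also have "\<dots> \<le> measure M ((\<Union>n. F n) - P N) + measure M (sym_diff (P N) B)"
      using UF PM TM[OF B(1)] by (intro measure_Un_le) auto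
    also have "\<dots> < e"
      using 1 B by simp
    finally show "\<exists>n. \<exists>B\<in>T n. measure M (sym_diff (\<Union>n. F n) B) < e"
      using B(1) by blast
  qed
qed

lemma cond_prob_of_mono:
  assumes T: "sub_sigma_algebra T" and A: "A \<in> sets M" and B: "B \<in> sets M"
    and le: "AE t in M. t \<in> A \<longrightarrow> t \<in> B"
  shows "AE t in M. cond_prob_of T A t \<le> cond_prob_of T B t"
proof -
  interpret finite_measure_subalgebra M "sigma (space M) T"
    using sub_sigma_algebra_subalgebra(3)[OF T] .
  have "AE t in M. indicat_real A t \<le> indicat_real B t"
    using le by eventually_elim (auto split: split_indicator)
  then show ?thesis
    unfolding cond_prob_of_def using integrable_indicator_finite A B
    by (intro real_cond_exp_mono)
qed

text \<open>
  A point lies in the limit density of \<open>A\<close> if, for each \<open>e\<close>, it lies in the densities of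
  \<open>{cond_prob_of (T m) A > 1 - e}\<close> for all large \<open>m\<close>. The zero-one law shows that this is \<open>A\<close> almost
  everywhere. If \<open>A\<close> is in \<open>T n\<close>, the conditional probability is the indicator of \<open>A\<close> for
  \<open>m \<ge> n\<close>, so the value does not change. Compatibility with intersections comes from
  \<open>cond_prob_of_Int\<close>, with \<open>e\<close> split into two halves.
\<close>

lemma lower_density_limit:
  fixes R :: "nat \<Rightarrow> ('a set \<times> 'a set) set"
  assumes R: "\<And>n. lower_density (R n)" and inc: "\<And>n. R n \<subseteq> R (Suc n)"
  obtains S where "lower_density S" "\<And>n. R n \<subseteq> S"
proof -
  define T where "T n = Domain (R n)" for n
  have T: "sub_sigma_algebra (T n)" for n
    unfolding T_def by (rule lower_densityD(1)[OF R])
  have Tinc: "T n \<subseteq> T (Suc n)" for n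
    unfolding T_def using inc by blast
  have inc': "R m \<subseteq> R n" if "m \<le> n" for m n
    using that inc by (rule lift_Suc_mono_le[of R, rotated])
  note TM = sub_sigma_algebraD(8)[OF T]
  define L where "L = {A \<in> sets M. \<forall>e>0. \<exists>n. \<exists>B\<in>T n. measure M (sym_diff A B) < e}"
  have L: "sub_sigma_algebra L"
    unfolding L_def by (rule approximable_sets_sub_sigma_algebra[of T, OF T Tinc])
  have TL: "T n \<subseteq> L" for n
  proof
    fix A
    assume A: "A \<in> T n"
    then have "\<exists>n. \<exists>B\<in>T n. measure M (sym_diff A B) < e" if "e > 0" for e :: real
      using that by (auto intro!: exI[of _ n] bexI[of _ A])
    then show "A \<in> L"
      unfolding L_def using TM[OF A] by blast
  qed
  note LM = sub_sigma_algebraD(8)[OF L]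
  define D where "D m e A = {t \<in> space M. cond_prob_of (T m) A t > 1 - e}" for m e A
  have DT: "D m e A \<in> Domain (R m)" for m e A
    using cond_prob_of_greater_set[OF T] unfolding D_def T_def by auto
  define th where "th m e A = density_set (R m) (D m e A)" for m e A
  \<comment> \<open>for \<open>A \<in> T m\<close> and \<open>0 < e < 1\<close>, the set \<open>D m e A\<close> is \<open>A\<close> almost everywhere\<close>
  define lam where "lam A = {t \<in> space M. \<forall>e. 0 < e \<and> e < 1 \<longrightarrow> (\<exists>n. \<forall>m\<ge>n. t \<in> th m e A)}" for A
  have th_mono: "th m e A \<subseteq> th m e' B"
    if "AE t in M. t \<in> A \<longrightarrow> t \<in> B" "A \<in> L" "B \<in> L" "e \<le> e'" for m e e' A B
  proof -
    have "AE t in M. t \<in> D m e A \<longrightarrow> t \<in> D m e' B"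
      using cond_prob_of_mono[OF T[of m] LM[OF that(2)] LM[OF that(3)] that(1)]
      by eventually_elim (use that(4) in \<open>auto simp: D_def\<close>)
    then show ?thesis
      unfolding th_def by (rule density_set(3)[OF R DT DT])
  qed
  have lam_mono: "lam A \<subseteq> lam B" if "AE t in M. t \<in> A \<longrightarrow> t \<in> B" "A \<in> L" "B \<in> L" for A B
    unfolding lam_def using th_mono[OF that order_refl] by blast
  have lam_Int: "lam (A \<inter> B) = lam A \<inter> lam B" if A: "A \<in> L" and B: "B \<in> L" for A B
  proof
    have AB: "A \<inter> B \<in> L"
      by (rule sub_sigma_algebraD(5)[OF L A B])
    show "lam (A \<inter> B) \<subseteq> lam A \<inter> lam B"
      using lam_mono[OF _ AB A] lam_mono[OF _ AB B] by auto
    show "lam A \<inter> lam B \<subseteq> lam (A \<inter> B)"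
    proof
      fix t
      assume t: "t \<in> lam A \<inter> lam B"
      have "\<exists>n. \<forall>m\<ge>n. t \<in> th m e (A \<inter> B)" if e: "0 < e" "e < 1" for e
      proof -
        have "0 < e / 2" "e / 2 < 1"
          using e by auto
        then obtain n n' where n: "\<forall>m\<ge>n. t \<in> th m (e / 2) A" "\<forall>m\<ge>n'. t \<in> th m (e / 2) B"
          using t unfolding lam_def by blast
        have "th m (e / 2) A \<inter> th m (e / 2) B \<subseteq> th m e (A \<inter> B)" for m
        proof -
          have "AE t in M. t \<in> D m (e / 2) A \<inter> D m (e / 2) B \<longrightarrow> t \<in> D m e (A \<inter> B)"
            using cond_prob_of_Int[OF T LM[OF A] LM[OF B], of m]
            by eventually_elim (auto simp: D_def)
          moreover have "D m (e / 2) A \<inter> D m (e / 2) B \<in> Domain (R m)"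
            using sub_sigma_algebraD(5)[OF T] DT unfolding T_def by blast
          ultimately show ?thesis
            unfolding th_def density_set(5)[OF R DT DT, symmetric]
            by (intro density_set(3)[OF R _ DT])
        qed
        then have "\<forall>m\<ge>max n n'. t \<in> th m e (A \<inter> B)"
          using n by (auto simp: subset_iff)
        then show ?thesis ..
      qed
      then show "t \<in> lam (A \<inter> B)"
        using t unfolding lam_def by blast
    qed
  qed
  have lam_AE: "AE t in M. t \<in> lam A \<longleftrightarrow> t \<in> A" if A: "A \<in> L" for A
  proof -
    \<comment> \<open>countably many \<open>e\<close> suffice, as \<open>th m e A\<close> increases with \<open>e\<close>; all are below \<open>1\<close>,
      and \<open>j = 0\<close> gives the threshold \<open>1 / 2\<close> that separates the two values of an indicator\<close>
    have "AE t in M. \<forall>m j. t \<in> th m (1 / (real j + 2)) A \<longleftrightarrow> t \<in> D m (1 / (real j + 2)) A"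
      unfolding AE_all_countable th_def using density_set(2)[OF R DT] by blast
    moreover have "AE t in M. (\<lambda>n. cond_prob_of (T n) A t) \<longlonglongrightarrow> indicat_real A t"
      using A unfolding L_def by (intro Levy_zero_one T Tinc) auto
    ultimately show ?thesis
      using AE_space
    proof eventually_elim
      case (elim t)
      show ?case
      proof
        assume "t \<in> lam A"
        then obtain n where "\<forall>m\<ge>n. t \<in> th m (1 / (real 0 + 2)) A"
          unfolding lam_def by force
        then have "\<forall>m\<ge>n. t \<in> D m (1 / (real 0 + 2)) A"
          using elim(1) by blast
        then have "\<forall>m\<ge>n. cond_prob_of (T m) A t \<ge> 1 / 2"
          by (auto simp: D_def less_imp_le)
        then have "indicat_real A t \<ge> 1 / 2"
          by (intro tendsto_lowerbound[OF elim(2)]) (auto simp: eventually_sequentially)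
        then show "t \<in> A"
          by (auto split: split_indicator_asm)
      next
        assume tA: "t \<in> A"
        have "\<exists>n. \<forall>m\<ge>n. t \<in> th m e A" if e: "0 < e" "e < 1" for e
        proof -
          obtain j where "1 / real (Suc j) < e"
            using nat_approx_posE[OF e(1)] by (metis of_nat_Suc)
          moreover have "1 / (real j + 2) \<le> 1 / real (Suc j)"
            by (simp add: frac_le)
          ultimately have je: "1 / (real j + 2) \<le> e"
            by linarith
          have "1 - 1 / (real j + 2) < indicat_real A t"
            using tA by simp
          then have "\<forall>\<^sub>F m in sequentially. 1 - 1 / (real j + 2) < cond_prob_of (T m) A t"
            by (rule order_tendstoD(1)[OF elim(2)])
          then obtain n where "\<forall>m\<ge>n. t \<in> D m (1 / (real j + 2)) A"
            using elim(3) unfolding D_def eventually_sequentially by blast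
          then have "\<forall>m\<ge>n. t \<in> th m (1 / (real j + 2)) A"
            using elim(1) by blast
          then show ?thesis
            using th_mono[OF _ A A je] by auto
        qed
        then show "t \<in> lam A"
          using elim(3) unfolding lam_def by blast
      qed
    qed
  qed
  have lam_ext: "lam A = A'" if RA: "(A, A') \<in> R n" for A A' n
  proof -
    have th_eq: "th m e A = A'" if "m \<ge> n" "0 < e" "e < 1" for m e
    proof -
      have RA': "(A, A') \<in> R m"
        using inc'[OF \<open>m \<ge> n\<close>] RA by blast
      then have "AE t in M. cond_prob_of (T m) A t = indicat_real A t"
        by (intro cond_prob_of_eq_indicator[OF T]) (auto simp: T_def)
      then have "AE t in M. t \<in> D m e A \<longleftrightarrow> t \<in> A"
        using AE_space by eventually_elim (use that in \<open>auto simp: D_def split: split_indicator_asm\<close>)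
      then have "th m e A = density_set (R m) A"
        unfolding th_def using RA' by (intro density_set(4)[OF R DT]) auto
      then show ?thesis
        using density_set_eq[OF R RA'] by simp
    qed
    have "A' \<subseteq> space M"
      by (rule lower_densityD(2)[OF R RA])
    moreover have "(\<exists>k. \<forall>m\<ge>k. t \<in> th m e A) \<longleftrightarrow> t \<in> A'" if e: "0 < e" "e < 1" for t e
    proof
      assume "\<exists>k. \<forall>m\<ge>k. t \<in> th m e A"
      then obtain k where "\<forall>m\<ge>k. t \<in> th m e A" ..
      then have "t \<in> th (max n k) e A"
        by simp
      then show "t \<in> A'"
        using th_eq[OF _ e] by simp
    next
      assume "t \<in> A'"
      then show "\<exists>k. \<forall>m\<ge>k. t \<in> th m e A"
        using th_eq[OF _ e] by blast
    qed
    moreover have "0 < (1/2::real) \<and> (1/2::real) < 1"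
      by simp
    ultimately show ?thesis
      unfolding lam_def by blast
  qed
  define S where "S = {(A, lam A) | A. A \<in> L}"
  have Dom: "Domain S = L"
    unfolding S_def by blast
  have RS: "R n \<subseteq> S" for n
  proof
    fix x
    assume x: "x \<in> R n"
    obtain A A' where xA: "x = (A, A')"
      by (cases x)
    have "A \<in> T n"
      using x xA T_def by auto
    then have "A \<in> L"
      using TL by blast
    then show "x \<in> S"
      unfolding S_def xA using lam_ext[of A A' n] x xA by auto
  qed
  have "lower_density S"
    unfolding lower_density_def
  proof (intro conjI allI impI)
    show "sub_sigma_algebra (Domain S)"
      using L Dom by simp
    show "({}, {}) \<in> S" "(space M, space M) \<in> S"
      using RS[of 0] lower_densityD(6,7)[OF R, of 0] by auto
  next
    fix A A'
    assume "(A, A') \<in> S"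
    then have A: "A \<in> L" "A' = lam A"
      unfolding S_def by auto
    then show "A' \<subseteq> space M" "AE t in M. t \<in> A' \<longleftrightarrow> t \<in> A"
      using lam_AE by (auto simp: lam_def)
    fix B B'
    assume "(B, B') \<in> S"
    then have B: "B \<in> L" "B' = lam B"
      unfolding S_def by auto
    show "(A \<inter> B, A' \<inter> B') \<in> S"
      unfolding S_def using A B lam_Int sub_sigma_algebraD(5)[OF L] by auto
    show "A' = B'" if eq: "AE t in M. t \<in> A \<longleftrightarrow> t \<in> B"
    proof -
      have "AE t in M. t \<in> A \<longrightarrow> t \<in> B" "AE t in M. t \<in> B \<longrightarrow> t \<in> A"
        using eq by (eventually_elim; auto)+
      then show ?thesis
        using lam_mono A B by blast
    qed
  qed
  then show ?thesis
    using that RS by blast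
qed

section \<open>Existence of a sublinear lifting\<close>

text \<open>
  On a null space there is no lower density, since the empty set and the whole space would be
  equal almost everywhere and yet have different values.
\<close>

lemma lower_density_trivial:
  assumes pos: "measure M (space M) > 0"
  shows "lower_density {({}, {}), (space M, space M)}"
proof -
  have "\<not> (AE t in M. t \<notin> space M)"
  proof
    assume "AE t in M. t \<notin> space M"
    then have "space M \<in> null_sets M"
      by (simp add: AE_iff_null_sets)
    then show False
      using pos by (auto simp: null_sets_def emeasure_eq_measure)
  qed
  then have n: "\<not> (AE t in M. t \<in> {} \<longleftrightarrow> t \<in> space M)" "\<not> (AE t in M. t \<in> space M \<longleftrightarrow> t \<in> {})"
    by simp_all
  have "sub_sigma_algebra {{}, space M}"
    by (rule sub_sigma_algebraI) auto
  moreover have "Domain {({}, {}), (space M, space M)} = {{}, space M}"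
    by auto
  ultimately show ?thesis
    unfolding lower_density_def using n by auto
qed

text \<open>
  If every sequence in the chain has an upper bound in the chain, then the union of the domains is
  closed under countable unions, and the union of the graphs is a lower density. Otherwise some
  sequence without such a bound is cofinal, and the limit along it bounds the chain.
\<close>

lemma lower_density_chain:
  assumes C: "subset.chain {R. lower_density R} C" "C \<noteq> {}"
  shows "\<exists>S. lower_density S \<and> (\<forall>R\<in>C. R \<subseteq> S)"
proof -
  have CD: "lower_density R" if "R \<in> C" for R
    using that C unfolding subset_chain_def by blast
  have Clin: "R \<subseteq> R' \<or> R' \<subseteq> R" if "R \<in> C" "R' \<in> C" for R R'
    using that C unfolding subset_chain_def by blast
  \<comment> \<open>is every sequence of the chain bounded within the chain?\<close>
  show ?thesis
  proof (cases "\<forall>f :: nat \<Rightarrow> _. range f \<subseteq> C \<longrightarrow> (\<exists>U\<in>C. \<forall>n. f n \<subseteq> U)")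
    case True
    have two: "\<exists>R\<in>C. x \<in> R \<and> y \<in> R" if "x \<in> \<Union>C" "y \<in> \<Union>C" for x y
      using that Clin by blast
    have "lower_density (\<Union>C)"
      unfolding lower_density_def
    proof (intro conjI allI impI)
      show "sub_sigma_algebra (Domain (\<Union>C))"
      proof (rule sub_sigma_algebraI)
        show "Domain (\<Union>C) \<subseteq> sets M"
          using sub_sigma_algebraD(8)[OF lower_densityD(1)[OF CD]] by blast
        show "{} \<in> Domain (\<Union>C)"
          using C(2) lower_densityD(6)[OF CD] by blast
        show "space M - A \<in> Domain (\<Union>C)" if "A \<in> Domain (\<Union>C)" for A
          using that sub_sigma_algebraD(3)[OF lower_densityD(1)[OF CD], of _ A] by blast
        fix F :: "nat \<Rightarrow> 'a set"
        assume "range F \<subseteq> Domain (\<Union>C)"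
        then have "\<forall>n. \<exists>R\<in>C. F n \<in> Domain R"
          by blast
        then obtain f where f: "\<And>n. f n \<in> C" "\<And>n. F n \<in> Domain (f n)"
          by metis
        then obtain U where U: "U \<in> C" "\<And>n. f n \<subseteq> U"
          using True[rule_format, of f] by blast
        have "range F \<subseteq> Domain U"
          using f(2) U(2) by blast
        then have "(\<Union>n. F n) \<in> Domain U"
          by (rule sub_sigma_algebraD(7)[OF lower_densityD(1)[OF CD[OF U(1)]]])
        then show "(\<Union>n. F n) \<in> Domain (\<Union>C)"
          using U(1) by blast
      qed
      show "({}, {}) \<in> \<Union>C" "(space M, space M) \<in> \<Union>C"
        using C(2) lower_densityD(6,7)[OF CD] by blast+
    next
      fix A A'
      assume A: "(A, A') \<in> \<Union>C"
      then show "A' \<subseteq> space M" "AE t in M. t \<in> A' \<longleftrightarrow> t \<in> A"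
        using lower_densityD(2,3)[OF CD] by blast+
      fix B B'
      assume "(B, B') \<in> \<Union>C"
      then obtain R where R: "R \<in> C" "(A, A') \<in> R" "(B, B') \<in> R"
        using two[OF A] by blast
      show "(A \<inter> B, A' \<inter> B') \<in> \<Union>C"
        using lower_densityD(5)[OF CD R(2,3)] R(1) by blast
      show "AE t in M. t \<in> A \<longleftrightarrow> t \<in> B \<Longrightarrow> A' = B'"
        by (rule lower_densityD(4)[OF CD R(2,3)]) (rule R(1))
    qed
    then show ?thesis
      by blast
  next
    case False
    then obtain f :: "nat \<Rightarrow> _" where f: "range f \<subseteq> C" and nb: "\<not> (\<exists>U\<in>C. \<forall>n. f n \<subseteq> U)"
      by blast
    \<comment> \<open>an increasing sequence with the same upper bounds as \<open>f\<close>\<close>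
    define g where "g n = (\<Union>i\<le>n. f i)" for n
    have "g n \<in> C" for n
    proof (induction n)
      case 0
      then show ?case
        using f by (auto simp: g_def)
    next
      case (Suc n)
      have "g (Suc n) = g n \<union> f (Suc n)"
        by (auto simp: g_def le_Suc_eq)
      moreover have "g n \<union> f (Suc n) = g n \<or> g n \<union> f (Suc n) = f (Suc n)"
        using Clin[OF Suc, of "f (Suc n)"] f by blast
      ultimately show ?case
        using Suc f by auto
    qed
    then have gD: "lower_density (g n)" for n
      by (rule CD)
    have ginc: "g n \<subseteq> g (Suc n)" for n
      unfolding g_def by (intro UN_mono) auto
    obtain S where S: "lower_density S" "\<And>n. g n \<subseteq> S"
      using lower_density_limit[of g, OF gD ginc] by blast
    have "R \<subseteq> S" if R: "R \<in> C" for R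
    proof -
      obtain n where "\<not> f n \<subseteq> R"
        using nb R by blast
      then have "R \<subseteq> f n"
        using Clin[OF R, of "f n"] f by blast
      also have "f n \<subseteq> g n"
        unfolding g_def by blast
      finally show ?thesis
        using S(2) by blast
    qed
    then show ?thesis
      using S(1) by blast
  qed
qed

theorem lower_density_exists:
  assumes pos: "measure M (space M) > 0"
  obtains R where "lower_density R" "Domain R = sets M"
proof -
  have "\<exists>U\<in>{R. lower_density R}. \<forall>X\<in>C. X \<subseteq> U" if "subset.chain {R. lower_density R} C" for C
  proof (cases "C = {}")
    case True
    then show ?thesis
      using lower_density_trivial[OF pos] by blast
  next
    case False
    then show ?thesis
      using lower_density_chain[OF that] by simp
  qed
  then have "\<exists>R\<in>{R. lower_density R}. \<forall>S\<in>{R. lower_density R}. R \<subseteq> S \<longrightarrow> S = R"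
    by (rule subset_Zorn)
  then obtain R where R: "lower_density R" and max: "\<And>S. lower_density S \<Longrightarrow> R \<subseteq> S \<Longrightarrow> S = R"
    by auto
  have "A \<in> Domain R" if A: "A \<in> sets M" for A
  proof -
    obtain S where "lower_density S" "R \<subseteq> S" "A \<in> Domain S"
      using lower_density_adjoin[OF R A] by blast
    then show ?thesis
      using max[of S] by simp
  qed
  then have "Domain R = sets M"
    using sub_sigma_algebraD(8)[OF lower_densityD(1)[OF R]] by blast
  then show ?thesis
    using that R by blast
qed

definition ess_bounded :: "('a \<Rightarrow> real) \<Rightarrow> bool" where
  "ess_bounded h \<longleftrightarrow> h \<in> borel_measurable M \<and> (\<exists>c. AE t in M. \<bar>h t\<bar> \<le> c)"

text \<open>
  A sublinear lifting turns inequalities that hold almost everywhere into inequalities that hold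
  at every point, and chooses a representative in each class of essentially bounded functions. It is
  only sublinear, but this suffices for support functions.
\<close>

definition sublinear_lifting :: "(('a \<Rightarrow> real) \<Rightarrow> 'a \<Rightarrow> real) \<Rightarrow> bool" where
  "sublinear_lifting U \<longleftrightarrow>
     (\<forall>h g. ess_bounded h \<longrightarrow> ess_bounded g \<longrightarrow> (AE t in M. h t \<le> g t) \<longrightarrow> (\<forall>t\<in>space M. U h t \<le> U g t)) \<and>
     (\<forall>h g. ess_bounded h \<longrightarrow> ess_bounded g \<longrightarrow> (\<forall>t\<in>space M. U (\<lambda>t. h t + g t) t \<le> U h t + U g t)) \<and>
     (\<forall>h c. ess_bounded h \<longrightarrow> c \<ge> 0 \<longrightarrow> (\<forall>t\<in>space M. U (\<lambda>t. c * h t) t = c * U h t)) \<and>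
     (\<forall>h c. ess_bounded h \<longrightarrow> (AE t in M. h t \<le> c) \<longrightarrow> (\<forall>t\<in>space M. U h t \<le> c)) \<and>
     (\<forall>h. ess_bounded h \<longrightarrow> (AE t in M. U h t = h t))"

lemma sublinear_liftingD:
  assumes "sublinear_lifting U" "ess_bounded h" "t \<in> space M"
  shows "ess_bounded g \<Longrightarrow> (AE t in M. h t \<le> g t) \<Longrightarrow> U h t \<le> U g t"
    "ess_bounded g \<Longrightarrow> U (\<lambda>t. h t + g t) t \<le> U h t + U g t"
    "c \<ge> 0 \<Longrightarrow> U (\<lambda>t. c * h t) t = c * U h t"
    "(AE t in M. h t \<le> c) \<Longrightarrow> U h t \<le> c"
  using assms unfolding sublinear_lifting_def by blast+

lemma ess_bounded_add:
  assumes "ess_bounded h" "ess_bounded g"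
  shows "ess_bounded (\<lambda>t. h t + g t)"
proof -
  obtain c d where cd: "AE t in M. \<bar>h t\<bar> \<le> c" "AE t in M. \<bar>g t\<bar> \<le> d"
    using assms unfolding ess_bounded_def by blast
  have "AE t in M. \<bar>h t + g t\<bar> \<le> c + d"
    using cd by eventually_elim linarith
  then show ?thesis
    using assms unfolding ess_bounded_def by auto
qed

lemma ess_bounded_cmult:
  assumes "ess_bounded h"
  shows "ess_bounded (\<lambda>t. c * h t)"
proof -
  obtain d where d: "AE t in M. \<bar>h t\<bar> \<le> d"
    using assms unfolding ess_bounded_def by blast
  have "AE t in M. \<bar>c * h t\<bar> \<le> \<bar>c\<bar> * d"
    using d by eventually_elim (auto simp: abs_mult intro!: mult_left_mono)
  then show ?thesis
    using assms unfolding ess_bounded_def by auto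
qed

text \<open>
  With a lower density \<open>th\<close>, let \<open>U h t\<close> be the infimum of all \<open>r\<close> such that \<open>t\<close> is in the density
  of \<open>{h < r}\<close>. Subadditivity is the compatibility of \<open>th\<close> with intersections, applied to
  \<open>{h < r} \<inter> {g < s} \<subseteq> {h + g < r + s}\<close>.
\<close>

theorem sublinear_lifting_exists:
  assumes pos: "measure M (space M) > 0"
  obtains U where "sublinear_lifting U"
proof -
  obtain R where R: "lower_density R" and Dom: "Domain R = sets M"
    using lower_density_exists[OF pos] by blast
  define th where "th A = density_set R A" for A
  note th = density_set[OF R, folded th_def, unfolded Dom]
  have th_space: "th (space M) = space M" and th_empty: "th {} = {}"
    unfolding th_def using density_set_eq[OF R] lower_densityD(6,7)[OF R] by auto
  define L where "L h r = {s \<in> space M. h s < r}" for h :: "'a \<Rightarrow> real" and r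
  have Ls: "L h r \<in> sets M" if "ess_bounded h" for h r
    using that unfolding L_def ess_bounded_def by auto
  define U where "U h t = Inf {r. t \<in> th (L h r)}" for h t
  have th_all: "th (L h r) = space M" if h: "ess_bounded h" and "AE t in M. h t < r" for h r
  proof -
    have "AE t in M. t \<in> L h r \<longleftrightarrow> t \<in> space M"
      using that(2) AE_space by eventually_elim (auto simp: L_def)
    then show ?thesis
      using th(4)[OF Ls[OF h], of "space M"] th_space by auto
  qed
  have bdd: "bdd_below {r. t \<in> th (L h r)}" if h: "ess_bounded h" for h t
  proof -
    obtain c where c: "AE t in M. \<bar>h t\<bar> \<le> c"
      using h unfolding ess_bounded_def by blast
    have "-c \<le> r" if "t \<in> th (L h r)" for r
    proof (rule ccontr)
      assume r: "\<not> - c \<le> r"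
      have "AE t in M. t \<in> L h r \<longleftrightarrow> t \<in> {}"
        using c by eventually_elim (use r in \<open>auto simp: L_def\<close>)
      then have "th (L h r) = {}"
        using th(4)[OF Ls[OF h], of "{}"] th_empty by auto
      then show False
        using that by blast
    qed
    then show ?thesis
      by (intro bdd_belowI) auto
  qed
  have ne: "{r. t \<in> th (L h r)} \<noteq> {}" if h: "ess_bounded h" and t: "t \<in> space M" for h t
  proof -
    obtain c where c: "AE t in M. \<bar>h t\<bar> \<le> c"
      using h unfolding ess_bounded_def by blast
    have "AE t in M. h t < c + 1"
      using c by eventually_elim auto
    then show ?thesis
      using th_all[OF h] t by blast
  qed
  have U_le: "U h t \<le> r" if "ess_bounded h" "t \<in> th (L h r)" for h t r
    unfolding U_def using that by (intro cInf_lower bdd) auto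
  have U_less: "t \<in> th (L h r)" if h: "ess_bounded h" and t: "t \<in> space M" and less: "U h t < r" for h t r
  proof -
    obtain r' where "t \<in> th (L h r')" "r' < r"
      using less cInf_lessD[OF ne[OF h t]] unfolding U_def by blast
    moreover have "th (L h r') \<subseteq> th (L h r)"
      using \<open>r' < r\<close> by (intro th(3)[OF Ls[OF h] Ls[OF h]]) (auto simp: L_def)
    ultimately show ?thesis
      by blast
  qed
  have const: "U h t \<le> c" if h: "ess_bounded h" and le: "AE t in M. h t \<le> c" and t: "t \<in> space M" for h c t
  proof (rule field_le_epsilon)
    fix e :: real
    assume "e > 0"
    then have "AE t in M. h t < c + e"
      using le by (auto elim: eventually_mono)
    then show "U h t \<le> c + e"
      using th_all[OF h] t by (intro U_le[OF h]) auto
  qed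
  have add: "U (\<lambda>t. h t + g t) t \<le> U h t + U g t"
    if h: "ess_bounded h" and g: "ess_bounded g" and t: "t \<in> space M" for h g t
  proof (rule field_le_epsilon)
    fix e :: real
    assume e: "e > 0"
    let ?r = "U h t + e / 2" and ?s = "U g t + e / 2"
    have "t \<in> th (L h ?r) \<inter> th (L g ?s)"
      using U_less[OF h t, of ?r] U_less[OF g t, of ?s] e by auto
    also have "\<dots> = th (L h ?r \<inter> L g ?s)"
      using th(5)[OF Ls[OF h] Ls[OF g]] by simp
    also have "\<dots> \<subseteq> th (L (\<lambda>t. h t + g t) (?r + ?s))"
      using Ls[OF h] Ls[OF g] by (intro th(3) Ls[OF ess_bounded_add[OF h g]]) (auto simp: L_def)
    finally have "U (\<lambda>t. h t + g t) t \<le> ?r + ?s"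
      by (rule U_le[OF ess_bounded_add[OF h g]])
    then show "U (\<lambda>t. h t + g t) t \<le> U h t + U g t + e"
      by simp
  qed
  have scale_le: "U (\<lambda>t. c * h t) t \<le> c * U h t" if h: "ess_bounded h" and c: "c > 0" and t: "t \<in> space M" for h c t
  proof (rule field_le_epsilon)
    fix e :: real
    assume e: "e > 0"
    let ?r = "U h t + e / c"
    have "t \<in> th (L h ?r)"
      using U_less[OF h t, of ?r] e c by auto
    also have "L h ?r = L (\<lambda>t. c * h t) (c * ?r)"
      using c unfolding L_def by auto
    finally have "U (\<lambda>t. c * h t) t \<le> c * ?r"
      by (rule U_le[OF ess_bounded_cmult[OF h]])
    also have "c * ?r = c * U h t + e"
      using c by (simp add: field_simps)
    finally show "U (\<lambda>t. c * h t) t \<le> c * U h t + e" .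
  qed
  have "sublinear_lifting U"
    unfolding sublinear_lifting_def
  proof (intro conjI allI impI ballI)
    fix h g t
    assume h: "ess_bounded h" and g: "ess_bounded g" and le: "AE t in M. h t \<le> g t" and t: "t \<in> space M"
    show "U h t \<le> U g t"
    proof (rule field_le_epsilon)
      fix e :: real
      assume "e > 0"
      then have "t \<in> th (L g (U g t + e))"
        by (intro U_less[OF g t]) auto
      moreover have "AE s in M. s \<in> L g (U g t + e) \<longrightarrow> s \<in> L h (U g t + e)"
        using le by eventually_elim (auto simp: L_def)
      ultimately show "U h t \<le> U g t + e"
        using th(3)[OF Ls[OF g] Ls[OF h]] by (intro U_le[OF h]) blast
    qed
  next
    fix h and c :: real and t
    assume h: "ess_bounded h" and c: "0 \<le> c" and t: "t \<in> space M"
    show "U (\<lambda>t. c * h t) t = c * U h t"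
    proof (cases "c = 0")
      case True
      have z: "ess_bounded (\<lambda>t. 0)"
        unfolding ess_bounded_def by auto
      have "U (\<lambda>t. 0) t \<le> U (\<lambda>t. 0) t + U (\<lambda>t. 0) t"
        using add[OF z z t] by simp
      moreover have "U (\<lambda>t. 0) t \<le> 0"
        by (rule const[OF z _ t]) auto
      ultimately show ?thesis
        using True by simp
    next
      case False
      then have c: "c > 0"
        using c by simp
      have "U (\<lambda>t. (1 / c) * (c * h t)) t \<le> (1 / c) * U (\<lambda>t. c * h t) t"
        using c t by (intro scale_le ess_bounded_cmult[OF h]) auto
      then have "c * U h t \<le> U (\<lambda>t. c * h t) t"
        using c by (simp add: field_simps)
      then show ?thesis
        using scale_le[OF h c t] by simp
    qed
  next
    fix h
    assume h: "ess_bounded h"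
    have "AE t in M. \<forall>q::rat. t \<in> th (L h (of_rat q)) \<longleftrightarrow> t \<in> L h (of_rat q)"
      unfolding AE_all_countable using th(2)[OF Ls[OF h]] by blast
    then show "AE t in M. U h t = h t"
      using AE_space
    proof eventually_elim
      case (elim t)
      have "U h t \<le> h t"
      proof (rule ccontr)
        assume "\<not> U h t \<le> h t"
        then obtain q where q: "h t < of_rat q" "of_rat q < U h t"
          using of_rat_dense[of "h t" "U h t"] by auto
        then have "t \<in> th (L h (of_rat q))"
          using elim by (auto simp: L_def)
        then show False
          using U_le[OF h] q by force
      qed
      moreover have "h t \<le> U h t"
      proof (rule ccontr)
        assume "\<not> h t \<le> U h t"
        then obtain q where q: "U h t < of_rat q" "of_rat q < h t"
          using of_rat_dense[of "U h t" "h t"] by auto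
        then have "t \<in> L h (of_rat q)"
          using U_less[OF h elim(2)] elim(1) by blast
        then show False
          using q by (auto simp: L_def)
      qed
      ultimately show ?case
        by simp
    qed
  qed (use add const in auto)
  then show ?thesis
    using that by blast
qed

end

section \<open>The Hahn-Banach theorem\<close>

definition sublinear :: "('a::real_vector \<Rightarrow> real) \<Rightarrow> bool" where
  "sublinear s \<longleftrightarrow> (\<forall>x y. s (x + y) \<le> s x + s y) \<and> (\<forall>c\<ge>0. \<forall>x. s (c *\<^sub>R x) = c * s x)"

lemma sublinearD:
  assumes "sublinear s"
  shows "s (x + y) \<le> s x + s y" "c \<ge> 0 \<Longrightarrow> s (c *\<^sub>R x) = c * s x" "s 0 = 0" "- s (- x) \<le> s x"
proof -
  show add: "s (x + y) \<le> s x + s y" and "c \<ge> 0 \<Longrightarrow> s (c *\<^sub>R x) = c * s x" for x y c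
    using assms unfolding sublinear_def by blast+
  from this(2)[of 0 0] show 0: "s 0 = 0"
    by simp
  show "- s (- x) \<le> s x"
    using add[of x "-x"] 0 by simp
qed

lemma sublinearI:
  assumes "\<And>x y. s (x + y) \<le> s x + s y" "\<And>c x. c > 0 \<Longrightarrow> s (c *\<^sub>R x) \<le> c * s x" "s 0 = 0"
  shows "sublinear s"
  unfolding sublinear_def
proof (intro conjI allI impI assms(1))
  fix c :: real and x
  assume "c \<ge> 0"
  show "s (c *\<^sub>R x) = c * s x"
  proof (cases "c = 0")
    case False
    then have c: "c > 0"
      using \<open>c \<ge> 0\<close> by simp
    then have "s ((1 / c) *\<^sub>R (c *\<^sub>R x)) \<le> (1 / c) * s (c *\<^sub>R x)"
      by (intro assms(2)) auto
    then have "c * s x \<le> s (c *\<^sub>R x)"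
      using c by (simp add: field_simps)
    then show ?thesis
      using assms(2)[OF c, of x] by simp
  qed (use assms(3) in simp)
qed

text \<open>
  If \<open>s \<ge> e\<close> on the convex set \<open>K\<close>, this is the greatest sublinear minorant of \<open>s\<close> that is at most
  \<open>- e\<close> on \<open>- K\<close>.
\<close>

definition lower_along :: "('a::real_vector \<Rightarrow> real) \<Rightarrow> 'a set \<Rightarrow> real \<Rightarrow> 'a \<Rightarrow> real" where
  "lower_along s K e y = Inf {s (y + c *\<^sub>R k) - c * e | c k. c \<ge> 0 \<and> k \<in> K}"

lemma lower_along:
  assumes s: "sublinear s" and K: "convex K" "K \<noteq> {}" and ge: "\<And>k. k \<in> K \<Longrightarrow> s k \<ge> e"
  shows "sublinear (lower_along s K e)" "lower_along s K e y \<le> s y"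
    "k \<in> K \<Longrightarrow> lower_along s K e (- k) \<le> - e"
proof -
  let ?A = "\<lambda>y. {s (y + c *\<^sub>R k) - c * e | c k. c \<ge> 0 \<and> k \<in> K}"
  let ?S = "lower_along s K e"
  have low: "- s (- y) \<le> s (y + c *\<^sub>R k) - c * e" if "c \<ge> 0" "k \<in> K" for y c k
  proof -
    have "c * e \<le> c * s k"
      using that ge by (intro mult_left_mono) auto
    also have "\<dots> = s (c *\<^sub>R k)"
      using that sublinearD(2)[OF s] by simp
    also have "\<dots> = s ((y + c *\<^sub>R k) + (- y))"
      by simp
    also have "\<dots> \<le> s (y + c *\<^sub>R k) + s (- y)"
      by (rule sublinearD(1)[OF s])
    finally show ?thesis
      by simp
  qed
  have bdd: "bdd_below (?A y)" for y
    using low by (intro bdd_belowI[of _ "- s (- y)"]) auto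
  have ne: "?A y \<noteq> {}" for y
    using K(2) by auto
  have le: "?S y \<le> s (y + c *\<^sub>R k) - c * e" if "c \<ge> 0" "k \<in> K" for y c k
    unfolding lower_along_def using that by (intro cInf_lower bdd) auto
  have ex: "\<exists>c k. c \<ge> 0 \<and> k \<in> K \<and> s (y + c *\<^sub>R k) - c * e < ?S y + d" if "d > 0" for y d
    using cInf_lessD[OF ne[of y], of "?S y + d"] that unfolding lower_along_def by auto
  obtain k0 where k0: "k0 \<in> K"
    using K by blast
  show le_s: "?S y \<le> s y" for y
    using le[of 0 k0 y] k0 by simp
  show "?S (- k) \<le> - e" if "k \<in> K" for k
    using le[of 1 k "-k"] that sublinearD(3)[OF s] by simp
  show "sublinear ?S"
  proof (rule sublinearI)
    fix x y
    show "?S (x + y) \<le> ?S x + ?S y"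
    proof (rule field_le_epsilon)
      fix d :: real
      assume "d > 0"
      then have d: "d / 2 > 0"
        by simp
      obtain b k where k: "b \<ge> 0" "k \<in> K" "s (x + b *\<^sub>R k) - b * e < ?S x + d / 2"
        using ex[OF d] by blast
      obtain c l where l: "c \<ge> 0" "l \<in> K" "s (y + c *\<^sub>R l) - c * e < ?S y + d / 2"
        using ex[OF d] by blast
      obtain m where m: "m \<in> K" "(b + c) *\<^sub>R m = b *\<^sub>R k + c *\<^sub>R l"
      proof (cases "b + c = 0")
        case True
        then have "b = 0" "c = 0"
          using k l by auto
        then show ?thesis
          using that[OF k0] by simp
      next
        case False
        then have pos: "b + c > 0"
          using k l by auto
        have "(b / (b + c)) *\<^sub>R k + (c / (b + c)) *\<^sub>R l \<in> K"
          using k l pos by (intro convexD[OF K(1)]) (auto simp: add_divide_distrib[symmetric])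
        moreover have "(b + c) *\<^sub>R ((b / (b + c)) *\<^sub>R k + (c / (b + c)) *\<^sub>R l) = b *\<^sub>R k + c *\<^sub>R l"
          using pos by (simp add: scaleR_add_right)
        ultimately show ?thesis
          using that by blast
      qed
      have "?S (x + y) \<le> s ((x + y) + (b + c) *\<^sub>R m) - (b + c) * e"
        using k l m by (intro le) auto
      also have "(x + y) + (b + c) *\<^sub>R m = (x + b *\<^sub>R k) + (y + c *\<^sub>R l)"
        unfolding m(2) by simp
      also have "s \<dots> \<le> s (x + b *\<^sub>R k) + s (y + c *\<^sub>R l)"
        by (rule sublinearD(1)[OF s])
      finally show "?S (x + y) \<le> ?S x + ?S y + d"
        using k(3) l(3) by (simp add: algebra_simps)
    qed
  next
    fix b :: real and x
    assume b: "b > 0"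
    show "?S (b *\<^sub>R x) \<le> b * ?S x"
    proof (rule field_le_epsilon)
      fix d :: real
      assume "d > 0"
      then have d: "d / b > 0"
        using b by simp
      obtain c k where k: "c \<ge> 0" "k \<in> K" "s (x + c *\<^sub>R k) - c * e < ?S x + d / b"
        using ex[OF d] by blast
      have "?S (b *\<^sub>R x) \<le> s (b *\<^sub>R x + (b * c) *\<^sub>R k) - (b * c) * e"
        using k b by (intro le) auto
      also have "b *\<^sub>R x + (b * c) *\<^sub>R k = b *\<^sub>R (x + c *\<^sub>R k)"
        by (simp add: scaleR_add_right)
      also have "s \<dots> = b * s (x + c *\<^sub>R k)"
        using b sublinearD(2)[OF s] by simp
      also have "b * s (x + c *\<^sub>R k) - (b * c) * e = b * (s (x + c *\<^sub>R k) - c * e)"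
        by (simp add: algebra_simps)
      also have "\<dots> \<le> b * (?S x + d / b)"
        using k b by (intro mult_left_mono) auto
      also have "\<dots> = b * ?S x + d"
        using b by (simp add: field_simps)
      finally show "?S (b *\<^sub>R x) \<le> b * ?S x + d" .
    qed
  next
    have "?S 0 \<le> 0"
      using le_s[of 0] sublinearD(3)[OF s] by simp
    moreover have "0 \<le> ?S 0"
      unfolding lower_along_def using low[of _ _ 0] sublinearD(3)[OF s]
      by (intro cInf_greatest ne[of 0]) auto
    ultimately show "?S 0 = 0"
      by simp
  qed
qed

lemma sublinear_Inf_chain:
  assumes C: "C \<noteq> {}" and sub: "\<And>s. s \<in> C \<Longrightarrow> sublinear s"
    and le: "\<And>s x. s \<in> C \<Longrightarrow> s x \<le> p x"
    and chain: "\<And>s s'. s \<in> C \<Longrightarrow> s' \<in> C \<Longrightarrow> s \<le> s' \<or> s' \<le> s"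
  shows "sublinear (\<lambda>x. INF s\<in>C. s x)" "s \<in> C \<Longrightarrow> (INF s\<in>C. s x) \<le> s x"
proof -
  have bdd: "bdd_below ((\<lambda>s. s x) ` C)" for x
  proof (rule bdd_belowI2)
    fix s
    assume s: "s \<in> C"
    have "- p (- x) \<le> - s (- x)"
      using le[OF s] by simp
    also have "\<dots> \<le> s x"
      by (rule sublinearD(4)[OF sub[OF s]])
    finally show "- p (- x) \<le> s x" .
  qed
  show low: "(INF s\<in>C. s x) \<le> s x" if "s \<in> C" for s x
    by (rule cINF_lower[OF bdd that])
  have ex: "\<exists>s\<in>C. s x < (INF s\<in>C. s x) + d" if "d > 0" for x and d :: real
    using cInf_lessD[of "(\<lambda>s. s x) ` C" "(INF s\<in>C. s x) + d"] C that by auto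
  show "sublinear (\<lambda>x. INF s\<in>C. s x)"
  proof (rule sublinearI)
    fix x y
    show "(INF s\<in>C. s (x + y)) \<le> (INF s\<in>C. s x) + (INF s\<in>C. s y)"
    proof (rule field_le_epsilon)
      fix d :: real
      assume "d > 0"
      then have d: "d / 2 > 0"
        by simp
      obtain s s' where s: "s \<in> C" "s x < (INF s\<in>C. s x) + d / 2"
        and s': "s' \<in> C" "s' y < (INF s\<in>C. s y) + d / 2"
        using ex[OF d] by blast
      obtain r where r: "r \<in> C" "r \<le> s" "r \<le> s'"
        using chain[OF s(1) s'(1)] s(1) s'(1) by auto
      have "(INF s\<in>C. s (x + y)) \<le> r (x + y)"
        by (rule low[OF r(1)])
      also have "\<dots> \<le> r x + r y"
        by (rule sublinearD(1)[OF sub[OF r(1)]])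
      also have "\<dots> \<le> s x + s' y"
        using r by (intro add_mono) (auto simp: le_fun_def)
      finally show "(INF s\<in>C. s (x + y)) \<le> (INF s\<in>C. s x) + (INF s\<in>C. s y) + d"
        using s(2) s'(2) by simp
    qed
  next
    fix c :: real and x
    assume c: "c > 0"
    show "(INF s\<in>C. s (c *\<^sub>R x)) \<le> c * (INF s\<in>C. s x)"
    proof (rule field_le_epsilon)
      fix d :: real
      assume "d > 0"
      then obtain s where s: "s \<in> C" "s x < (INF s\<in>C. s x) + d / c"
        using ex[of "d / c"] c by auto
      have "(INF s\<in>C. s (c *\<^sub>R x)) \<le> s (c *\<^sub>R x)"
        by (rule low[OF s(1)])
      also have "\<dots> = c * s x"
        using c sublinearD(2)[OF sub[OF s(1)]] by simp
      also have "\<dots> \<le> c * ((INF s\<in>C. s x) + d / c)"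
        using s c by (intro mult_left_mono) auto
      also have "\<dots> = c * (INF s\<in>C. s x) + d"
        using c by (simp add: field_simps)
      finally show "(INF s\<in>C. s (c *\<^sub>R x)) \<le> c * (INF s\<in>C. s x) + d" .
    qed
  next
    have "(INF s\<in>C. s 0) = (INF s\<in>C. (0::real))"
      using sublinearD(3)[OF sub] by (intro INF_cong) auto
    then show "(INF s\<in>C. s 0) = 0"
      using C by simp
  qed
qed

text \<open>
  A minimal sublinear functional \<open>f\<close> below \<open>p\<close> is linear: lowering it along \<open>{a}\<close> to the level \<open>f a\<close>
  cannot change it, hence \<open>f (- a) \<le> - f a\<close>.
\<close>

theorem Hahn_Banach_sublinear:
  assumes p: "sublinear p"
  obtains f where "linear f" "\<And>x. f x \<le> p x"
proof -
  define A where "A = {s. sublinear s \<and> s \<le> p}"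
  let ?P = "\<lambda>s s' :: 'a \<Rightarrow> real. s' \<le> s"
  have "partial_order_on A (relation_of ?P A)"
    by (rule partial_order_on_relation_ofI) auto
  moreover have "\<exists>u\<in>A. \<forall>s\<in>C. u \<le> s" if C: "C \<in> Chains (relation_of ?P A)" for C
  proof (cases "C = {}")
    case True
    then show ?thesis
      using p unfolding A_def by auto
  next
    case False
    have CA: "C \<subseteq> A"
      using Chains_relation_of[OF C] .
    have chain: "s \<le> s' \<or> s' \<le> s" if "s \<in> C" "s' \<in> C" for s s'
      using C that unfolding Chains_def relation_of_def by auto
    have *: "sublinear (\<lambda>x. INF s\<in>C. s x)" "\<And>s x. s \<in> C \<Longrightarrow> (INF s\<in>C. s x) \<le> s x"
      using sublinear_Inf_chain[OF False _ _ chain, of p] CA unfolding A_def le_fun_def by auto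
    obtain s where "s \<in> C"
      using False by blast
    then have "(\<lambda>x. INF s\<in>C. s x) \<le> p"
      using *(2)[of s] CA unfolding A_def le_fun_def by (auto intro: order_trans)
    then show ?thesis
      using * unfolding A_def by (intro bexI[of _ "\<lambda>x. INF s\<in>C. s x"]) (auto simp: le_fun_def)
  qed
  ultimately obtain f where f: "f \<in> A" and min: "\<And>s. s \<in> A \<Longrightarrow> s \<le> f \<Longrightarrow> s = f"
    using predicate_Zorn[of A ?P] by blast
  have sub: "sublinear f" and fp: "f \<le> p"
    using f unfolding A_def by auto
  have neg: "f (- a) = - f a" for a
  proof -
    have "lower_along f {a} (f a) \<in> A"
      using lower_along(1,2)[OF sub, of "{a}" "f a"] fp unfolding A_def le_fun_def
      by (auto intro: order_trans)
    then have "lower_along f {a} (f a) = f"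
      using lower_along(2)[OF sub, of "{a}" "f a"] by (intro min) (auto simp: le_fun_def)
    then have "f (- a) \<le> - f a"
      using lower_along(3)[OF sub, of "{a}" "f a" a] by simp
    then show ?thesis
      using sublinearD(4)[OF sub, of a] by simp
  qed
  have "linear f"
  proof (rule linearI)
    fix x y
    have "f x = f ((x + y) + (- y))"
      by simp
    also have "\<dots> \<le> f (x + y) + f (- y)"
      by (rule sublinearD(1)[OF sub])
    finally show "f (x + y) = f x + f y"
      using neg[of y] sublinearD(1)[OF sub, of x y] by simp
  next
    fix c x
    show "f (c *\<^sub>R x) = c *\<^sub>R f x"
    proof (cases "c \<ge> 0")
      case False
      then show ?thesis
        using sublinearD(2)[OF sub, of "-c" x] neg[of "c *\<^sub>R x"] by simp
    qed (use sublinearD(2)[OF sub] in simp)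
  qed
  then show ?thesis
    using that fp by (auto simp: le_fun_def)
qed

text \<open>
  The Mazur-Orlicz form of the Hahn-Banach theorem, from which both norming functionals
  (\<open>K\<close> a single point) and separating functionals (\<open>K = x - C\<close>) are obtained.
\<close>

theorem Hahn_Banach_convex:
  assumes p: "sublinear p" and K: "convex K" "K \<noteq> {}" and ge: "\<And>k. k \<in> K \<Longrightarrow> p k \<ge> e"
  obtains f where "linear f" "\<And>x. f x \<le> p x" "\<And>k. k \<in> K \<Longrightarrow> f k \<ge> e"
proof -
  obtain f where f: "linear f" "\<And>x. f x \<le> lower_along p K e x"
    using Hahn_Banach_sublinear[OF lower_along(1)[OF p K ge]] by blast
  have "f k \<ge> e" if "k \<in> K" for k
    using f(2)[of "-k"] lower_along(3)[OF p K ge that] linear_neg[OF f(1), of k] by simp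
  moreover have "f x \<le> p x" for x
    using f(2)[of x] lower_along(2)[OF p K ge, of x] by (rule order_trans)
  ultimately show ?thesis
    using that f(1) by blast
qed

section \<open>Seminorms and duality in locally convex spaces\<close>

lemma seminormD:
  assumes "seminorm p"
  shows "p (x + y) \<le> p x + p y" "p (c *\<^sub>R x) = \<bar>c\<bar> * p x" "p 0 = 0" "p (- x) = p x" "p x \<ge> 0"
    "p (x - y) = p (y - x)" "\<bar>p x - p y\<bar> \<le> p (x - y)" "sublinear p"
proof -
  show add: "p (x + y) \<le> p x + p y" and sc: "p (c *\<^sub>R x) = \<bar>c\<bar> * p x" for x y c
    using assms unfolding seminorm_def by blast+
  show 0: "p 0 = 0"
    using sc[of 0 0] by simp
  show neg: "p (- x) = p x" for x
    using sc[of "-1" x] by simp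
  show "p x \<ge> 0"
    using add[of x "- x"] 0 neg[of x] by simp
  show comm: "p (x - y) = p (y - x)" for x y
    using neg[of "x - y"] by simp
  show "\<bar>p x - p y\<bar> \<le> p (x - y)"
    using add[of "x - y" y] add[of "y - x" x] comm[of x y] by simp
  show "sublinear p"
    unfolding sublinear_def using add sc by simp
qed

lemma continuous_seminormsD:
  assumes "p \<in> continuous_seminorms"
  shows "seminorm p" "continuous_on UNIV p"
  using assms unfolding continuous_seminorms_def by auto

lemma tendsto_scaleR_locally_convex:
  fixes g :: "'b \<Rightarrow> 'a::locally_convex_space"
  assumes "(f \<longlongrightarrow> c) F" "(g \<longlongrightarrow> a) F"
  shows "((\<lambda>x. f x *\<^sub>R g x) \<longlongrightarrow> c *\<^sub>R a) F"
  using filterlim_compose[OF tendsto_scaleR_Pair filterlim_Pair[OF assms]] by simp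

lemma continuous_on_scaleR_locally_convex:
  "continuous_on A (\<lambda>x::'a::locally_convex_space. c *\<^sub>R x)"
  unfolding continuous_on_def
  by (auto intro!: tendsto_scaleR_locally_convex tendsto_const tendsto_ident_at)

lemma continuous_on_seminormI:
  fixes p :: "'a::locally_convex_space \<Rightarrow> real"
  assumes p: "seminorm p" and nbhd: "\<And>e. e > 0 \<Longrightarrow> \<exists>N. open N \<and> 0 \<in> N \<and> (\<forall>x\<in>N. p x < e)"
  shows "continuous_on UNIV p"
  unfolding continuous_on_def
proof
  fix x :: 'a
  show "(p \<longlongrightarrow> p x) (at x within UNIV)"
  proof (rule tendstoI)
    fix e :: real
    assume "e > 0"
    then obtain N where N: "open N" "0 \<in> N" "\<forall>x\<in>N. p x < e"
      using nbhd[of e] by auto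
    have "((\<lambda>y. y - x) \<longlongrightarrow> x - x) (at x within UNIV)"
      by (intro tendsto_diff tendsto_ident_at tendsto_const)
    then have "\<forall>\<^sub>F y in at x within UNIV. y - x \<in> N"
      by (rule topological_tendstoD) (use N in auto)
    then show "\<forall>\<^sub>F y in at x within UNIV. dist (p y) (p x) < e"
    proof eventually_elim
      case (elim y)
      then show ?case
        unfolding dist_real_def by (intro le_less_trans[OF seminormD(7)[OF p] bspec[OF N(3)]])
    qed
  qed
qed

definition minkowski_functional :: "'a::real_vector set \<Rightarrow> 'a \<Rightarrow> real" where
  "minkowski_functional W x = Inf {r. r > 0 \<and> (1 / r) *\<^sub>R x \<in> W}"

text \<open>
  The seminorm is the Minkowski functional of a symmetric convex open neighbourhood of zero.
\<close>

lemma continuous_seminorm_in_nbhd: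
  fixes U :: "'a::locally_convex_space set"
  assumes "open U" "0 \<in> U"
  obtains p where "p \<in> continuous_seminorms" "\<And>x. p x < 1 \<Longrightarrow> x \<in> U"
proof -
  obtain V where V: "open V" "convex V" "0 \<in> V" "V \<subseteq> U"
    using locally_convex[OF assms] by blast
  define W where "W = V \<inter> uminus -` V"
  have W_neg: "- x \<in> W" if "x \<in> W" for x
    using that unfolding W_def by auto
  have "linear (uminus :: 'a \<Rightarrow> 'a)"
    by (rule linearI) simp_all
  then have "convex (uminus -` V)"
    by (rule convex_linear_vimage[OF _ V(2)])
  then have W_convex: "convex W"
    unfolding W_def using V(2) by (intro convex_Int)
  have "open (uminus -` V)"
    using V(1) by (intro open_vimage continuous_on_minus continuous_on_id)
  then have W_open: "open W"
    unfolding W_def using V(1) by (intro open_Int)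
  have W0: "0 \<in> W"
    unfolding W_def using V(3) by auto
  have WU: "W \<subseteq> U"
    unfolding W_def using V(4) by auto
  have shrink: "c *\<^sub>R x \<in> W" if "x \<in> W" "0 \<le> c" "c \<le> 1" for c x
    using convexD[OF W_convex that(1) W0, of c "1 - c"] that by simp
  define p where "p = minkowski_functional W"
  let ?A = "\<lambda>x. {r. r > 0 \<and> (1 / r) *\<^sub>R x \<in> W}"
  have bdd: "bdd_below (?A x)" for x
    by (intro bdd_belowI[of _ 0]) auto
  have ne: "?A x \<noteq> {}" for x
  proof -
    have "((\<lambda>n. (1 / real (Suc n)) *\<^sub>R x) \<longlongrightarrow> 0 *\<^sub>R x) sequentially"
      using LIMSEQ_inverse_real_of_nat
      by (intro tendsto_scaleR_locally_convex tendsto_const) (simp add: inverse_eq_divide)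
    then have "\<forall>\<^sub>F n in sequentially. (1 / real (Suc n)) *\<^sub>R x \<in> W"
      by (rule topological_tendstoD) (use W_open W0 in auto)
    then obtain n where "(1 / real (Suc n)) *\<^sub>R x \<in> W"
      unfolding eventually_sequentially by blast
    then have "real (Suc n) \<in> ?A x"
      by simp
    then show ?thesis
      by blast
  qed
  have p_le: "p x \<le> r" if "r > 0" "(1 / r) *\<^sub>R x \<in> W" for x r
    unfolding p_def minkowski_functional_def using that by (intro cInf_lower bdd) auto
  have p_less: "(1 / r) *\<^sub>R x \<in> W \<and> r > 0" if less: "p x < r" for x r
  proof -
    obtain r' where r': "r' > 0" "(1 / r') *\<^sub>R x \<in> W" "r' < r"
      using cInf_lessD[OF ne less[unfolded p_def minkowski_functional_def]] by blast
    have "(r' / r) *\<^sub>R ((1 / r') *\<^sub>R x) \<in> W"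
      using r' by (intro shrink[OF r'(2)]) (auto simp: divide_simps)
    then show ?thesis
      using r' by simp
  qed
  have p0: "p x \<ge> 0" for x
    unfolding p_def minkowski_functional_def by (rule cInf_greatest[OF ne]) auto
  have zero: "p 0 = 0"
  proof (rule antisym)
    show "p 0 \<le> 0"
      by (rule field_le_epsilon) (use p_le[of _ 0] W0 in simp)
  qed (rule p0)
  have scale: "p (c *\<^sub>R x) \<le> \<bar>c\<bar> * p x" if c: "c \<noteq> 0" for c x
  proof (rule field_le_epsilon)
    fix e :: real
    assume "e > 0"
    then have "p x < p x + e / \<bar>c\<bar>"
      using c by simp
    from p_less[OF this] have r: "(1 / (p x + e / \<bar>c\<bar>)) *\<^sub>R x \<in> W" "p x + e / \<bar>c\<bar> > 0"
      by auto
    have "(1 / (\<bar>c\<bar> * (p x + e / \<bar>c\<bar>))) *\<^sub>R (c *\<^sub>R x) \<in> W"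
      using r(1) W_neg[OF r(1)] c by (cases "c > 0") auto
    then have "p (c *\<^sub>R x) \<le> \<bar>c\<bar> * (p x + e / \<bar>c\<bar>)"
      using r(2) c by (intro p_le) auto
    then show "p (c *\<^sub>R x) \<le> \<bar>c\<bar> * p x + e"
      using c by (simp add: distrib_left)
  qed
  have "seminorm p"
    unfolding seminorm_def
  proof (intro conjI allI)
    fix x y
    show "p (x + y) \<le> p x + p y"
    proof (rule field_le_epsilon)
      fix e :: real
      assume e: "e > 0"
      define r s where "r = p x + e / 2" and "s = p y + e / 2"
      have r: "(1 / r) *\<^sub>R x \<in> W" "r > 0" and s: "(1 / s) *\<^sub>R y \<in> W" "s > 0"
        using p_less[of x r] p_less[of y s] e by (auto simp: r_def s_def)
      have "(r / (r + s)) *\<^sub>R ((1 / r) *\<^sub>R x) + (s / (r + s)) *\<^sub>R ((1 / s) *\<^sub>R y) \<in> W"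
        using r s by (intro convexD[OF W_convex]) (auto simp: add_divide_distrib[symmetric])
      also have "(r / (r + s)) *\<^sub>R ((1 / r) *\<^sub>R x) + (s / (r + s)) *\<^sub>R ((1 / s) *\<^sub>R y) = (1 / (r + s)) *\<^sub>R (x + y)"
        using r s by (simp add: scaleR_add_right)
      finally have "p (x + y) \<le> r + s"
        using r s by (intro p_le) auto
      then show "p (x + y) \<le> p x + p y + e"
        by (simp add: r_def s_def)
    qed
  next
    fix c x
    show "p (c *\<^sub>R x) = \<bar>c\<bar> * p x"
    proof (cases "c = 0")
      case False
      have "p ((1 / c) *\<^sub>R (c *\<^sub>R x)) \<le> \<bar>1 / c\<bar> * p (c *\<^sub>R x)"
        using False by (intro scale) auto
      then have "\<bar>c\<bar> * p x \<le> p (c *\<^sub>R x)"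
        using False by (simp add: field_simps)
      then show ?thesis
        using scale[OF False, of x] by simp
    qed (use zero in simp)
  qed
  moreover have "\<exists>N. open N \<and> 0 \<in> N \<and> (\<forall>x\<in>N. p x < e)" if e: "e > 0" for e
  proof (intro exI conjI ballI)
    show "open ((\<lambda>x. (1 / (e / 2)) *\<^sub>R x) -` W)"
      by (rule open_vimage[OF W_open continuous_on_scaleR_locally_convex])
    show "0 \<in> (\<lambda>x. (1 / (e / 2)) *\<^sub>R x) -` W"
      using W0 by simp
    show "p x < e" if "x \<in> (\<lambda>x. (1 / (e / 2)) *\<^sub>R x) -` W" for x
      using p_le[of "e / 2" x] that e by simp
  qed
  ultimately have "p \<in> continuous_seminorms"
    unfolding continuous_seminorms_def using continuous_on_seminormI by blast
  moreover have "x \<in> U" if "p x < 1" for x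
    using p_less[OF that] WU by auto
  ultimately show ?thesis
    using that by blast
qed

lemma topological_dualD:
  assumes "\<xi> \<in> topological_dual"
  shows "linear \<xi>" "continuous_on A \<xi>" "\<xi> (x + y) = \<xi> x + \<xi> y" "\<xi> (x - y) = \<xi> x - \<xi> y"
    "\<xi> (c *\<^sub>R x) = c * \<xi> x" "\<xi> 0 = 0" "\<xi> (- x) = - \<xi> x" "\<xi> (sum f I) = (\<Sum>i\<in>I. \<xi> (f i))"
proof -
  show l: "linear \<xi>"
    using assms unfolding topological_dual_def by auto
  show "continuous_on A \<xi>"
    using assms continuous_on_subset unfolding topological_dual_def by blast
  show "\<xi> (x + y) = \<xi> x + \<xi> y" "\<xi> (x - y) = \<xi> x - \<xi> y"
    "\<xi> (c *\<^sub>R x) = c * \<xi> x" "\<xi> 0 = 0" "\<xi> (- x) = - \<xi> x" "\<xi> (sum f I) = (\<Sum>i\<in>I. \<xi> (f i))"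
    using linear_add[OF l] linear_diff[OF l] linear_cmul[OF l] linear_0[OF l] linear_neg[OF l] linear_sum[OF l]
    by auto
qed

lemma zero_topological_dual: "(\<lambda>x. 0) \<in> topological_dual"
  unfolding topological_dual_def by (simp add: linear_zero)

lemma topological_dual_closed:
  assumes "\<xi> \<in> topological_dual" "\<eta> \<in> topological_dual"
  shows "(\<lambda>x. \<xi> x + \<eta> x) \<in> topological_dual" "(\<lambda>x. c * \<xi> x) \<in> topological_dual"
    "(\<lambda>x. - \<xi> x) \<in> topological_dual" "(\<lambda>x. \<xi> x - \<eta> x) \<in> topological_dual"
  using topological_dualD(1)[OF assms(1)] topological_dualD(1)[OF assms(2)]
    topological_dualD(2)[OF assms(1), of UNIV] topological_dualD(2)[OF assms(2), of UNIV]
  unfolding topological_dual_def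
  by (auto intro!: linearI continuous_intros simp: linear_add linear_cmul algebra_simps)

lemma topological_dual_sum:
  assumes "\<And>i. i \<in> I \<Longrightarrow> \<xi> i \<in> topological_dual"
  shows "(\<lambda>x. \<Sum>i\<in>I. \<xi> i x) \<in> topological_dual"
  using assms
proof (induction I rule: infinite_finite_induct)
  case (insert i I)
  then show ?case
    using topological_dual_closed(1)[of "\<xi> i" "\<lambda>x. \<Sum>i\<in>I. \<xi> i x"] by simp
qed (simp_all add: zero_topological_dual)

lemma abs_dual_continuous_seminorm:
  assumes "\<xi> \<in> topological_dual"
  shows "(\<lambda>x. \<bar>\<xi> x\<bar>) \<in> continuous_seminorms"
  unfolding continuous_seminorms_def seminorm_def
  using topological_dualD[OF assms] by (auto simp: abs_mult intro!: continuous_on_rabs)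

lemma linear_dominated_dual:
  assumes f: "linear f" and p: "p \<in> continuous_seminorms" and le: "\<And>x. f x \<le> p x"
  shows "f \<in> topological_dual" "\<bar>f x\<bar> \<le> p x"
proof -
  note sp = continuous_seminormsD(1)[OF p]
  show abs: "\<bar>f x\<bar> \<le> p x" for x
    using le[of x] le[of "- x"] linear_neg[OF f, of x] seminormD(4)[OF sp, of x] by simp
  have "(f \<longlongrightarrow> f x) (at x within UNIV)" for x
  proof -
    have "((\<lambda>y. p (y - x)) \<longlongrightarrow> p (x - x)) (at x within UNIV)"
      using continuous_seminormsD(2)[OF p]
      by (intro continuous_on_tendsto_compose[of UNIV p] tendsto_diff tendsto_ident_at tendsto_const) auto
    then have "((\<lambda>y. p (y - x)) \<longlongrightarrow> 0) (at x within UNIV)"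
      using seminormD(3)[OF sp] by simp
    moreover have "\<forall>\<^sub>F y in at x within UNIV. norm (f y - f x) \<le> p (y - x)"
      using abs linear_diff[OF f] by (intro always_eventually) (metis real_norm_def)
    ultimately have "((\<lambda>y. f y - f x) \<longlongrightarrow> 0) (at x within UNIV)"
      by (rule Lim_null_comparison[rotated])
    then show ?thesis
      by (simp add: LIM_zero_iff)
  qed
  then show "f \<in> topological_dual"
    unfolding topological_dual_def continuous_on_def using f by auto
qed

lemma dual_attains_seminorm:
  assumes p: "p \<in> continuous_seminorms"
  obtains \<xi> where "\<xi> \<in> topological_dual" "\<And>x. \<bar>\<xi> x\<bar> \<le> p x" "\<xi> z = p z"
proof -
  note sp = continuous_seminormsD(1)[OF p]
  obtain f where f: "linear f" "\<And>x. f x \<le> p x" "\<And>k. k \<in> {z} \<Longrightarrow> f k \<ge> p z"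
    using Hahn_Banach_convex[OF seminormD(8)[OF sp], of "{z}" "p z"] by auto
  then have "f z = p z"
    by (meson antisym singletonI)
  then show ?thesis
    using that linear_dominated_dual[OF f(1) p f(2)] by blast
qed

lemma ckD:
  assumes "C \<in> ck"
  shows "C \<noteq> {}" "convex C" "compact C" "closed C"
  using assms compact_imp_closed unfolding ck_def by auto

lemma dual_separates_point_ck:
  assumes C: "C \<in> ck" and x: "x \<notin> C"
  obtains \<xi> e where "\<xi> \<in> topological_dual" "e > 0" "\<And>c. c \<in> C \<Longrightarrow> \<xi> c + e \<le> \<xi> x"
proof -
  have "open ((\<lambda>y. x - y) -` (- C))"
    using ckD(4)[OF C] by (intro open_vimage continuous_on_diff continuous_on_const continuous_on_id) auto
  then obtain p where p: "p \<in> continuous_seminorms" "\<And>y. p y < 1 \<Longrightarrow> y \<in> (\<lambda>y. x - y) -` (- C)"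
    using continuous_seminorm_in_nbhd[of "(\<lambda>y. x - y) -` (- C)"] x by auto
  have ge: "p k \<ge> 1" if k: "k \<in> (\<lambda>c. x - c) ` C" for k
  proof (rule ccontr)
    assume "\<not> 1 \<le> p k"
    then show False
      using p(2)[of k] k by auto
  qed
  have conv: "convex ((\<lambda>c. x - c) ` C)"
    using convex_translation[OF convex_negations[OF ckD(2)[OF C]], of x] by (simp add: image_image)
  obtain f where f: "linear f" "\<And>x. f x \<le> p x" "\<And>k. k \<in> (\<lambda>c. x - c) ` C \<Longrightarrow> f k \<ge> 1"
    using Hahn_Banach_convex[OF seminormD(8)[OF continuous_seminormsD(1)[OF p(1)]] conv _ ge] ckD(1)[OF C] by blast
  have "f c + 1 \<le> f x" if "c \<in> C" for c
    using f(3)[of "x - c"] that linear_diff[OF f(1), of x c] by auto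
  then show ?thesis
    using that[of f 1] linear_dominated_dual(1)[OF f(1) p(1) f(2)] by auto
qed

lemma singleton_ck: "{x} \<in> ck"
  unfolding ck_def by auto

lemma dual_separates_points:
  fixes x y :: "'a::locally_convex_space"
  assumes "\<And>\<xi>. \<xi> \<in> topological_dual \<Longrightarrow> \<xi> x = \<xi> y"
  shows "x = y"
proof (rule ccontr)
  assume "x \<noteq> y"
  then obtain \<xi> e where "\<xi> \<in> topological_dual" "e > 0" "\<And>c. c \<in> {y} \<Longrightarrow> \<xi> c + e \<le> \<xi> x"
    using dual_separates_point_ck[OF singleton_ck, of x y] by blast
  then show False
    using assms[of \<xi>] by simp
qed

lemma support_fun_ck:
  assumes C: "C \<in> ck" and \<xi>: "\<xi> \<in> topological_dual"
  shows "c \<in> C \<Longrightarrow> \<xi> c \<le> support_fun \<xi> C" "\<exists>c\<in>C. \<xi> c = support_fun \<xi> C"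
    "(\<And>c. c \<in> C \<Longrightarrow> \<xi> c \<le> b) \<Longrightarrow> support_fun \<xi> C \<le> b"
proof -
  obtain c where c: "c \<in> C" "\<And>y. y \<in> C \<Longrightarrow> \<xi> y \<le> \<xi> c"
    using continuous_attains_sup[OF ckD(3,1)[OF C] topological_dualD(2)[OF \<xi>]] by blast
  have eq: "support_fun \<xi> C = \<xi> c"
    unfolding support_fun_def using c by (intro cSup_eq_maximum) auto
  show "c \<in> C \<Longrightarrow> \<xi> c \<le> support_fun \<xi> C" for c
    using c eq by simp
  show "\<exists>c\<in>C. \<xi> c = support_fun \<xi> C"
    using c eq by auto
  show "(\<And>c. c \<in> C \<Longrightarrow> \<xi> c \<le> b) \<Longrightarrow> support_fun \<xi> C \<le> b"
    using c eq by auto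
qed

lemma support_fun_singleton: "support_fun \<xi> {x} = \<xi> x"
  unfolding support_fun_def by simp

lemma mem_ck_iff_support_fun:
  assumes C: "C \<in> ck"
  shows "x \<in> C \<longleftrightarrow> (\<forall>\<xi>\<in>topological_dual. \<xi> x \<le> support_fun \<xi> C)"
proof
  assume "x \<in> C"
  then show "\<forall>\<xi>\<in>topological_dual. \<xi> x \<le> support_fun \<xi> C"
    using support_fun_ck(1)[OF C] by blast
next
  assume le: "\<forall>\<xi>\<in>topological_dual. \<xi> x \<le> support_fun \<xi> C"
  show "x \<in> C"
  proof (rule ccontr)
    assume "x \<notin> C"
    then obtain \<xi> e where \<xi>: "\<xi> \<in> topological_dual" "e > 0" "\<And>c. c \<in> C \<Longrightarrow> \<xi> c + e \<le> \<xi> x"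
      using dual_separates_point_ck[OF C] by blast
    have "support_fun \<xi> C \<le> \<xi> x - e"
      using \<xi>(3) by (intro support_fun_ck(3)[OF C \<xi>(1)]) (simp add: le_diff_eq)
    then show False
      using le \<xi> by fastforce
  qed
qed

lemma ck_eqI_support_fun:
  assumes "C \<in> ck" "D \<in> ck" "\<And>\<xi>. \<xi> \<in> topological_dual \<Longrightarrow> support_fun \<xi> C = support_fun \<xi> D"
  shows "C = D"
  using mem_ck_iff_support_fun[OF assms(1)] mem_ck_iff_support_fun[OF assms(2)] assms(3) by auto

section \<open>Sublinear functionals on the dual as support functions\<close>

text \<open>
  Induction on \<open>I\<close>. On the part of \<open>Q\<close> where \<open>g i \<le> 0\<close>, the other functions either have a common
  point with values at most zero, or a nonnegative combination \<open>G\<close> of them is positive there. In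
  the second case the image of \<open>Q\<close> under \<open>(G, g i)\<close> misses the quadrant of nonpositive pairs. A line
  in the plane separates the two sets, and its coefficients are nonnegative because the quadrant is
  unbounded; they give the combination for \<open>insert i I\<close>.
\<close>

lemma affine_alternative:
  fixes Q :: "'a::{real_vector,t2_space} set" and g :: "'i \<Rightarrow> 'a \<Rightarrow> real"
  assumes "finite I" "compact Q" "convex Q" "\<And>i. i \<in> I \<Longrightarrow> continuous_on UNIV (g i)"
    "\<And>i x y u v. i \<in> I \<Longrightarrow> u \<ge> 0 \<Longrightarrow> v \<ge> 0 \<Longrightarrow> u + v = 1 \<Longrightarrow> g i (u *\<^sub>R x + v *\<^sub>R y) = u * g i x + v * g i y"
  shows "(\<exists>x\<in>Q. \<forall>i\<in>I. g i x \<le> 0) \<or> (\<exists>l. (\<forall>i\<in>I. l i \<ge> 0) \<and> (\<forall>x\<in>Q. 0 < (\<Sum>i\<in>I. l i * g i x)))"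
  using assms
proof (induction I arbitrary: Q rule: finite_induct)
  case empty
  then show ?case
    by auto
next
  case (insert i I)
  let ?Q = "{x. g i x \<le> 0} \<inter> Q"
  have cont: "continuous_on A (g j)" if "j \<in> insert i I" for j A
    using insert.prems(3)[OF that] continuous_on_subset by blast
  have aff: "g j (u *\<^sub>R x + v *\<^sub>R y) = u * g j x + v * g j y"
    if "j \<in> insert i I" "u \<ge> 0" "v \<ge> 0" "u + v = 1" for j x y u v
    using insert.prems(4)[OF that] .
  have Q1: "compact ?Q"
    using insert.prems(1) cont[of i UNIV] by (intro closed_Int_compact closed_Collect_le continuous_on_const) auto
  have Q2: "convex ?Q"
  proof (rule convex_Int[OF convexI insert.prems(2)])
    fix x y and u v :: real
    assume uv: "x \<in> {x. g i x \<le> 0}" "y \<in> {x. g i x \<le> 0}" "0 \<le> u" "0 \<le> v" "u + v = 1"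
    then have "u * g i x \<le> 0" "v * g i y \<le> 0"
      by (auto simp: mult_nonneg_nonpos)
    then show "u *\<^sub>R x + v *\<^sub>R y \<in> {x. g i x \<le> 0}"
      using aff[of i u v x y] uv by simp
  qed
  have "(\<exists>x\<in>?Q. \<forall>j\<in>I. g j x \<le> 0) \<or> (\<exists>l. (\<forall>j\<in>I. l j \<ge> 0) \<and> (\<forall>x\<in>?Q. 0 < (\<Sum>j\<in>I. l j * g j x)))"
    using Q1 Q2 cont aff by (intro insert.IH) auto
  then show ?case
  proof
    assume "\<exists>x\<in>?Q. \<forall>j\<in>I. g j x \<le> 0"
    then show ?thesis
      by auto
  next
    assume "\<exists>l. (\<forall>j\<in>I. l j \<ge> 0) \<and> (\<forall>x\<in>?Q. 0 < (\<Sum>j\<in>I. l j * g j x))"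
    then obtain l where l: "\<And>j. j \<in> I \<Longrightarrow> l j \<ge> 0" "\<And>x. x \<in> ?Q \<Longrightarrow> 0 < (\<Sum>j\<in>I. l j * g j x)"
      by blast
    define G where "G x = (\<Sum>j\<in>I. l j * g j x)" for x
    define S where "S = (\<lambda>x. (G x, g i x)) ` Q"
    define N where "N = {..0::real} \<times> {..0::real}"
    have G_aff: "G (u *\<^sub>R x + v *\<^sub>R y) = u * G x + v * G y"
      if "u \<ge> 0" "v \<ge> 0" "u + v = 1" for u v x y
    proof -
      have "G (u *\<^sub>R x + v *\<^sub>R y) = (\<Sum>j\<in>I. u * (l j * g j x) + v * (l j * g j y))"
        unfolding G_def using that by (intro sum.cong refl) (simp add: aff algebra_simps)
      then show ?thesis
        by (simp add: G_def sum.distrib sum_distrib_left)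
    qed
    have "continuous_on Q G"
      unfolding G_def by (intro continuous_intros cont) auto
    then have "compact S"
      unfolding S_def using cont[of i Q] by (intro compact_continuous_image continuous_on_Pair insert.prems(1)) auto
    moreover have "convex S"
    proof (rule convexI)
      fix a b and u v :: real
      assume ab: "a \<in> S" "b \<in> S" and uv: "0 \<le> u" "0 \<le> v" "u + v = 1"
      then obtain x y where x: "x \<in> Q" "a = (G x, g i x)" and y: "y \<in> Q" "b = (G y, g i y)"
        unfolding S_def by blast
      have "u *\<^sub>R a + v *\<^sub>R b = (G (u *\<^sub>R x + v *\<^sub>R y), g i (u *\<^sub>R x + v *\<^sub>R y))"
        using x y uv G_aff aff[of i] by simp
      moreover have "u *\<^sub>R x + v *\<^sub>R y \<in> Q"
        using x y uv by (intro convexD[OF insert.prems(2)])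
      ultimately show "u *\<^sub>R a + v *\<^sub>R b \<in> S"
        unfolding S_def by blast
    qed
    moreover have "closed N" "convex N"
      unfolding N_def by (auto intro!: closed_Times convex_Times)
    moreover have "N \<inter> S = {}"
      unfolding N_def S_def using l(2) unfolding G_def by force
    ultimately obtain a b where sep: "\<forall>x\<in>N. inner a x < b" "\<forall>x\<in>S. inner a x > b"
    proof (cases "S = {}")
      case True
      then show ?thesis
        using that[of "(0, 0)" 1] by (simp add: zero_prod_def[symmetric])
    qed (use separating_hyperplane_closed_compact[of N S] in blast)
    have "inner a (0, 0) < b"
      using sep(1) unfolding N_def by auto
    then have b: "b > 0"
      by (simp add: inner_Pair_0)
    have nonneg: "fst a \<ge> 0" "snd a \<ge> 0"
    proof -
      have "inner a (- b / d, 0) < b" if "d > 0" for d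
        using sep(1) b that unfolding N_def by auto
      from this[of "- fst a"] show "fst a \<ge> 0"
        using b by (cases a) (auto simp: not_le[symmetric] divide_simps split: if_splits)
      have "inner a (0, - b / d) < b" if "d > 0" for d
        using sep(1) b that unfolding N_def by auto
      from this[of "- snd a"] show "snd a \<ge> 0"
        using b by (cases a) (auto simp: not_le[symmetric] divide_simps split: if_splits)
    qed
    have pos: "0 < fst a * G x + snd a * g i x" if "x \<in> Q" for x
      using sep(2) b that unfolding S_def by (cases a) fastforce
    let ?l = "\<lambda>j. if j = i then snd a else fst a * l j"
    have "(\<Sum>j\<in>insert i I. ?l j * g j x) = fst a * G x + snd a * g i x" for x
    proof -
      have "(\<Sum>j\<in>I. ?l j * g j x) = (\<Sum>j\<in>I. fst a * (l j * g j x))"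
        using insert.hyps(2) by (intro sum.cong) auto
      then show ?thesis
        using insert.hyps by (simp add: G_def sum_distrib_left)
    qed
    moreover have "\<forall>j\<in>insert i I. ?l j \<ge> 0"
      using nonneg l(1) by auto
    ultimately show ?thesis
      using pos by (intro disjI2 exI[of _ ?l]) auto
  qed
qed

lemma sublinear_on_dual_sum:
  fixes s :: "('a::locally_convex_space \<Rightarrow> real) \<Rightarrow> real"
  assumes add: "\<And>\<xi> \<eta>. \<xi> \<in> topological_dual \<Longrightarrow> \<eta> \<in> topological_dual \<Longrightarrow> s (\<lambda>x. \<xi> x + \<eta> x) \<le> s \<xi> + s \<eta>"
    and scale: "\<And>\<xi> c. \<xi> \<in> topological_dual \<Longrightarrow> c \<ge> 0 \<Longrightarrow> s (\<lambda>x. c * \<xi> x) = c * s \<xi>"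
    and I: "finite I" "I \<subseteq> topological_dual" "\<And>\<xi>. \<xi> \<in> I \<Longrightarrow> l \<xi> \<ge> 0"
  shows "s (\<lambda>x. \<Sum>\<xi>\<in>I. l \<xi> * \<xi> x) \<le> (\<Sum>\<xi>\<in>I. l \<xi> * s \<xi>)"
  using I
proof (induction I rule: finite_induct)
  case empty
  from scale[OF zero_topological_dual, of 0] show ?case
    by simp
next
  case (insert \<eta> I)
  have \<eta>: "\<eta> \<in> topological_dual"
    using insert.prems by simp
  have "(\<lambda>x. \<Sum>\<xi>\<in>I. l \<xi> * \<xi> x) \<in> topological_dual"
    using insert.prems by (intro topological_dual_sum) (auto intro: topological_dual_closed(2))
  then have "s (\<lambda>x. l \<eta> * \<eta> x + (\<Sum>\<xi>\<in>I. l \<xi> * \<xi> x)) \<le> s (\<lambda>x. l \<eta> * \<eta> x) + s (\<lambda>x. \<Sum>\<xi>\<in>I. l \<xi> * \<xi> x)"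
    by (intro add topological_dual_closed(2)[OF \<eta> \<eta>])
  also have "\<dots> \<le> l \<eta> * s \<eta> + (\<Sum>\<xi>\<in>I. l \<xi> * s \<xi>)"
    using insert scale[OF \<eta>, of "l \<eta>"] by auto
  finally show ?case
    using insert.hyps by simp
qed

text \<open>
  By compactness it suffices to satisfy finitely many of the constraints. If this is impossible, then
  \<open>affine_alternative\<close> yields a functional \<open>\<zeta> = c \<xi>0 - \<eta>\<close>, with \<open>\<eta>\<close> a nonnegative combination of the
  constraints, such that \<open>\<zeta> < c s(\<xi>0) - s(\<eta>) \<le> s(\<zeta>)\<close> everywhere on \<open>Q\<close>; but \<open>\<zeta>\<close> attains
  \<open>support_fun \<zeta> Q \<ge> s(\<zeta>)\<close> on \<open>Q\<close>.
\<close>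

lemma sublinear_on_dual_attained:
  fixes Q :: "'a::locally_convex_space set"
  assumes Q: "Q \<in> ck"
    and add: "\<And>\<xi> \<eta>. \<xi> \<in> topological_dual \<Longrightarrow> \<eta> \<in> topological_dual \<Longrightarrow> s (\<lambda>x. \<xi> x + \<eta> x) \<le> s \<xi> + s \<eta>"
    and scale: "\<And>\<xi> c. \<xi> \<in> topological_dual \<Longrightarrow> c \<ge> 0 \<Longrightarrow> s (\<lambda>x. c * \<xi> x) = c * s \<xi>"
    and dom: "\<And>\<xi>. \<xi> \<in> topological_dual \<Longrightarrow> s \<xi> \<le> support_fun \<xi> Q"
    and \<xi>0: "\<xi>0 \<in> topological_dual"
  shows "\<exists>x\<in>Q. s \<xi>0 \<le> \<xi>0 x \<and> (\<forall>\<xi>\<in>topological_dual. \<xi> x \<le> s \<xi>)"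
proof -
  note D = topological_dualD
  let ?S = "{x. s \<xi>0 \<le> \<xi>0 x} \<inter> Q"
  have "compact ?S"
    using ckD(3)[OF Q] D(2)[OF \<xi>0, of UNIV]
    by (intro closed_Int_compact closed_Collect_le continuous_on_const) auto
  moreover have "closed {x. \<xi> x \<le> s \<xi>}" if "\<xi> \<in> topological_dual" for \<xi>
    using D(2)[OF that, of UNIV] by (intro closed_Collect_le continuous_on_const) auto
  moreover have "?S \<inter> (\<Inter>\<xi>\<in>I. {x. \<xi> x \<le> s \<xi>}) \<noteq> {}" if I: "finite I" "I \<subseteq> topological_dual" for I
  proof -
    \<comment> \<open>the index \<open>None\<close> stands for the constraint \<open>s \<xi>0 \<le> \<xi>0 x\<close>\<close>
    define g where "g j x = (case j of None \<Rightarrow> s \<xi>0 - \<xi>0 x | Some \<xi> \<Rightarrow> \<xi> x - s \<xi>)" for j x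
    let ?J = "insert None (Some ` I)"
    have "(\<exists>x\<in>Q. \<forall>j\<in>?J. g j x \<le> 0) \<or> (\<exists>l. (\<forall>j\<in>?J. l j \<ge> 0) \<and> (\<forall>x\<in>Q. 0 < (\<Sum>j\<in>?J. l j * g j x)))"
    proof (rule affine_alternative)
      show "finite ?J" "compact Q" "convex Q"
        using I ckD[OF Q] by auto
      show "continuous_on UNIV (g j)" if "j \<in> ?J" for j
        using that D(2)[OF subsetD[OF I(2)], of _ UNIV] D(2)[OF \<xi>0, of UNIV] unfolding g_def
        by (auto split: option.splits intro!: continuous_intros dest: subsetD)
      show "g j (u *\<^sub>R x + v *\<^sub>R y) = u * g j x + v * g j y"
        if "j \<in> ?J" "u \<ge> 0" "v \<ge> 0" "u + v = 1" for j x y u v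
      proof -
        have c: "c = u * c + v * c" for c :: real
          using that(4) by (simp add: distrib_right[symmetric])
        show ?thesis
        proof (cases j)
          case None
          then show ?thesis
            using c[of "s \<xi>0"] D(3,5)[OF \<xi>0] by (simp add: g_def algebra_simps)
        next
          case (Some \<xi>)
          then have "\<xi> \<in> topological_dual"
            using that I by auto
          then show ?thesis
            using c[of "s \<xi>"] D(3,5)[of \<xi>] Some by (simp add: g_def algebra_simps)
        qed
      qed
    qed
    then show ?thesis
    proof
      assume "\<exists>x\<in>Q. \<forall>j\<in>?J. g j x \<le> 0"
      then obtain x where "x \<in> Q" "\<forall>j\<in>?J. g j x \<le> 0"
        by blast
      then have "x \<in> ?S \<inter> (\<Inter>\<xi>\<in>I. {x. \<xi> x \<le> s \<xi>})"
        by (auto simp: g_def)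
      then show ?thesis
        by blast
    next
      assume "\<exists>l. (\<forall>j\<in>?J. l j \<ge> 0) \<and> (\<forall>x\<in>Q. 0 < (\<Sum>j\<in>?J. l j * g j x))"
      then obtain l where l: "\<And>j. j \<in> ?J \<Longrightarrow> l j \<ge> 0" and pos: "\<And>x. x \<in> Q \<Longrightarrow> 0 < (\<Sum>j\<in>?J. l j * g j x)"
        by blast
      define \<eta> where "\<eta> x = (\<Sum>\<xi>\<in>I. l (Some \<xi>) * \<xi> x)" for x
      define \<zeta> where "\<zeta> x = l None * \<xi>0 x - \<eta> x" for x
      have \<eta>: "\<eta> \<in> topological_dual"
        unfolding \<eta>_def using I by (intro topological_dual_sum) (auto intro: topological_dual_closed(2))
      have \<zeta>: "\<zeta> \<in> topological_dual"
        unfolding \<zeta>_def by (rule topological_dual_closed(4)[OF topological_dual_closed(2)[OF \<xi>0 \<xi>0] \<eta>])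
      have "s (\<lambda>x. \<Sum>\<xi>\<in>I. l (Some \<xi>) * \<xi> x) \<le> (\<Sum>\<xi>\<in>I. l (Some \<xi>) * s \<xi>)"
        by (rule sublinear_on_dual_sum[where s = s, OF add scale I]) (use l in auto)
      moreover have "(\<lambda>x. \<Sum>\<xi>\<in>I. l (Some \<xi>) * \<xi> x) = \<eta>"
        by (rule ext) (simp add: \<eta>_def)
      ultimately have s_\<eta>: "s \<eta> \<le> (\<Sum>\<xi>\<in>I. l (Some \<xi>) * s \<xi>)"
        by simp
      obtain x where x: "x \<in> Q" "\<zeta> x = support_fun \<zeta> Q"
        using support_fun_ck(2)[OF Q \<zeta>] by blast
      have "(\<Sum>j\<in>?J. l j * g j x) = l None * (s \<xi>0 - \<xi>0 x) + (\<Sum>\<xi>\<in>I. l (Some \<xi>) * (\<xi> x - s \<xi>))"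
        using I(1) by (simp add: g_def sum.reindex)
      also have "\<dots> = l None * s \<xi>0 - \<zeta> x - (\<Sum>\<xi>\<in>I. l (Some \<xi>) * s \<xi>)"
        by (simp add: \<zeta>_def \<eta>_def algebra_simps sum_subtractf)
      finally have "\<zeta> x < l None * s \<xi>0 - (\<Sum>\<xi>\<in>I. l (Some \<xi>) * s \<xi>)"
        using pos[OF x(1)] by simp
      also have "\<dots> \<le> l None * s \<xi>0 - s \<eta>"
        using s_\<eta> by simp
      also have "l None * s \<xi>0 = s (\<lambda>x. \<zeta> x + \<eta> x)"
        using scale[OF \<xi>0, of "l None"] l by (simp add: \<zeta>_def)
      also have "s (\<lambda>x. \<zeta> x + \<eta> x) - s \<eta> \<le> s \<zeta>"
        using add[OF \<zeta> \<eta>] by simp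
      also have "\<dots> \<le> \<zeta> x"
        using dom[OF \<zeta>] x by simp
      finally show ?thesis
        by simp
    qed
  qed
  ultimately have "?S \<inter> (\<Inter>\<xi>\<in>topological_dual. {x. \<xi> x \<le> s \<xi>}) \<noteq> {}"
    by (rule compact_imp_fip_image)
  then show ?thesis
    by blast
qed

text \<open>
  Sublinear functionals on the dual that are dominated by the support function of a compact convex
  set are support functions themselves. The domination replaces any continuity assumption on \<open>s\<close>.
\<close>

lemma sublinear_on_dual_is_support_fun:
  fixes Q :: "'a::locally_convex_space set"
  assumes Q: "Q \<in> ck"
    and add: "\<And>\<xi> \<eta>. \<xi> \<in> topological_dual \<Longrightarrow> \<eta> \<in> topological_dual \<Longrightarrow> s (\<lambda>x. \<xi> x + \<eta> x) \<le> s \<xi> + s \<eta>"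
    and scale: "\<And>\<xi> c. \<xi> \<in> topological_dual \<Longrightarrow> c \<ge> 0 \<Longrightarrow> s (\<lambda>x. c * \<xi> x) = c * s \<xi>"
    and dom: "\<And>\<xi>. \<xi> \<in> topological_dual \<Longrightarrow> s \<xi> \<le> support_fun \<xi> Q"
  defines "F \<equiv> {x \<in> Q. \<forall>\<xi>\<in>topological_dual. \<xi> x \<le> s \<xi>}"
  shows "F \<in> ck" "\<And>\<xi>. \<xi> \<in> topological_dual \<Longrightarrow> support_fun \<xi> F = s \<xi>"
proof -
  have att: "\<exists>x\<in>Q. s \<xi> \<le> \<xi> x \<and> (\<forall>\<xi>\<in>topological_dual. \<xi> x \<le> s \<xi>)"
    if "\<xi> \<in> topological_dual" for \<xi>
    using add scale dom that by (rule sublinear_on_dual_attained[where s = s, OF Q])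
  have F: "F = Q \<inter> (\<Inter>\<xi>\<in>topological_dual. {x. \<xi> x \<le> s \<xi>})"
    unfolding F_def by auto
  have "F \<noteq> {}"
    using att[OF zero_topological_dual] unfolding F_def by blast
  moreover have "convex F"
    unfolding F
  proof (intro convex_Int convex_INT ckD(2)[OF Q] convexI)
    fix \<xi> x y and u v :: real
    assume \<xi>: "\<xi> \<in> topological_dual" and xy: "x \<in> {x. \<xi> x \<le> s \<xi>}" "y \<in> {x. \<xi> x \<le> s \<xi>}"
      and uv: "0 \<le> u" "0 \<le> v" "u + v = 1"
    have "u * \<xi> x + v * \<xi> y \<le> s \<xi>"
      using xy uv by (intro convex_bound_le) auto
    then show "u *\<^sub>R x + v *\<^sub>R y \<in> {x. \<xi> x \<le> s \<xi>}"
      using topological_dualD(3,5)[OF \<xi>] by simp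
  qed
  moreover have "compact F"
    unfolding F using topological_dualD(2)[of _ UNIV]
    by (intro compact_Int_closed ckD(3)[OF Q] closed_INT ballI closed_Collect_le continuous_on_const) auto
  ultimately show ck: "F \<in> ck"
    unfolding ck_def by auto
  fix \<xi>
  assume \<xi>: "\<xi> \<in> (topological_dual :: ('a \<Rightarrow> real) set)"
  obtain x where "x \<in> F" "s \<xi> \<le> \<xi> x"
    using att[OF \<xi>] unfolding F_def by blast
  then have "s \<xi> \<le> support_fun \<xi> F"
    using support_fun_ck(1)[OF ck \<xi>, of x] by simp
  moreover have "support_fun \<xi> F \<le> s \<xi>"
    using \<xi> by (intro support_fun_ck(3)[OF ck \<xi>]) (auto simp: F_def)
  ultimately show "support_fun \<xi> F = s \<xi>"
    by simp
qed

section \<open>Set-valued Radon-Nikodym derivatives\<close>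

lemma (in complete_measure) borel_measurable_AE_eq:
  fixes f h :: "'a \<Rightarrow> real"
  assumes h: "h \<in> borel_measurable M" and eq: "AE t in M. f t = h t"
  shows "f \<in> borel_measurable M"
proof (rule borel_measurableI_less)
  fix y
  have "AE t in M. t \<in> {t \<in> space M. h t < y} \<longleftrightarrow> t \<in> {t \<in> space M. f t < y}"
    using eq by eventually_elim auto
  moreover have "{t \<in> space M. h t < y} \<in> sets M"
    using h by measurable
  ultimately show "{t \<in> space M. f t < y} \<in> sets M"
    by (rule in_sets_AE) auto
qed

context finite_measure
begin

lemma AE_le_if_set_integrals_le:
  assumes h: "integrable M h" and g: "integrable M g"
    and le: "\<And>E. E \<in> sets M \<Longrightarrow> (\<integral>t\<in>E. h t \<partial>M) \<le> (\<integral>t\<in>E. g t \<partial>M)"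
  shows "AE t in M. h t \<le> (g t :: real)"
proof -
  note [measurable] = borel_measurable_integrable[OF h] borel_measurable_integrable[OF g]
  define E where "E = {t \<in> space M. g t < h t}"
  have E[measurable]: "E \<in> sets M"
    unfolding E_def by measurable
  have int: "integrable M (\<lambda>t. indicat_real E t * h t)" "integrable M (\<lambda>t. indicat_real E t * g t)"
    using integrable_mult_indicator[OF E h] integrable_mult_indicator[OF E g] by auto
  have nonneg: "0 \<le> indicat_real E t * h t - indicat_real E t * g t" for t
    by (auto simp: E_def split: split_indicator)
  have "(\<integral>t. indicat_real E t * h t - indicat_real E t * g t \<partial>M) \<le> 0"
    using le[OF E] int by (simp add: set_lebesgue_integral_def)
  moreover have "(\<integral>t. indicat_real E t * h t - indicat_real E t * g t \<partial>M) \<ge> 0"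
    using nonneg by (intro integral_nonneg_AE) auto
  ultimately have "(\<integral>t. indicat_real E t * h t - indicat_real E t * g t \<partial>M) = 0"
    by simp
  then have "AE t in M. indicat_real E t * h t - indicat_real E t * g t = 0"
    using nonneg int by (subst (asm) integral_nonneg_eq_0_iff_AE) auto
  then show ?thesis
    using AE_space
  proof eventually_elim
    case (elim t)
    then show ?case
      by (cases "t \<in> E") (auto simp: E_def)
  qed
qed

text \<open>
  The bound makes \<open>\<nu> + c \<mu>\<close> nonnegative and continuous at the empty set, hence a measure that is
  absolutely continuous with respect to \<open>\<mu>\<close> (the measure \<open>M\<close> here).
\<close>

lemma bounded_additive_has_density:
  fixes \<nu> :: "'a set \<Rightarrow> real"
  assumes add: "\<And>A B. A \<in> sets M \<Longrightarrow> B \<in> sets M \<Longrightarrow> A \<inter> B = {} \<Longrightarrow> \<nu> (A \<union> B) = \<nu> A + \<nu> B"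
    and bound: "\<And>A. A \<in> sets M \<Longrightarrow> \<bar>\<nu> A\<bar> \<le> c * measure M A"
  obtains h where "integrable M h" "ess_bounded h" "\<And>E. E \<in> sets M \<Longrightarrow> (\<integral>t\<in>E. h t \<partial>M) = \<nu> E"
proof -
  define w where "w E = \<nu> E + c * measure M E" for E
  have w0: "w E \<ge> 0" and w_le: "w E \<le> 2 * c * measure M E" if "E \<in> sets M" for E
    using bound[OF that] unfolding w_def by auto
  have w_add: "w (A \<union> B) = w A + w B" if "A \<in> sets M" "B \<in> sets M" "A \<inter> B = {}" for A B
    unfolding w_def using add[OF that] finite_measure_Union[OF that] by (simp add: algebra_simps)
  have w_empty: "w {} = 0"
    using w_add[of "{}" "{}"] by simp
  define N where "N = measure_of (space M) (sets M) (\<lambda>E. ennreal (w E))"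
  have N_sets: "sets N = sets M" and N_space: "space N = space M"
    unfolding N_def by (auto simp: sets.sets_measure_of_eq space_measure_of_conv)
  have pos: "positive (sets M) (\<lambda>E. ennreal (w E))"
    unfolding positive_def using w_empty by simp
  have "countably_additive (sets M) (\<lambda>E. ennreal (w E))"
  proof (rule sets.empty_continuous_imp_countably_additive[OF pos])
    show "Measure_Space.additive (sets M) (\<lambda>E. ennreal (w E))"
      unfolding Measure_Space.additive_def using w_add w0 by (auto simp: ennreal_plus)
    show "(\<lambda>i. ennreal (w (A i))) \<longlonglongrightarrow> 0"
      if A: "range A \<subseteq> sets M" "decseq A" "(\<Inter>i. A i) = {}" for A
    proof -
      have "(\<lambda>i. 2 * c * measure M (A i)) \<longlonglongrightarrow> 2 * c * measure M (\<Inter>i. A i)"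
        using A by (intro tendsto_mult_left finite_Lim_measure_decseq)
      then have "(\<lambda>i. 2 * c * measure M (A i)) \<longlonglongrightarrow> 0"
        using A(3) by simp
      moreover have "\<forall>\<^sub>F i in sequentially. 0 \<le> w (A i)"
        "\<forall>\<^sub>F i in sequentially. w (A i) \<le> 2 * c * measure M (A i)"
        using A(1) w0 w_le by (auto intro!: always_eventually)
      ultimately have "(\<lambda>i. w (A i)) \<longlonglongrightarrow> 0"
        by (rule tendsto_sandwich[OF _ _ tendsto_const, rotated 2])
      from tendsto_ennrealI[OF this] show ?thesis
        by simp
    qed
  qed auto
  then have ca: "countably_additive (sets N) (\<lambda>E. ennreal (w E))"
    unfolding N_sets .
  have N: "emeasure N E = ennreal (w E)" if "E \<in> sets M" for E
    by (rule emeasure_measure_of[OF N_def sets.space_closed pos[folded N_sets] ca])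
      (use that N_sets in simp)
  have "absolutely_continuous M N"
    unfolding absolutely_continuous_def
  proof
    fix E
    assume E: "E \<in> null_sets M"
    then have "E \<in> sets M" "measure M E = 0"
      by (auto simp: measure_def)
    then show "E \<in> null_sets N"
      using w0[of E] w_le[of E] N[of E] by (intro null_setsI) (auto simp: N_sets)
  qed
  then obtain f where f[measurable]: "f \<in> borel_measurable M" and fN: "density M f = N"
    using Radon_Nikodym[OF _ N_sets] by blast
  have fE: "(\<integral>\<^sup>+t. f t * indicator E t \<partial>M) = ennreal (w E)" if "E \<in> sets M" for E
    using N[OF that] that unfolding fN[symmetric] by (simp add: emeasure_density)
  have "(\<integral>\<^sup>+t. f t \<partial>M) = ennreal (w (space M))"
    using fE[of "space M"] by (simp cong: nn_integral_cong)
  then have fin: "AE t in M. f t \<noteq> \<infinity>"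
    by (intro nn_integral_PInf_AE) auto
  define h0 where "h0 t = enn2real (f t)" for t
  have h0[measurable]: "h0 \<in> borel_measurable M"
    unfolding h0_def by measurable
  have h0_E: "(\<integral>\<^sup>+t. ennreal (indicat_real E t * h0 t) \<partial>M) = ennreal (w E)" if "E \<in> sets M" for E
  proof -
    have "(\<integral>\<^sup>+t. ennreal (indicat_real E t * h0 t) \<partial>M) = (\<integral>\<^sup>+t. f t * indicator E t \<partial>M)"
      by (rule nn_integral_cong_AE, use fin in eventually_elim)
        (auto simp: h0_def less_top split: split_indicator)
    then show ?thesis
      unfolding fE[OF that] .
  qed
  have h0_int: "(\<integral>t. indicat_real E t * h0 t \<partial>M) = w E" if E[measurable]: "E \<in> sets M" for E
    using h0_E[OF E] w0[OF E] by (subst integral_eq_nn_integral) (auto simp: h0_def)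
  have "integrable M (\<lambda>t. indicat_real (space M) t * h0 t)"
    using h0_E[of "space M"] by (intro integrableI_nonneg) (auto simp: h0_def)
  then have h0i: "integrable M h0"
    by (rule Bochner_Integration.integrable_cong[THEN iffD1, rotated 2]) auto
  define h where "h t = h0 t - c" for t
  have hi: "integrable M h"
    unfolding h_def using h0i by simp
  have hE: "(\<integral>t\<in>E. h t \<partial>M) = \<nu> E" if E: "E \<in> sets M" for E
  proof -
    have "(\<integral>t\<in>E. h t \<partial>M) = (\<integral>t. indicat_real E t * h0 t - c * indicat_real E t \<partial>M)"
      unfolding set_lebesgue_integral_def h_def by (intro Bochner_Integration.integral_cong) (auto simp: algebra_simps)
    also have "\<dots> = w E - c * measure M E"
      using integrable_mult_indicator[OF E h0i] integrable_indicator_finite[OF E] h0_int[OF E] E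
      by simp
    finally show ?thesis
      by (simp add: w_def)
  qed
  have cE: "(\<integral>t\<in>E. d \<partial>M) = d * measure M E" if "E \<in> sets M" for E and d :: real
    using that by (simp add: set_lebesgue_integral_def)
  have "AE t in M. h t \<le> c"
  proof (rule AE_le_if_set_integrals_le[OF hi])
    show "(\<integral>t\<in>E. h t \<partial>M) \<le> (\<integral>t\<in>E. c \<partial>M)" if "E \<in> sets M" for E
      unfolding hE[OF that] cE[OF that] using bound[OF that] by auto
  qed auto
  moreover have "AE t in M. - c \<le> h t"
  proof (rule AE_le_if_set_integrals_le[OF _ hi])
    show "(\<integral>t\<in>E. - c \<partial>M) \<le> (\<integral>t\<in>E. h t \<partial>M)" if "E \<in> sets M" for E
      unfolding hE[OF that] cE[OF that] using bound[OF that] by auto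
  qed auto
  ultimately have "AE t in M. \<bar>h t\<bar> \<le> c"
    by eventually_elim auto
  then have "ess_bounded h"
    unfolding ess_bounded_def using hi by auto
  then show ?thesis
    using that hi hE by blast
qed

text \<open>
  Selectors \<open>m\<close> appear in the same form, as \<open>\<lambda>E. {m E}\<close>; this makes densities of vector measures
  a special case of densities of set-valued measures.
\<close>

definition dominated_multimeasure :: "'b::locally_convex_space set \<Rightarrow> ('a set \<Rightarrow> 'b set) \<Rightarrow> bool" where
  "dominated_multimeasure Q N \<longleftrightarrow>
     (\<forall>E\<in>sets M. N E \<in> ck \<and> N E \<subseteq> (\<lambda>x. measure M E *\<^sub>R x) ` Q) \<and>
     (\<forall>A\<in>sets M. \<forall>B\<in>sets M. A \<inter> B = {} \<longrightarrow> N (A \<union> B) = {a + b | a b. a \<in> N A \<and> b \<in> N B})"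

lemma dominated_multimeasureD:
  assumes "dominated_multimeasure Q N" "E \<in> sets M"
  shows "N E \<in> ck" "N E \<subseteq> (\<lambda>x. measure M E *\<^sub>R x) ` Q"
    "B \<in> sets M \<Longrightarrow> E \<inter> B = {} \<Longrightarrow> N (E \<union> B) = {a + b | a b. a \<in> N E \<and> b \<in> N B}"
  using assms unfolding dominated_multimeasure_def by blast+

lemma support_fun_multimeasure_add:
  assumes N: "dominated_multimeasure Q N" and \<xi>: "\<xi> \<in> topological_dual"
    and A: "A \<in> sets M" and B: "B \<in> sets M" and disj: "A \<inter> B = {}"
  shows "support_fun \<xi> (N (A \<union> B)) = support_fun \<xi> (N A) + support_fun \<xi> (N B)"
proof (rule antisym)
  note ND = dominated_multimeasureD[OF N]
  have AB: "A \<union> B \<in> sets M"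
    using A B by blast
  note eq = ND(3)[OF A B disj] and add = topological_dualD(3)[OF \<xi>]
  show "support_fun \<xi> (N (A \<union> B)) \<le> support_fun \<xi> (N A) + support_fun \<xi> (N B)"
    using support_fun_ck(1)[OF ND(1)[OF A] \<xi>] support_fun_ck(1)[OF ND(1)[OF B] \<xi>]
    by (intro support_fun_ck(3)[OF ND(1)[OF AB] \<xi>]) (auto simp: eq add intro!: add_mono)
  obtain a b where a: "a \<in> N A" "\<xi> a = support_fun \<xi> (N A)" and b: "b \<in> N B" "\<xi> b = support_fun \<xi> (N B)"
    using support_fun_ck(2)[OF ND(1)[OF A] \<xi>] support_fun_ck(2)[OF ND(1)[OF B] \<xi>] by blast
  have "a + b \<in> N (A \<union> B)"
    using a b eq by blast
  from support_fun_ck(1)[OF ND(1)[OF AB] \<xi> this]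
  show "support_fun \<xi> (N A) + support_fun \<xi> (N B) \<le> support_fun \<xi> (N (A \<union> B))"
    using a b add by simp
qed

lemma dual_bounded_on_ck:
  assumes Q: "Q \<in> ck" and \<xi>: "\<xi> \<in> topological_dual"
  obtains c where "\<And>x. x \<in> Q \<Longrightarrow> \<bar>\<xi> x\<bar> \<le> c"
proof -
  have "(\<lambda>x. - \<xi> x) \<in> topological_dual"
    using topological_dual_closed(3)[OF \<xi> \<xi>] .
  then have "\<bar>\<xi> x\<bar> \<le> max (support_fun \<xi> Q) (support_fun (\<lambda>x. - \<xi> x) Q)" if "x \<in> Q" for x
    using support_fun_ck(1)[OF Q \<xi> that] support_fun_ck(1)[OF Q, of "\<lambda>x. - \<xi> x" x] that by auto
  then show ?thesis
    using that by blast
qed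

lemma support_fun_multimeasure_le:
  assumes N: "dominated_multimeasure Q N" and Q: "Q \<in> ck" and \<xi>: "\<xi> \<in> topological_dual"
    and E: "E \<in> sets M"
  shows "support_fun \<xi> (N E) \<le> support_fun \<xi> Q * measure M E"
proof (rule support_fun_ck(3)[OF dominated_multimeasureD(1)[OF N E] \<xi>])
  fix y
  assume "y \<in> N E"
  then obtain x where x: "x \<in> Q" "y = measure M E *\<^sub>R x"
    using dominated_multimeasureD(2)[OF N E] by blast
  have "\<xi> x * measure M E \<le> support_fun \<xi> Q * measure M E"
    by (intro mult_right_mono support_fun_ck(1)[OF Q \<xi> x(1)] measure_nonneg)
  then show "\<xi> y \<le> support_fun \<xi> Q * measure M E"
    using x topological_dualD(5)[OF \<xi>] by (simp add: mult.commute)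
qed

lemma multimeasure_scalar_density:
  assumes N: "dominated_multimeasure Q N" and Q: "Q \<in> ck" and \<xi>: "\<xi> \<in> topological_dual"
  obtains h where "integrable M h" "ess_bounded h"
    "\<And>E. E \<in> sets M \<Longrightarrow> (\<integral>t\<in>E. h t \<partial>M) = support_fun \<xi> (N E)"
proof -
  obtain c where c: "\<And>x. x \<in> Q \<Longrightarrow> \<bar>\<xi> x\<bar> \<le> c"
    using dual_bounded_on_ck[OF Q \<xi>] by blast
  have "\<bar>support_fun \<xi> (N E)\<bar> \<le> c * measure M E" if E: "E \<in> sets M" for E
  proof -
    obtain y where y: "y \<in> N E" "\<xi> y = support_fun \<xi> (N E)"
      using support_fun_ck(2)[OF dominated_multimeasureD(1)[OF N E] \<xi>] by blast
    obtain x where x: "x \<in> Q" "y = measure M E *\<^sub>R x"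
      using dominated_multimeasureD(2)[OF N E] y by blast
    have "\<bar>\<xi> x\<bar> * measure M E \<le> c * measure M E"
      by (intro mult_right_mono c x measure_nonneg)
    then show ?thesis
      using x topological_dualD(5)[OF \<xi>] by (simp add: y(2)[symmetric] abs_mult mult.commute)
  qed
  then show ?thesis
    using bounded_additive_has_density[of "\<lambda>E. support_fun \<xi> (N E)" c]
      support_fun_multimeasure_add[OF N \<xi>] that by metis
qed

text \<open>
  \<open>\<Phi> N\<close> is a set-valued Radon-Nikodym derivative of \<open>N\<close>. The derivatives are chosen for all \<open>N\<close>
  simultaneously, so that inclusions between set-valued measures persist at every single point.
\<close>

definition set_density_operator ::
  "'b::locally_convex_space set \<Rightarrow> (('a set \<Rightarrow> 'b set) \<Rightarrow> 'a \<Rightarrow> 'b set) \<Rightarrow> bool" where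
  "set_density_operator Q \<Phi> \<longleftrightarrow>
     (\<forall>N. dominated_multimeasure Q N \<longrightarrow>
        (\<forall>t\<in>space M. \<Phi> N t \<in> ck \<and> \<Phi> N t \<subseteq> Q) \<and>
        (\<forall>\<xi>\<in>topological_dual. integrable M (\<lambda>t. support_fun \<xi> (\<Phi> N t)) \<and>
           (\<forall>E\<in>sets M. (\<integral>t\<in>E. support_fun \<xi> (\<Phi> N t) \<partial>M) = support_fun \<xi> (N E))) \<and>
        (\<forall>N'. dominated_multimeasure Q N' \<longrightarrow> (\<forall>E\<in>sets M. N E \<subseteq> N' E) \<longrightarrow>
           (\<forall>t\<in>space M. \<Phi> N t \<subseteq> \<Phi> N' t)))"

lemma set_density_operatorD:
  assumes "set_density_operator Q \<Phi>" "dominated_multimeasure Q N"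
  shows "t \<in> space M \<Longrightarrow> \<Phi> N t \<in> ck \<and> \<Phi> N t \<subseteq> Q"
    "\<xi> \<in> topological_dual \<Longrightarrow> integrable M (\<lambda>t. support_fun \<xi> (\<Phi> N t)) \<and>
       (\<forall>E\<in>sets M. (\<integral>t\<in>E. support_fun \<xi> (\<Phi> N t) \<partial>M) = support_fun \<xi> (N E))"
    "dominated_multimeasure Q N' \<Longrightarrow> \<forall>E\<in>sets M. N E \<subseteq> N' E \<Longrightarrow> t \<in> space M \<Longrightarrow> \<Phi> N t \<subseteq> \<Phi> N' t"
  using assms unfolding set_density_operator_def by blast+

text \<open>
  The support function of the derivative at \<open>t\<close> should be \<open>\<xi> \<mapsto> dens N \<xi> t\<close>, with \<open>dens N \<xi>\<close> a
  density of the scalar measure \<open>E \<mapsto> support_fun \<xi> (N E)\<close>. These densities are sublinear in \<open>\<xi>\<close>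
  and dominated by the support function of \<open>Q\<close> only almost everywhere, with uncountably many
  exceptional sets. A sublinear lifting removes all of them at once, and
  \<open>sublinear_on_dual_is_support_fun\<close> then yields the sets.
\<close>

theorem multimeasure_density:
  fixes Q :: "'b::locally_convex_space set"
  assumes complete: "complete_measure M" and Q: "Q \<in> ck"
  obtains \<Phi> where "set_density_operator Q \<Phi>"
proof -
  interpret complete_measure M
    by (rule complete)
  define dens where "dens N \<xi> = (SOME h. integrable M h \<and> ess_bounded h \<and>
      (\<forall>E\<in>sets M. (\<integral>t\<in>E. h t \<partial>M) = support_fun \<xi> (N E)))" for N and \<xi> :: "'b \<Rightarrow> real"
  have dens: "integrable M (dens N \<xi>)" "ess_bounded (dens N \<xi>)"
      "E \<in> sets M \<Longrightarrow> (\<integral>t\<in>E. dens N \<xi> t \<partial>M) = support_fun \<xi> (N E)"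
    if "dominated_multimeasure Q N" "\<xi> \<in> topological_dual" for N \<xi> E
  proof -
    have "\<exists>h. integrable M h \<and> ess_bounded h \<and> (\<forall>E\<in>sets M. (\<integral>t\<in>E. h t \<partial>M) = support_fun \<xi> (N E))"
      using multimeasure_scalar_density[OF that(1) Q that(2)] by metis
    from someI_ex[OF this] show "integrable M (dens N \<xi>)" "ess_bounded (dens N \<xi>)"
      "E \<in> sets M \<Longrightarrow> (\<integral>t\<in>E. dens N \<xi> t \<partial>M) = support_fun \<xi> (N E)"
      unfolding dens_def by auto
  qed
  note main = that
  have result: thesis
    if ck: "\<And>N t. dominated_multimeasure Q N \<Longrightarrow> t \<in> space M \<Longrightarrow> \<Phi> N t \<in> ck \<and> \<Phi> N t \<subseteq> Q"
      and ae: "\<And>N \<xi>. dominated_multimeasure Q N \<Longrightarrow> \<xi> \<in> topological_dual \<Longrightarrow>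
        AE t in M. support_fun \<xi> (\<Phi> N t) = dens N \<xi> t"
      and mono: "\<And>N N' t. dominated_multimeasure Q N \<Longrightarrow> dominated_multimeasure Q N' \<Longrightarrow>
        \<forall>E\<in>sets M. N E \<subseteq> N' E \<Longrightarrow> t \<in> space M \<Longrightarrow> \<Phi> N t \<subseteq> \<Phi> N' t" for \<Phi>
  proof (rule main[of \<Phi>], unfold set_density_operator_def, intro allI impI conjI ballI)
    show "\<Phi> N t \<in> ck" "\<Phi> N t \<subseteq> Q" if "dominated_multimeasure Q N" "t \<in> space M" for N t
      using ck[OF that] by auto
    show "\<Phi> N t \<subseteq> \<Phi> N' t"
      if "dominated_multimeasure Q N" "dominated_multimeasure Q N'"
        "\<forall>E\<in>sets M. N E \<subseteq> N' E" "t \<in> space M" for N N' t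
      using that by (rule mono)
  next
    fix N and \<xi> :: "'b \<Rightarrow> real"
    assume N: "dominated_multimeasure Q N" and \<xi>: "\<xi> \<in> topological_dual"
    note d = dens[OF N \<xi>] and eq = ae[OF N \<xi>]
    have [measurable]: "dens N \<xi> \<in> borel_measurable M"
      using d(1) by auto
    have [measurable]: "(\<lambda>t. support_fun \<xi> (\<Phi> N t)) \<in> borel_measurable M"
      by (rule borel_measurable_AE_eq[OF _ eq]) measurable
    have "integrable M (\<lambda>t. support_fun \<xi> (\<Phi> N t))"
      using d(1) eq by (subst integrable_cong_AE[of _ _ "dens N \<xi>"]) auto
    moreover have "(\<integral>t\<in>E. support_fun \<xi> (\<Phi> N t) \<partial>M) = support_fun \<xi> (N E)" if E[measurable]: "E \<in> sets M" for E
    proof -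
      have "AE t in M. indicat_real E t *\<^sub>R support_fun \<xi> (\<Phi> N t) = indicat_real E t *\<^sub>R dens N \<xi> t"
        using eq by eventually_elim simp
      then have "(\<integral>t\<in>E. support_fun \<xi> (\<Phi> N t) \<partial>M) = (\<integral>t\<in>E. dens N \<xi> t \<partial>M)"
        unfolding set_lebesgue_integral_def by (intro integral_cong_AE) measurable
      then show ?thesis
        using d(3)[OF E] by simp
    qed
    ultimately show "integrable M (\<lambda>t. support_fun \<xi> (\<Phi> N t))"
      "\<And>E. E \<in> sets M \<Longrightarrow> (\<integral>t\<in>E. support_fun \<xi> (\<Phi> N t) \<partial>M) = support_fun \<xi> (N E)"
      by blast+
  qed
  show thesis
  proof (cases "measure M (space M) > 0")
    case False
    \<comment> \<open>on a null space every condition on integrals is void, and \<open>Q\<close> serves for all \<open>N\<close>\<close>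
    then have "space M \<in> null_sets M"
      by (auto simp: null_sets_def emeasure_eq_measure not_less measure_le_0_iff)
    then have "AE t in M. P t" for P
      by (rule AE_I') auto
    then show ?thesis
      by (intro result[of "\<lambda>N t. Q"]) (use Q in auto)
  next
    case True
    then obtain U where U: "sublinear_lifting U"
      using sublinear_lifting_exists by blast
    note UD = sublinear_liftingD[OF U]
    define \<Phi> where "\<Phi> N t = {x \<in> Q. \<forall>\<xi>\<in>topological_dual. \<xi> x \<le> U (dens N \<xi>) t}" for N t
    have supp: "\<Phi> N t \<in> ck" "\<xi> \<in> topological_dual \<Longrightarrow> support_fun \<xi> (\<Phi> N t) = U (dens N \<xi>) t"
      if N: "dominated_multimeasure Q N" and t: "t \<in> space M" for N t \<xi>
    proof -
      note d = dens[OF N]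
      have add: "U (dens N (\<lambda>x. \<xi> x + \<eta> x)) t \<le> U (dens N \<xi>) t + U (dens N \<eta>) t"
        if \<xi>: "\<xi> \<in> topological_dual" and \<eta>: "\<eta> \<in> topological_dual" for \<xi> \<eta>
      proof -
        note \<xi>\<eta> = topological_dual_closed(1)[OF \<xi> \<eta>]
        have "AE t in M. dens N (\<lambda>x. \<xi> x + \<eta> x) t \<le> dens N \<xi> t + dens N \<eta> t"
        proof (rule AE_le_if_set_integrals_le[OF d(1)[OF \<xi>\<eta>]])
          fix E
          assume E: "E \<in> sets M"
          have ND: "N E \<in> ck"
            by (rule dominated_multimeasureD(1)[OF N E])
          have "(\<integral>t\<in>E. dens N \<xi> t + dens N \<eta> t \<partial>M) = (\<integral>t\<in>E. dens N \<xi> t \<partial>M) + (\<integral>t\<in>E. dens N \<eta> t \<partial>M)"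
            unfolding set_lebesgue_integral_def
            using integrable_mult_indicator[OF E d(1)[OF \<xi>]] integrable_mult_indicator[OF E d(1)[OF \<eta>]]
            by (simp add: distrib_left)
          moreover have "support_fun (\<lambda>x. \<xi> x + \<eta> x) (N E) \<le> support_fun \<xi> (N E) + support_fun \<eta> (N E)"
            using support_fun_ck(1)[OF ND \<xi>] support_fun_ck(1)[OF ND \<eta>]
            by (intro support_fun_ck(3)[OF ND \<xi>\<eta>]) (auto intro: add_mono)
          ultimately show "(\<integral>t\<in>E. dens N (\<lambda>x. \<xi> x + \<eta> x) t \<partial>M) \<le> (\<integral>t\<in>E. dens N \<xi> t + dens N \<eta> t \<partial>M)"
            using d(3)[OF \<xi> E] d(3)[OF \<eta> E] d(3)[OF \<xi>\<eta> E] by simp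
        qed (use d(1)[OF \<xi>] d(1)[OF \<eta>] in auto)
        then have "U (dens N (\<lambda>x. \<xi> x + \<eta> x)) t \<le> U (\<lambda>t. dens N \<xi> t + dens N \<eta> t) t"
          by (intro UD(1) d(2) \<xi>\<eta> t ess_bounded_add \<xi> \<eta>)
        also have "\<dots> \<le> U (dens N \<xi>) t + U (dens N \<eta>) t"
          by (intro UD(2) d(2) \<xi> \<eta> t)
        finally show ?thesis .
      qed
      have scale: "U (dens N (\<lambda>x. c * \<xi> x)) t = c * U (dens N \<xi>) t"
        if \<xi>: "\<xi> \<in> topological_dual" and c: "c \<ge> 0" for \<xi> c
      proof -
        note c\<xi> = topological_dual_closed(2)[OF \<xi> \<xi>, of c]
        have eq: "(\<integral>t\<in>E. dens N (\<lambda>x. c * \<xi> x) t \<partial>M) = (\<integral>t\<in>E. c * dens N \<xi> t \<partial>M)" if E: "E \<in> sets M" for E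
        proof -
          have ND: "N E \<in> ck"
            by (rule dominated_multimeasureD(1)[OF N E])
          obtain y where y: "y \<in> N E" "\<xi> y = support_fun \<xi> (N E)"
            using support_fun_ck(2)[OF ND \<xi>] by blast
          have "support_fun (\<lambda>x. c * \<xi> x) (N E) = c * support_fun \<xi> (N E)"
          proof (rule antisym)
            show "support_fun (\<lambda>x. c * \<xi> x) (N E) \<le> c * support_fun \<xi> (N E)"
              using support_fun_ck(1)[OF ND \<xi>] c
              by (intro support_fun_ck(3)[OF ND c\<xi>]) (auto intro: mult_left_mono)
            show "c * support_fun \<xi> (N E) \<le> support_fun (\<lambda>x. c * \<xi> x) (N E)"
              using support_fun_ck(1)[OF ND c\<xi> y(1)] y(2) by simp
          qed
          then show ?thesis
            using d(3)[OF \<xi> E] d(3)[OF c\<xi> E] by simp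
        qed
        have "AE t in M. dens N (\<lambda>x. c * \<xi> x) t \<le> c * dens N \<xi> t"
          "AE t in M. c * dens N \<xi> t \<le> dens N (\<lambda>x. c * \<xi> x) t"
          using eq d(1)[OF \<xi>] d(1)[OF c\<xi>] by (intro AE_le_if_set_integrals_le; simp)+
        then have "U (dens N (\<lambda>x. c * \<xi> x)) t = U (\<lambda>t. c * dens N \<xi> t) t"
          by (intro antisym UD(1) d(2) c\<xi> t ess_bounded_cmult \<xi>)
        then show ?thesis
          using UD(3)[OF d(2)[OF \<xi>] t c] by simp
      qed
      have dom: "U (dens N \<xi>) t \<le> support_fun \<xi> Q" if \<xi>: "\<xi> \<in> topological_dual" for \<xi>
      proof (rule UD(4)[OF d(2)[OF \<xi>] t])
        show "AE t in M. dens N \<xi> t \<le> support_fun \<xi> Q"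
        proof (rule AE_le_if_set_integrals_le[OF d(1)[OF \<xi>]])
          fix E
          assume E: "E \<in> sets M"
          have "(\<integral>t\<in>E. support_fun \<xi> Q \<partial>M) = support_fun \<xi> Q * measure M E"
            using E by (simp add: set_lebesgue_integral_def)
          then show "(\<integral>t\<in>E. dens N \<xi> t \<partial>M) \<le> (\<integral>t\<in>E. support_fun \<xi> Q \<partial>M)"
            using d(3)[OF \<xi> E] support_fun_multimeasure_le[OF N Q \<xi> E] by simp
        qed auto
      qed
      note * = sublinear_on_dual_is_support_fun[where s = "\<lambda>\<xi>. U (dens N \<xi>) t", OF Q]
      show "\<Phi> N t \<in> ck"
        unfolding \<Phi>_def using add scale dom by (rule *(1))
      show "\<xi> \<in> topological_dual \<Longrightarrow> support_fun \<xi> (\<Phi> N t) = U (dens N \<xi>) t"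
        unfolding \<Phi>_def using add scale dom by (rule *(2))
    qed
    show ?thesis
    proof (rule result[of \<Phi>])
      fix N t
      assume N: "dominated_multimeasure Q N" and t: "t \<in> space M"
      show "\<Phi> N t \<in> ck \<and> \<Phi> N t \<subseteq> Q"
        using supp(1)[OF N t] unfolding \<Phi>_def by auto
      fix N'
      assume N': "dominated_multimeasure Q N'" and sub: "\<forall>E\<in>sets M. N E \<subseteq> N' E"
      have "U (dens N \<xi>) t \<le> U (dens N' \<xi>) t" if \<xi>: "\<xi> \<in> topological_dual" for \<xi>
      proof (intro UD(1) dens(2) N N' \<xi> t)
        show "AE t in M. dens N \<xi> t \<le> dens N' \<xi> t"
        proof (rule AE_le_if_set_integrals_le[OF dens(1)[OF N \<xi>] dens(1)[OF N' \<xi>]])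
          fix E
          assume E: "E \<in> sets M"
          note ck = dominated_multimeasureD(1)[OF N E] dominated_multimeasureD(1)[OF N' E]
          have "support_fun \<xi> (N E) \<le> support_fun \<xi> (N' E)"
            using bspec[OF sub E] by (intro support_fun_ck(3)[OF ck(1) \<xi>] support_fun_ck(1)[OF ck(2) \<xi>]) auto
          then show "(\<integral>t\<in>E. dens N \<xi> t \<partial>M) \<le> (\<integral>t\<in>E. dens N' \<xi> t \<partial>M)"
            using dens(3)[OF N \<xi> E] dens(3)[OF N' \<xi> E] by simp
        qed
      qed
      then show "\<Phi> N t \<subseteq> \<Phi> N' t"
        unfolding \<Phi>_def by (auto intro: order_trans)
    next
      fix N and \<xi> :: "'b \<Rightarrow> real"
      assume N: "dominated_multimeasure Q N" and \<xi>: "\<xi> \<in> topological_dual"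
      have "AE t in M. U (dens N \<xi>) t = dens N \<xi> t"
        using U dens(2)[OF N \<xi>] unfolding sublinear_lifting_def by blast
      then show "AE t in M. support_fun \<xi> (\<Phi> N t) = dens N \<xi> t"
        using AE_space by eventually_elim (simp add: supp(2)[OF N _ \<xi>])
    qed
  qed
qed

end

section \<open>Integration by seminorm\<close>

text \<open>
  The defining property of \<open>seminorm_integral\<close>, so that existence and uniqueness can be stated.
\<close>

definition is_seminorm_integral ::
  "'w measure \<Rightarrow> 'w set \<Rightarrow> ('w \<Rightarrow> 'a::locally_convex_space) \<Rightarrow> 'a \<Rightarrow> bool" where
  "is_seminorm_integral \<mu> E f x \<longleftrightarrow>
     (\<exists>g. \<forall>p\<in>continuous_seminorms.
        simple_approx_ae \<mu> p f (g p) \<and> simple_approx_L1 \<mu> p f (g p) \<and>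
        (\<lambda>n. p (x - simple_integral_on \<mu> E (g p n))) \<longlonglongrightarrow> 0)"

context finite_measure
begin

lemma dual_simple_integral:
  assumes g: "simple_function M g" and \<xi>: "\<xi> \<in> topological_dual" and E: "E \<in> sets M"
  shows "integrable M (\<lambda>t. \<xi> (g t))" "(\<integral>t\<in>E. \<xi> (g t) \<partial>M) = \<xi> (simple_integral_on M E g)"
proof -
  have "simple_function M (\<lambda>t. \<xi> (g t))"
    by (rule simple_function_compose1[OF g])
  then show "integrable M (\<lambda>t. \<xi> (g t))"
    by (rule integrableI_simple_bochner_integrable[OF simple_bochner_integrable.intros])
      (simp add: emeasure_eq_measure)
  let ?I = "g ` space M"
  have fin: "finite ?I"
    using g simple_functionD(1) by blast
  have s: "E \<inter> g -` {x} \<in> sets M" for x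
  proof -
    have "E \<inter> g -` {x} = E \<inter> (g -` {x} \<inter> space M)"
      using sets.sets_into_space[OF E] by auto
    then show ?thesis
      using E simple_functionD(2)[OF g, of "{x}"] by auto
  qed
  have "(\<integral>t\<in>E. \<xi> (g t) \<partial>M) = (\<integral>t. (\<Sum>x\<in>?I. \<xi> x * indicat_real (E \<inter> g -` {x}) t) \<partial>M)"
    unfolding set_lebesgue_integral_def
  proof (rule Bochner_Integration.integral_cong[OF refl])
    fix t
    assume t: "t \<in> space M"
    have "(\<Sum>x\<in>?I. \<xi> x * indicat_real (E \<inter> g -` {x}) t) = (\<Sum>x\<in>?I. if g t = x then \<xi> x * indicat_real E t else 0)"
      by (intro sum.cong refl) (auto split: split_indicator)
    also have "\<dots> = \<xi> (g t) * indicat_real E t"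
      using fin t by simp
    finally show "indicat_real E t *\<^sub>R \<xi> (g t) = (\<Sum>x\<in>?I. \<xi> x * indicat_real (E \<inter> g -` {x}) t)"
      by simp
  qed
  also have "\<dots> = (\<Sum>x\<in>?I. \<xi> x * measure M (E \<inter> g -` {x}))"
    using integrable_indicator_finite[OF s] s by (subst Bochner_Integration.integral_sum) auto
  also have "\<dots> = \<xi> (simple_integral_on M E g)"
    unfolding simple_integral_on_def topological_dualD(8)[OF \<xi>] topological_dualD(5)[OF \<xi>]
    by (simp add: mult.commute)
  finally show "(\<integral>t\<in>E. \<xi> (g t) \<partial>M) = \<xi> (simple_integral_on M E g)" .
qed

text \<open>
  For the continuous seminorm \<open>\<bar>\<xi>\<bar>\<close>, convergence by seminorm is ordinary \<open>L1\<close>-convergence of the scalar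
  functions \<open>\<xi> \<circ> g n\<close> to \<open>\<xi> \<circ> f\<close>.
\<close>

lemma dual_of_L1_limit:
  assumes complete: "complete_measure M" and \<xi>: "\<xi> \<in> topological_dual"
    and ae: "simple_approx_ae M (\<lambda>x. \<bar>\<xi> x\<bar>) f g" and L1: "simple_approx_L1 M (\<lambda>x. \<bar>\<xi> x\<bar>) f g"
  shows "integrable M (\<lambda>t. \<xi> (f t))"
    "E \<in> sets M \<Longrightarrow> (\<lambda>n. \<xi> (simple_integral_on M E (g n))) \<longlonglongrightarrow> (\<integral>t\<in>E. \<xi> (f t) \<partial>M)"
proof -
  interpret complete_measure M
    by (rule complete)
  note diff = topological_dualD(4)[OF \<xi>]
  have g: "simple_function M (g n)" for n
    using ae unfolding simple_approx_ae_def by blast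
  have gi: "integrable M (\<lambda>t. \<xi> (g n t))" for n
    by (rule dual_simple_integral(1)[OF g \<xi> sets.top])
  then have gm[measurable]: "(\<lambda>t. \<xi> (g n t)) \<in> borel_measurable M" for n
    by blast
  obtain Z where Z: "Z \<in> null_sets M" "\<And>t. t \<in> space M - Z \<Longrightarrow> (\<lambda>n. \<bar>\<xi> (g n t - f t)\<bar>) \<longlonglongrightarrow> 0"
    using ae unfolding simple_approx_ae_def by blast
  have conv: "(\<lambda>n. \<xi> (g n t)) \<longlonglongrightarrow> \<xi> (f t)" if "t \<in> space M - Z" for t
    using Z(2)[OF that] unfolding diff by (simp add: tendsto_rabs_zero_iff LIM_zero_iff)
  have "AE t in M. t \<notin> Z"
    by (rule AE_not_in[OF Z(1)])
  then have "AE t in M. \<xi> (f t) = lim (\<lambda>n. \<xi> (g n t))"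
    using AE_space by eventually_elim (use limI[OF conv] in auto)
  moreover have "(\<lambda>t. lim (\<lambda>n. \<xi> (g n t))) \<in> borel_measurable M"
    by (rule borel_measurable_lim_metric) measurable
  ultimately have fm[measurable]: "(\<lambda>t. \<xi> (f t)) \<in> borel_measurable M"
    using borel_measurable_AE_eq[of "\<lambda>t. lim (\<lambda>n. \<xi> (g n t))" "\<lambda>t. \<xi> (f t)"] by blast
  have "integrable M (\<lambda>t. \<bar>\<xi> (g n t) - \<xi> (f t)\<bar>)" for n
    using L1 unfolding simple_approx_L1_def diff by blast
  then have di: "integrable M (\<lambda>t. \<xi> (g n t) - \<xi> (f t))" for n
    using integrable_abs_iff[OF borel_measurable_diff[OF gm fm]] by blast
  have "integrable M (\<lambda>t. \<xi> (g 0 t) - (\<xi> (g 0 t) - \<xi> (f t)))"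
    using gi[of 0] di[of 0] by (rule Bochner_Integration.integrable_diff)
  then show fi: "integrable M (\<lambda>t. \<xi> (f t))"
    by simp
  assume E: "E \<in> sets M"
  have bound: "norm (\<xi> (simple_integral_on M E (g n)) - (\<integral>t\<in>E. \<xi> (f t) \<partial>M)) \<le> (\<integral>t. \<bar>\<xi> (g n t - f t)\<bar> \<partial>M)" for n
  proof -
    have "\<xi> (simple_integral_on M E (g n)) - (\<integral>t\<in>E. \<xi> (f t) \<partial>M)
        = (\<integral>t. indicat_real E t * (\<xi> (g n t) - \<xi> (f t)) \<partial>M)"
      unfolding dual_simple_integral(2)[OF g \<xi> E, symmetric] set_lebesgue_integral_def
      using integrable_mult_indicator[OF E gi[of n]] integrable_mult_indicator[OF E fi]
      by (simp add: right_diff_distrib)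
    also have "\<bar>\<dots>\<bar> \<le> (\<integral>t. \<bar>indicat_real E t * (\<xi> (g n t) - \<xi> (f t))\<bar> \<partial>M)"
      by (rule integral_abs_bound)
    also have "\<dots> \<le> (\<integral>t. \<bar>\<xi> (g n t - f t)\<bar> \<partial>M)"
      using integrable_mult_indicator[OF E di[of n]] di[of n]
      by (intro integral_mono) (auto simp: diff split: split_indicator)
    finally show ?thesis
      unfolding real_norm_def .
  qed
  have lim0: "(\<lambda>n. \<integral>t. \<bar>\<xi> (g n t - f t)\<bar> \<partial>M) \<longlonglongrightarrow> 0"
    using L1 unfolding simple_approx_L1_def by blast
  have "(\<lambda>n. \<xi> (simple_integral_on M E (g n)) - (\<integral>t\<in>E. \<xi> (f t) \<partial>M)) \<longlonglongrightarrow> 0"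
    by (rule Lim_null_comparison[OF always_eventually[rule_format, OF bound] lim0])
  then show "(\<lambda>n. \<xi> (simple_integral_on M E (g n))) \<longlonglongrightarrow> (\<integral>t\<in>E. \<xi> (f t) \<partial>M)"
    by (simp add: LIM_zero_iff)
qed

lemma dual_seminorm_integral:
  assumes complete: "complete_measure M" and x: "is_seminorm_integral M E f x" and E: "E \<in> sets M"
    and \<xi>: "\<xi> \<in> topological_dual"
  shows "integrable M (\<lambda>t. \<xi> (f t))" "\<xi> x = (\<integral>t\<in>E. \<xi> (f t) \<partial>M)"
proof -
  obtain g where ae: "simple_approx_ae M (\<lambda>x. \<bar>\<xi> x\<bar>) f g" and L1: "simple_approx_L1 M (\<lambda>x. \<bar>\<xi> x\<bar>) f g"
    and lim: "(\<lambda>n. \<bar>\<xi> (x - simple_integral_on M E (g n))\<bar>) \<longlonglongrightarrow> 0"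
    using x abs_dual_continuous_seminorm[OF \<xi>] unfolding is_seminorm_integral_def by blast
  show "integrable M (\<lambda>t. \<xi> (f t))"
    by (rule dual_of_L1_limit(1)[OF complete \<xi> ae L1])
  have "(\<lambda>n. \<xi> x - \<xi> (simple_integral_on M E (g n))) \<longlonglongrightarrow> 0"
    using lim unfolding topological_dualD(4)[OF \<xi>] by (simp add: tendsto_rabs_zero_iff)
  moreover have "(\<lambda>n. \<xi> x - \<xi> (simple_integral_on M E (g n))) \<longlonglongrightarrow> \<xi> x - (\<integral>t\<in>E. \<xi> (f t) \<partial>M)"
    by (intro tendsto_diff tendsto_const dual_of_L1_limit(2)[OF complete \<xi> ae L1 E])
  ultimately show "\<xi> x = (\<integral>t\<in>E. \<xi> (f t) \<partial>M)"
    using LIMSEQ_unique by fastforce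
qed

lemma seminorm_integral_eqI:
  assumes complete: "complete_measure M" and x: "is_seminorm_integral M E f x" and E: "E \<in> sets M"
  shows "seminorm_integral M E f = x"
proof -
  have "y = x" if "is_seminorm_integral M E f y" for y
    using dual_seminorm_integral(2)[OF complete that E] dual_seminorm_integral(2)[OF complete x E]
    by (intro dual_separates_points) simp
  then show ?thesis
    unfolding seminorm_integral_def is_seminorm_integral_def[symmetric] using x by (intro the_equality)
qed

lemma integrable_by_seminormD:
  assumes "integrable_by_seminorm M f" "E \<in> sets M"
  obtains x where "is_seminorm_integral M E f x"
  using assms unfolding integrable_by_seminorm_def is_seminorm_integral_def by metis

lemma compact_seminorm_net:
  assumes Q: "compact Q" "Q \<noteq> {}" and p: "p \<in> continuous_seminorms" and r: "r > 0"
  obtains K where "finite K" "K \<noteq> {}" "K \<subseteq> Q" "\<And>x. x \<in> Q \<Longrightarrow> \<exists>k\<in>K. p (x - k) < r"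
proof -
  have "open {x. p (x - k) < r}" for k
  proof -
    have "continuous_on UNIV (\<lambda>x. p (x - k))"
      using continuous_seminormsD(2)[OF p]
      by (intro continuous_on_compose2[of UNIV p UNIV "\<lambda>x. x - k"] continuous_on_diff continuous_on_id continuous_on_const) auto
    then show ?thesis
      by (intro open_Collect_less continuous_on_const)
  qed
  moreover have "Q \<subseteq> (\<Union>k\<in>Q. {x. p (x - k) < r})"
    using r seminormD(3)[OF continuous_seminormsD(1)[OF p]] by auto
  ultimately obtain K where "K \<subseteq> Q" "finite K" "Q \<subseteq> (\<Union>k\<in>K. {x. p (x - k) < r})"
    using compactE_image[OF Q(1), of Q "\<lambda>k. {x. p (x - k) < r}"] by blast
  then show ?thesis
    using that[of K] Q(2) by blast
qed

text \<open>
  On \<open>Q\<close> the function \<open>p (\<cdot> - x)\<close> is the supremum of countably many functions \<open>\<xi> (\<cdot> - x)\<close>: choose a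
  countable subset of \<open>Q\<close> that is dense for \<open>p\<close>, and for each of its points \<open>d\<close> a functional \<open>\<xi> \<le> p\<close>
  with \<open>\<xi> (d - x) = p (d - x)\<close>.
\<close>

lemma measurable_seminorm_of_ck_valued:
  assumes Q: "Q \<in> ck" and fQ: "\<And>t. t \<in> space M \<Longrightarrow> f t \<in> Q"
    and meas: "\<And>\<xi>. \<xi> \<in> topological_dual \<Longrightarrow> (\<lambda>t. \<xi> (f t)) \<in> borel_measurable M"
    and p: "p \<in> continuous_seminorms"
  shows "(\<lambda>t. p (f t - x)) \<in> borel_measurable M"
proof -
  note sp = continuous_seminormsD(1)[OF p]
  have "\<exists>K. finite K \<and> K \<noteq> {} \<and> K \<subseteq> Q \<and> (\<forall>x\<in>Q. \<exists>k\<in>K. p (x - k) < 1 / Suc n)" for n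
    using compact_seminorm_net[OF ckD(3,1)[OF Q] p, of "1 / Suc n"] by (metis divide_pos_pos of_nat_0_less_iff zero_less_Suc zero_less_one)
  then obtain K where K: "\<And>n. finite (K n)" "\<And>n. K n \<noteq> {}"
    "\<And>n x. x \<in> Q \<Longrightarrow> \<exists>k\<in>K n. p (x - k) < 1 / Suc n"
    by metis
  define D where "D = (\<Union>n. K n)"
  have D: "countable D" "D \<noteq> {}"
    unfolding D_def using K(1,2) by (auto intro: countable_finite)
  have "\<exists>\<xi>\<in>topological_dual. (\<forall>y. \<bar>\<xi> y\<bar> \<le> p y) \<and> \<xi> z = p z" for z
    using dual_attains_seminorm[OF p, of z] by metis
  then obtain \<xi> where \<xi>: "\<And>z. \<xi> z \<in> topological_dual" "\<And>z y. \<bar>\<xi> z y\<bar> \<le> p y" "\<And>z. \<xi> z z = p z"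
    by metis
  have le: "\<xi> z y \<le> p y" for z y
    using \<xi>(2)[of z y] by simp
  let ?F = "\<lambda>d t. \<xi> (d - x) (f t) - \<xi> (d - x) x"
  have bdd: "bdd_above ((\<lambda>d. ?F d t) ` D)" for t
    using le by (intro bdd_aboveI2[of _ _ "p (f t - x)"]) (simp add: topological_dualD(4)[OF \<xi>(1), symmetric])
  have eq: "p (f t - x) = (SUP d\<in>D. ?F d t)" if t: "t \<in> space M" for t
  proof (rule antisym)
    show "(SUP d\<in>D. ?F d t) \<le> p (f t - x)"
      using le D(2) by (intro cSUP_least) (simp_all add: topological_dualD(4)[OF \<xi>(1), symmetric])
    show "p (f t - x) \<le> (SUP d\<in>D. ?F d t)"
    proof (rule field_le_epsilon)
      fix e :: real
      assume "e > 0"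
      then obtain n where n: "1 / real (Suc n) < e / 2"
        using nat_approx_posE[of "e / 2"] by (metis half_gt_zero of_nat_Suc)
      obtain d where d: "d \<in> K n" "p (f t - d) < 1 / Suc n"
        using K(3)[OF fQ[OF t]] by blast
      have "p (f t - x) \<le> p (f t - d) + p (d - x)"
        using seminormD(1)[OF sp, of "f t - d" "d - x"] by simp
      also have "p (d - x) = \<xi> (d - x) (f t - x) + \<xi> (d - x) (d - f t)"
        using \<xi>(3)[of "d - x"] topological_dualD(3)[OF \<xi>(1), of "d - x" "f t - x" "d - f t"] by simp
      also have "\<xi> (d - x) (d - f t) \<le> p (f t - d)"
        using le[of "d - x" "d - f t"] seminormD(6)[OF sp, of d "f t"] by simp
      also have "\<xi> (d - x) (f t - x) \<le> (SUP d\<in>D. ?F d t)"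
        unfolding topological_dualD(4)[OF \<xi>(1)] using d(1) by (intro cSUP_upper bdd) (auto simp: D_def)
      finally show "p (f t - x) \<le> (SUP d\<in>D. ?F d t) + e"
        using d(2) n by simp
    qed
  qed
  have "(\<lambda>t. SUP d\<in>D. ?F d t) \<in> borel_measurable M"
    using D(1) bdd meas[OF \<xi>(1)] by (intro borel_measurable_cSUP borel_measurable_diff) auto
  then show ?thesis
    using eq by (subst measurable_cong)
qed

text \<open>
  The simple function sends \<open>t\<close> to the first point of a finite \<open>r\<close>-net of \<open>Q\<close> that is close to \<open>f t\<close>.
\<close>

lemma ck_valued_simple_approx:
  assumes Q: "Q \<in> ck" and fQ: "\<And>t. t \<in> space M \<Longrightarrow> f t \<in> Q"
    and meas: "\<And>\<xi>. \<xi> \<in> topological_dual \<Longrightarrow> (\<lambda>t. \<xi> (f t)) \<in> borel_measurable M"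
    and p: "p \<in> continuous_seminorms" and r: "r > 0"
  obtains g where "simple_function M g" "(\<lambda>t. p (g t - f t)) \<in> borel_measurable M"
    "\<And>t. t \<in> space M \<Longrightarrow> p (g t - f t) < r"
proof -
  note sp = continuous_seminormsD(1)[OF p]
  note pm[measurable] = measurable_seminorm_of_ck_valued[where f = f, OF Q fQ meas p]
  obtain K where K: "finite K" "K \<noteq> {}" "K \<subseteq> Q" "\<And>x. x \<in> Q \<Longrightarrow> \<exists>k\<in>K. p (x - k) < r"
    using compact_seminorm_net[OF ckD(3,1)[OF Q] p r] by blast
  let ?k = "from_nat_into K"
  have kK: "?k i \<in> K" for i
    by (rule from_nat_into[OF K(2)])
  define idx where "idx t = (LEAST i. p (f t - ?k i) < r)" for t
  have idx[measurable]: "idx \<in> measurable M (count_space UNIV)"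
    unfolding idx_def by measurable
  define g where "g t = ?k (idx t)" for t
  have "g \<in> measurable M (count_space UNIV)"
    unfolding g_def by measurable
  then have "g -` {x} \<inter> space M \<in> sets M" for x
    by (rule measurable_sets) simp
  moreover have "finite (g ` space M)"
    by (rule finite_subset[OF _ K(1)]) (use kK in \<open>auto simp: g_def\<close>)
  ultimately have "simple_function M g"
    unfolding simple_function_def by auto
  moreover have "p (g t - f t) = p (f t - g t)" for t
    by (rule seminormD(6)[OF sp])
  moreover have "(\<lambda>t. p (f t - g t)) \<in> borel_measurable M"
    unfolding g_def by (rule measurable_compose_countable[OF pm idx])
  moreover have "p (f t - g t) < r" if t: "t \<in> space M" for t
  proof -
    obtain k where k: "k \<in> K" "p (f t - k) < r"
      using K(4)[OF fQ[OF t]] by blast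
    then obtain i where "p (f t - ?k i) < r"
      using from_nat_into_surj[of K k] countable_finite[OF K(1)] by auto
    then show ?thesis
      unfolding g_def idx_def by (rule LeastI)
  qed
  ultimately show ?thesis
    using that by simp
qed

text \<open>
  Weak measurability and a weak integral suffice for functions with values in a compact convex set:
  they are uniform limits of simple functions for each \<open>p\<close>. The error of the integrals is tested
  with a functional \<open>\<xi>\<close> that norms it, for which it is an integral of \<open>\<xi> \<circ> (f - g n)\<close>.
\<close>

theorem ck_valued_integrable:
  assumes Q: "Q \<in> ck" and fQ: "\<And>t. t \<in> space M \<Longrightarrow> f t \<in> Q"
    and meas: "\<And>\<xi>. \<xi> \<in> topological_dual \<Longrightarrow> integrable M (\<lambda>t. \<xi> (f t))"
    and m: "\<And>\<xi> E. \<xi> \<in> topological_dual \<Longrightarrow> E \<in> sets M \<Longrightarrow> (\<integral>t\<in>E. \<xi> (f t) \<partial>M) = \<xi> (m E)"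
  shows "integrable_by_seminorm M f" "measurable_by_seminorm M f"
    "E \<in> sets M \<Longrightarrow> is_seminorm_integral M E f (m E)"
proof -
  have approx: "\<exists>g. simple_approx_ae M p f g \<and> simple_approx_L1 M p f g \<and>
      (\<forall>E\<in>sets M. (\<lambda>n. p (m E - simple_integral_on M E (g n))) \<longlonglongrightarrow> 0)"
    if p: "p \<in> continuous_seminorms" for p
  proof -
    note sp = continuous_seminormsD(1)[OF p]
    have r: "1 / real (Suc n) > 0" for n
      by simp
    have "\<exists>g. simple_function M g \<and> (\<lambda>t. p (g t - f t)) \<in> borel_measurable M \<and>
        (\<forall>t\<in>space M. p (g t - f t) < 1 / real (Suc n))" for n
      using ck_valued_simple_approx[where f = f, OF Q fQ borel_measurable_integrable[OF meas] p r] by metis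
    then obtain g where g: "\<And>n. simple_function M (g n)"
      "\<And>n. (\<lambda>t. p (g n t - f t)) \<in> borel_measurable M"
      "\<And>n t. t \<in> space M \<Longrightarrow> p (g n t - f t) < 1 / real (Suc n)"
      by metis
    have lim: "(\<lambda>n. c * (1 / real (Suc n))) \<longlonglongrightarrow> 0" for c :: real
      using tendsto_mult_right_zero[OF LIMSEQ_inverse_real_of_nat, of c] by (simp add: inverse_eq_divide)
    have squeeze: "X \<longlonglongrightarrow> 0" if "\<And>n. 0 \<le> X n" "\<And>n. X n \<le> c * (1 / real (Suc n))" for X :: "nat \<Rightarrow> real" and c
      by (rule tendsto_sandwich[OF _ _ tendsto_const lim[of c]]) (use that in auto)
    have "simple_approx_ae M p f g"
      unfolding simple_approx_ae_def
    proof (intro conjI allI bexI[of _ "{}"] ballI)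
      show "simple_function M (g n)" for n
        by (rule g(1))
      fix t
      assume "t \<in> space M - {}"
      then show "(\<lambda>n. p (g n t - f t)) \<longlonglongrightarrow> 0"
        using g(3)[of t] seminormD(5)[OF sp] by (intro squeeze[of _ 1]) (auto intro: less_imp_le)
    qed auto
    moreover have gi: "integrable M (\<lambda>t. p (g n t - f t))" for n
      using g(2)[of n] g(3)[of _ n] seminormD(5)[OF sp]
      by (intro integrable_const_bound[of _ "1 / real (Suc n)"]) (auto intro: less_imp_le)
    have "simple_approx_L1 M p f g"
      unfolding simple_approx_L1_def
    proof (intro conjI allI gi)
      have "(\<integral>t. p (g n t - f t) \<partial>M) \<le> (\<integral>t. 1 / real (Suc n) \<partial>M)" for n
        using g(3)[of _ n] by (intro integral_mono gi) (auto intro: less_imp_le)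
      then have "(\<integral>t. p (g n t - f t) \<partial>M) \<le> measure M (space M) * (1 / real (Suc n))" for n
        by simp
      then show "(\<lambda>n. \<integral>t. p (g n t - f t) \<partial>M) \<longlonglongrightarrow> 0"
        using seminormD(5)[OF sp] by (intro squeeze[of _ "measure M (space M)"] integral_nonneg_AE) auto
    qed
    moreover have "(\<lambda>n. p (m E - simple_integral_on M E (g n))) \<longlonglongrightarrow> 0" if E: "E \<in> sets M" for E
    proof (rule squeeze[of _ "measure M E"])
      show "0 \<le> p (m E - simple_integral_on M E (g n))" for n
        by (rule seminormD(5)[OF sp])
      fix n
      obtain \<xi> where \<xi>: "\<xi> \<in> topological_dual" "\<And>y. \<bar>\<xi> y\<bar> \<le> p y"
        "\<xi> (m E - simple_integral_on M E (g n)) = p (m E - simple_integral_on M E (g n))"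
        using dual_attains_seminorm[OF p] by blast
      note gs = dual_simple_integral[OF g(1)[of n] \<xi>(1) E]
      have i: "integrable M (\<lambda>t. indicat_real E t * \<xi> (f t))" "integrable M (\<lambda>t. indicat_real E t * \<xi> (g n t))"
        using integrable_mult_indicator[OF E meas[OF \<xi>(1)]] integrable_mult_indicator[OF E gs(1)] by auto
      have "p (m E - simple_integral_on M E (g n)) = \<xi> (m E) - \<xi> (simple_integral_on M E (g n))"
        unfolding \<xi>(3)[symmetric] topological_dualD(4)[OF \<xi>(1)] ..
      also have "\<dots> = (\<integral>t. indicat_real E t * \<xi> (f t) - indicat_real E t * \<xi> (g n t) \<partial>M)"
        unfolding m[OF \<xi>(1) E, symmetric] gs(2)[symmetric] set_lebesgue_integral_def using i by simp
      also have "\<dots> \<le> (\<integral>t. indicat_real E t * (1 / real (Suc n)) \<partial>M)"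
      proof (rule integral_mono)
        show "integrable M (\<lambda>t. indicat_real E t * \<xi> (f t) - indicat_real E t * \<xi> (g n t))"
          using i by (rule Bochner_Integration.integrable_diff)
        show "integrable M (\<lambda>t. indicat_real E t * (1 / real (Suc n)))"
          using integrable_indicator_finite[OF E] by (intro integrable_mult_left)
        fix t
        assume t: "t \<in> space M"
        have "\<xi> (f t) - \<xi> (g n t) \<le> 1 / real (Suc n)"
          using \<xi>(2)[of "g n t - f t"] g(3)[OF t, of n] topological_dualD(4)[OF \<xi>(1), of "g n t" "f t"] by linarith
        then show "indicat_real E t * \<xi> (f t) - indicat_real E t * \<xi> (g n t) \<le> indicat_real E t * (1 / real (Suc n))"
          by (auto split: split_indicator)
      qed
      also have "\<dots> = measure M E * (1 / real (Suc n))"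
        using E by simp
      finally show "p (m E - simple_integral_on M E (g n)) \<le> measure M E * (1 / real (Suc n))" .
    qed
    ultimately show ?thesis
      by blast
  qed
  then obtain g where g: "\<And>p. p \<in> continuous_seminorms \<Longrightarrow> simple_approx_ae M p f (g p) \<and>
      simple_approx_L1 M p f (g p) \<and> (\<forall>E\<in>sets M. (\<lambda>n. p (m E - simple_integral_on M E (g p n))) \<longlonglongrightarrow> 0)"
    by metis
  show "integrable_by_seminorm M f"
    unfolding integrable_by_seminorm_def using g by blast
  show "measurable_by_seminorm M f"
    unfolding measurable_by_seminorm_def strongly_measurable_wrt_def using g by blast
  show "E \<in> sets M \<Longrightarrow> is_seminorm_integral M E f (m E)"
    unfolding is_seminorm_integral_def using g by blast
qed

section \<open>Selectors of set-valued measures\<close>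

lemma dominated_multimeasure_empty:
  assumes "dominated_multimeasure Q N"
  shows "N {} = {0}"
proof -
  have "N {} \<noteq> {}" "N {} \<subseteq> {0}"
    using ckD(1)[OF dominated_multimeasureD(1)[OF assms]] dominated_multimeasureD(2)[OF assms, of "{}"] by auto
  then show ?thesis
    by blast
qed

lemma multimeasure_finite_union:
  assumes N: "dominated_multimeasure Q N" and I: "finite I"
    and P: "\<And>i. i \<in> I \<Longrightarrow> P i \<in> sets M" "disjoint_family_on P I"
  shows "N (\<Union>i\<in>I. P i) = {\<Sum>i\<in>I. y i | y. \<forall>i\<in>I. y i \<in> N (P i)}"
  using I P
proof (induction I rule: finite_induct)
  case empty
  then show ?case
    using dominated_multimeasure_empty[OF N] by simp
next
  case (insert i I)
  have IH: "N (\<Union>i\<in>I. P i) = {\<Sum>i\<in>I. y i | y. \<forall>i\<in>I. y i \<in> N (P i)}"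
    using insert.prems disjoint_family_on_mono[of I "insert i I" P] by (intro insert.IH) auto
  have sets: "P i \<in> sets M" "(\<Union>i\<in>I. P i) \<in> sets M"
    using insert.prems(1) insert.hyps(1) by auto
  have "P i \<inter> P j = {}" if "j \<in> I" for j
    using insert.hyps(2) that by (intro disjoint_family_onD[OF insert.prems(2)]) auto
  then have "P i \<inter> (\<Union>i\<in>I. P i) = {}"
    by blast
  then have eq: "N (P i \<union> (\<Union>i\<in>I. P i)) = {a + b | a b. a \<in> N (P i) \<and> b \<in> N (\<Union>i\<in>I. P i)}"
    by (rule dominated_multimeasureD(3)[OF N sets])
  show ?case
  proof (intro subset_antisym subsetI)
    fix x
    assume "x \<in> N (\<Union>i\<in>insert i I. P i)"
    then have "x \<in> N (P i \<union> (\<Union>i\<in>I. P i))"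
      by simp
    then obtain a b where a: "a \<in> N (P i)" and b: "b \<in> N (\<Union>i\<in>I. P i)" and x: "x = a + b"
      unfolding eq by blast
    obtain y where y: "\<forall>j\<in>I. y j \<in> N (P j)" "b = (\<Sum>j\<in>I. y j)"
      using b unfolding IH by blast
    have "(\<Sum>j\<in>I. (y(i := a)) j) = (\<Sum>j\<in>I. y j)"
      using insert.hyps(2) by (intro sum.cong) auto
    then have "x = (\<Sum>j\<in>insert i I. (y(i := a)) j)"
      using insert.hyps x y(2) by simp
    moreover have "\<forall>j\<in>insert i I. (y(i := a)) j \<in> N (P j)"
      using a y by auto
    ultimately show "x \<in> {\<Sum>i\<in>insert i I. y i | y. \<forall>i\<in>insert i I. y i \<in> N (P i)}"
      by blast
  next
    fix x
    assume "x \<in> {\<Sum>i\<in>insert i I. y i | y. \<forall>i\<in>insert i I. y i \<in> N (P i)}"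
    then obtain y where y: "\<forall>j\<in>insert i I. y j \<in> N (P j)" "x = (\<Sum>j\<in>insert i I. y j)"
      by blast
    then have "x = y i + (\<Sum>j\<in>I. y j)" "y i \<in> N (P i)"
      using insert.hyps by simp_all
    moreover have "(\<Sum>j\<in>I. y j) \<in> N (\<Union>i\<in>I. P i)"
      unfolding IH using y(1) by blast
    ultimately have "x \<in> N (P i \<union> (\<Union>i\<in>I. P i))"
      unfolding eq by blast
    then show "x \<in> N (\<Union>i\<in>insert i I. P i)"
      by simp
  qed
qed

text \<open>
  Let \<open>P J\<close> be the atoms of the algebra generated by \<open>S\<close>. Since \<open>E0\<close> is the union of its atoms, \<open>x0\<close>
  splits into a sum of points \<open>y J\<close> of \<open>N (P J)\<close>; on the remaining atoms \<open>y J\<close> is arbitrary. Summing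
  \<open>y J\<close> over the atoms of a set in \<open>S\<close> gives an additive choice.
\<close>

lemma finitely_many_additivity_constraints:
  assumes N: "dominated_multimeasure Q N" and S: "finite S" "S \<subseteq> sets M" and E0: "E0 \<in> S"
    and x0: "x0 \<in> N E0"
  shows "\<exists>m. (\<forall>E\<in>sets M. m E \<in> N E) \<and> m E0 = x0 \<and>
    (\<forall>A\<in>S. \<forall>B\<in>S. A \<union> B \<in> S \<longrightarrow> A \<inter> B = {} \<longrightarrow> m (A \<union> B) = m A + m B)"
proof -
  define P where "P J = {t \<in> space M. \<forall>A\<in>S. t \<in> A \<longleftrightarrow> A \<in> J}" for J
  have P_sets: "P J \<in> sets M" for J
  proof -
    have "P J = space M \<inter> (\<Inter>A\<in>S. if A \<in> J then A else space M - A)"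
      unfolding P_def by (auto split: if_splits)
    also have "\<dots> \<in> sets M"
    proof (cases "S = {}")
      case False
      then have "(\<Inter>A\<in>S. if A \<in> J then A else space M - A) \<in> sets M"
        using S by (intro sets.finite_INT) auto
      then show ?thesis
        by blast
    qed auto
    finally show ?thesis .
  qed
  have P_disj: "disjoint_family_on P \<J>" if "\<J> \<subseteq> Pow S" for \<J>
    unfolding disjoint_family_on_def
  proof (intro ballI impI)
    fix J J'
    assume J: "J \<in> \<J>" "J' \<in> \<J>" "J \<noteq> J'"
    have "J = {A \<in> S. t \<in> A}" "J' = {A \<in> S. t \<in> A}" if "t \<in> P J \<inter> P J'" for t
      using that J(1,2) \<open>\<J> \<subseteq> Pow S\<close> unfolding P_def by auto
    then show "P J \<inter> P J' = {}"
      using J(3) by blast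
  qed
  have cover: "A = (\<Union>J\<in>{J \<in> Pow S. A \<in> J}. P J)" if A: "A \<in> S" for A
  proof (intro subset_antisym subsetI)
    fix t
    assume t: "t \<in> A"
    then have "t \<in> P {B \<in> S. t \<in> B}"
      using A S sets.sets_into_space unfolding P_def by blast
    then show "t \<in> (\<Union>J\<in>{J \<in> Pow S. A \<in> J}. P J)"
      by (rule UN_I[rotated]) (use A t in auto)
  qed (use A in \<open>auto simp: P_def\<close>)
  have fin: "finite {J \<in> Pow S. A \<in> J}" for A
    using S(1) by auto
  have N_eq: "N A = {\<Sum>J\<in>{J \<in> Pow S. A \<in> J}. y J | y. \<forall>J\<in>{J \<in> Pow S. A \<in> J}. y J \<in> N (P J)}" if "A \<in> S" for A
  proof -
    have "N A = N (\<Union>J\<in>{J \<in> Pow S. A \<in> J}. P J)"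
      using cover[OF that] by simp
    also have "\<dots> = {\<Sum>J\<in>{J \<in> Pow S. A \<in> J}. y J | y. \<forall>J\<in>{J \<in> Pow S. A \<in> J}. y J \<in> N (P J)}"
      by (rule multimeasure_finite_union[OF N fin P_sets P_disj]) blast
    finally show ?thesis .
  qed
  obtain y0 where y0: "\<forall>J\<in>{J \<in> Pow S. E0 \<in> J}. y0 J \<in> N (P J)" "x0 = (\<Sum>J\<in>{J \<in> Pow S. E0 \<in> J}. y0 J)"
    using x0 unfolding N_eq[OF E0] by blast
  have ne: "\<exists>z. z \<in> N A" if "A \<in> sets M" for A
    using ckD(1)[OF dominated_multimeasureD(1)[OF N that]] by blast
  define y where "y J = (if E0 \<in> J then y0 J else (SOME z. z \<in> N (P J)))" for J
  have y: "y J \<in> N (P J)" if "J \<in> Pow S" for J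
    unfolding y_def using y0(1) that someI_ex[OF ne[OF P_sets]] by auto
  define m where "m A = (if A \<in> S then \<Sum>J\<in>{J \<in> Pow S. A \<in> J}. y J else (SOME z. z \<in> N A))" for A
  have "m A \<in> N A" if "A \<in> sets M" for A
  proof (cases "A \<in> S")
    case True
    have "\<forall>J\<in>{J \<in> Pow S. A \<in> J}. y J \<in> N (P J)"
      using y by blast
    then show ?thesis
      unfolding N_eq[OF True] m_def using True by auto
  next
    case False
    then show ?thesis
      unfolding m_def using someI_ex[OF ne[OF that]] by simp
  qed
  moreover have "m E0 = x0"
    unfolding m_def y0(2) using E0 by (auto simp: y_def intro!: sum.cong)
  moreover have "m (A \<union> B) = m A + m B" if AB: "A \<in> S" "B \<in> S" "A \<union> B \<in> S" "A \<inter> B = {}" for A B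
  proof -
    have m: "m C = (\<Sum>J\<in>Pow S. if C \<in> J then y J else 0)" if "C \<in> S" for C
      unfolding m_def using sum.inter_filter[of "Pow S" y "\<lambda>J. C \<in> J"] S(1) that by (simp only: finite_Pow_iff if_True)
    have "(if A \<union> B \<in> J then y J else 0) = (if A \<in> J then y J else 0) + (if B \<in> J then y J else 0)"
      if J: "J \<in> Pow S" for J
    proof (cases "P J = {}")
      case True
      then have "y J = 0"
        using y[OF J] dominated_multimeasure_empty[OF N] by simp
      then show ?thesis
        by simp
    next
      case False
      then obtain t where "t \<in> P J"
        by blast
      then have "\<forall>C\<in>S. t \<in> C \<longleftrightarrow> C \<in> J"
        unfolding P_def by simp
      then have "A \<union> B \<in> J \<longleftrightarrow> t \<in> A \<union> B" "A \<in> J \<longleftrightarrow> t \<in> A" "B \<in> J \<longleftrightarrow> t \<in> B"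
        using AB(1-3) by metis+
      then show ?thesis
        using AB(4) by auto
    qed
    then show ?thesis
      unfolding m[OF AB(1)] m[OF AB(2)] m[OF AB(3)] sum.distrib[symmetric] by (intro sum.cong) auto
  qed
  ultimately show ?thesis
    by blast
qed

text \<open>
  Additivity for a given pair of disjoint sets is a closed condition on points of the product of the
  compact sets \<open>N E\<close>, and any finitely many such conditions can be met. Tychonoff's theorem gives a
  point that meets all of them.
\<close>

theorem additive_selector_through_point:
  fixes N :: "'a set \<Rightarrow> 'b::locally_convex_space set"
  assumes N: "dominated_multimeasure Q N" and E0: "E0 \<in> sets M" and x0: "x0 \<in> N E0"
  obtains m where "\<And>E. E \<in> sets M \<Longrightarrow> m E \<in> N E" "m E0 = x0"
    "\<And>A B. A \<in> sets M \<Longrightarrow> B \<in> sets M \<Longrightarrow> A \<inter> B = {} \<Longrightarrow> m (A \<union> B) = m A + m B"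
proof -
  define S where "S E = (if E = E0 then {x0} else if E \<in> sets M then N E else {0})" for E
  have S_compact: "compact (S E)" for E
    unfolding S_def using ckD(3)[OF dominated_multimeasureD(1)[OF N]] by auto
  have "compactin (product_topology (\<lambda>_. euclidean) UNIV) (PiE UNIV S)"
    unfolding compactin_PiE using S_compact by simp
  then have K: "compact (PiE UNIV S)"
    by (simp add: euclidean_product_topology)
  define I where "I = {(A, B). A \<in> sets M \<and> B \<in> sets M \<and> A \<inter> B = {}}"
  define C where "C = (\<lambda>(A, B). {m :: 'a set \<Rightarrow> 'b. m (A \<union> B) = m A + m B})"
  have closed_C: "closed (C i)" for i
    unfolding C_def
    by (cases i) (auto intro!: closed_Collect_eq continuous_on_add continuous_on_product_coordinates)
  have fip: "PiE UNIV S \<inter> (\<Inter>i\<in>J. C i) \<noteq> {}" if J: "finite J" "J \<subseteq> I" for J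
  proof -
    define T where "T = insert E0 (\<Union>(A, B)\<in>J. {A, B, A \<union> B})"
    have "finite T" "T \<subseteq> sets M"
      using J E0 unfolding T_def I_def by auto
    moreover have "E0 \<in> T"
      unfolding T_def by simp
    ultimately obtain m where m: "\<forall>E\<in>sets M. m E \<in> N E" "m E0 = x0"
      "\<forall>A\<in>T. \<forall>B\<in>T. A \<union> B \<in> T \<longrightarrow> A \<inter> B = {} \<longrightarrow> m (A \<union> B) = m A + m B"
      using finitely_many_additivity_constraints[OF N _ _ _ x0, of T] by blast
    define m' where "m' E = (if E \<in> sets M then m E else 0)" for E
    have "m' \<in> PiE UNIV S"
      using m(1,2) E0 unfolding S_def m'_def by auto
    moreover have "m' \<in> C i" if i: "i \<in> J" for i
    proof -
      obtain A B where AB: "(A, B) \<in> J" and i_eq: "i = (A, B)"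
        using i by (cases i) auto
      have "A \<in> T" "B \<in> T" "A \<union> B \<in> T"
        using AB unfolding T_def by auto
      moreover have "A \<in> sets M" "B \<in> sets M" "A \<inter> B = {}"
        using AB J(2) unfolding I_def by auto
      ultimately show ?thesis
        using m(3) unfolding C_def m'_def i_eq by auto
    qed
    ultimately have "m' \<in> PiE UNIV S \<inter> (\<Inter>i\<in>J. C i)"
      by (intro IntI INT_I)
    then show "PiE UNIV S \<inter> (\<Inter>i\<in>J. C i) \<noteq> {}"
      unfolding ex_in_conv[symmetric] by (rule exI[of _ m'])
  qed
  have "PiE UNIV S \<inter> (\<Inter>i\<in>I. C i) \<noteq> {}"
    by (rule compact_imp_fip_image[OF K], rule closed_C, rule fip)
  then obtain m where "m \<in> PiE UNIV S" "m \<in> (\<Inter>i\<in>I. C i)"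
    by blast
  then have m: "\<And>E. m E \<in> S E" "\<And>i. i \<in> I \<Longrightarrow> m \<in> C i"
    unfolding PiE_iff by auto
  show ?thesis
  proof
    show "m E0 = x0"
      using m(1)[of E0] unfolding S_def by simp
    then show "m E \<in> N E" if "E \<in> sets M" for E
      using m(1)[of E] that x0 unfolding S_def by (auto split: if_splits)
    show "m (A \<union> B) = m A + m B" if "A \<in> sets M" "B \<in> sets M" "A \<inter> B = {}" for A B
      using m(2)[of "(A, B)"] that unfolding I_def C_def by auto
  qed
qed

lemma dominated_multimeasure_selector:
  assumes N: "dominated_multimeasure Q N" and sel: "\<And>E. E \<in> sets M \<Longrightarrow> m E \<in> N E"
    and add: "\<And>A B. A \<in> sets M \<Longrightarrow> B \<in> sets M \<Longrightarrow> A \<inter> B = {} \<Longrightarrow> m (A \<union> B) = m A + m B"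
  shows "dominated_multimeasure Q (\<lambda>E. {m E})"
  unfolding dominated_multimeasure_def
  using sel dominated_multimeasureD(2)[OF N] add by (auto simp: singleton_ck)

text \<open>
  Turns countable additivity into finite additivity: a disjoint pair, continued by empty sets.
\<close>

lemma two_set_partition:
  fixes A B :: "'a set"
  defines "E \<equiv> (\<lambda>n::nat. if n = 0 then A else if n = 1 then B else {})"
  assumes "A \<inter> B = {}"
  shows "disjoint_family E" "(\<Union>n. E n) = A \<union> B"
proof -
  show "disjoint_family E"
    using assms unfolding disjoint_family_on_def by auto
  show "(\<Union>n. E n) = A \<union> B"
  proof
    show "(\<Union>n. E n) \<subseteq> A \<union> B"
      unfolding E_def by auto
    have "E 0 = A" "E 1 = B"
      by (simp_all add: E_def)
    then show "A \<union> B \<subseteq> (\<Union>n. E n)"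
      by blast
  qed
qed

lemma strong_multimeasure_dominated:
  assumes strong: "strong_multimeasure M N" and ck: "\<forall>E\<in>sets M. N E \<in> ck"
    and dom: "\<forall>E\<in>sets M. N E \<subseteq> (\<lambda>x. measure M E *\<^sub>R x) ` Q"
  shows "dominated_multimeasure Q N"
  unfolding dominated_multimeasure_def
proof (intro conjI ballI impI)
  show "E \<in> sets M \<Longrightarrow> N E \<in> ck" "E \<in> sets M \<Longrightarrow> N E \<subseteq> (\<lambda>x. measure M E *\<^sub>R x) ` Q" for E
    using ck dom by auto
  fix A B
  assume A: "A \<in> sets M" and B: "B \<in> sets M" and disj: "A \<inter> B = {}"
  define E where "E n = (if n = 0 then A else if n = 1 then B else {})" for n :: nat
  note part = two_set_partition[OF disj, folded E_def]
  have N0: "N {} = {0}"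
    using strong unfolding strong_multimeasure_def by blast
  have "range E \<subseteq> sets M"
    using A B unfolding E_def by auto
  then have eq: "N (A \<union> B) = set_series (\<lambda>n. N (E n))"
    using strong part unfolding strong_multimeasure_def by metis
  have sums: "x sums (x 0 + x 1)" if "\<And>n. n \<notin> {0, 1} \<Longrightarrow> x n = 0" for x :: "nat \<Rightarrow> 'b"
    using sums_finite[of "{0, 1}" x] that by simp
  show "N (A \<union> B) = {a + b | a b. a \<in> N A \<and> b \<in> N B}"
  proof (intro subset_antisym subsetI)
    fix s
    assume "s \<in> N (A \<union> B)"
    then obtain x where x: "\<And>n. x n \<in> N (E n)" "x sums s"
      unfolding eq set_series_def by blast
    have "x n = 0" if "n \<notin> {0, 1}" for n
      using x(1)[of n] that N0 unfolding E_def by auto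
    then have "s = x 0 + x 1"
      using sums_unique2[OF x(2) sums] by blast
    then show "s \<in> {a + b | a b. a \<in> N A \<and> b \<in> N B}"
      using x(1)[of 0] x(1)[of 1] unfolding E_def by auto
  next
    fix s
    assume "s \<in> {a + b | a b. a \<in> N A \<and> b \<in> N B}"
    then obtain a b where ab: "a \<in> N A" "b \<in> N B" "s = a + b"
      by blast
    define x where "x n = (if n = 0 then a else if n = 1 then b else 0)" for n :: nat
    have "\<forall>n. x n \<in> N (E n)"
      unfolding x_def E_def using ab N0 by auto
    moreover have "unconditionally_convergent x"
      unfolding unconditionally_convergent_def
    proof (intro allI impI)
      fix \<pi> :: "nat \<Rightarrow> nat"
      assume "bij \<pi>"
      then have "finite (\<pi> -` {0, 1})"
        by (intro finite_vimageI) (auto simp: bij_def)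
      then show "summable (\<lambda>n. x (\<pi> n))"
        by (rule summable_finite) (auto simp: x_def)
    qed
    moreover have "x sums s"
      using sums[of x] ab(3) unfolding x_def by simp
    ultimately show "s \<in> N (A \<union> B)"
      unfolding eq set_series_def by blast
  qed
qed

lemma countably_additive_vec_additive:
  assumes m: "countably_additive_vec M m" and m0: "m {} = 0"
    and A: "A \<in> sets M" and B: "B \<in> sets M" and disj: "A \<inter> B = {}"
  shows "m (A \<union> B) = m A + m B"
proof -
  define E where "E n = (if n = 0 then A else if n = 1 then B else {})" for n :: nat
  note part = two_set_partition[OF disj, folded E_def]
  have "range E \<subseteq> sets M"
    using A B unfolding E_def by auto
  then have "(\<lambda>n. m (E n)) sums m (A \<union> B)"
    using m part unfolding countably_additive_vec_def by metis
  moreover have "(\<lambda>n. m (E n)) sums (\<Sum>n\<in>{0, 1}. m (E n))"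
    by (rule sums_finite) (auto simp: E_def m0)
  ultimately have "m (A \<union> B) = (\<Sum>n\<in>{0, 1}. m (E n))"
    by (rule sums_unique2)
  then show ?thesis
    by (simp add: E_def)
qed

text \<open>
  The two bounds \<open>- support_fun (- \<xi>) (F t) \<le> \<xi> (f t) \<le> support_fun \<xi> (F t)\<close> have the same integral
  \<open>\<xi> (m E)\<close> over each \<open>E\<close>, so they agree almost everywhere. Hence every selector \<open>f\<close> of \<open>F\<close>, chosen
  without regard to measurability, is weakly measurable with the right weak integral.
\<close>

lemma point_valued_density:
  assumes complete_M: "complete_measure M" and Q: "Q \<in> ck"
    and F: "\<And>t. t \<in> space M \<Longrightarrow> F t \<in> ck \<and> F t \<subseteq> Q"
    and int: "\<And>\<xi>. \<xi> \<in> topological_dual \<Longrightarrow> integrable M (\<lambda>t. support_fun \<xi> (F t)) \<and>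
       (\<forall>E\<in>sets M. (\<integral>t\<in>E. support_fun \<xi> (F t) \<partial>M) = \<xi> (m E))"
    and f: "\<And>t. t \<in> space M \<Longrightarrow> f t \<in> F t"
  shows "integrable_by_seminorm M f" "measurable_by_seminorm M f"
    "E \<in> sets M \<Longrightarrow> seminorm_integral M E f = m E"
proof -
  interpret complete_measure M
    by (rule complete_M)
  have main: "integrable M (\<lambda>t. \<xi> (f t)) \<and> (\<forall>E\<in>sets M. (\<integral>t\<in>E. \<xi> (f t) \<partial>M) = \<xi> (m E))"
    if \<xi>: "\<xi> \<in> topological_dual" for \<xi>
  proof -
    note n\<xi> = topological_dual_closed(3)[OF \<xi> \<xi>]
    note i = int[OF \<xi>] and ni = int[OF n\<xi>]
    have "AE t in M. support_fun \<xi> (F t) \<le> - support_fun (\<lambda>x. - \<xi> x) (F t)"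
    proof (rule AE_le_if_set_integrals_le)
      show "integrable M (\<lambda>t. support_fun \<xi> (F t))" "integrable M (\<lambda>t. - support_fun (\<lambda>x. - \<xi> x) (F t))"
        using i ni by auto
      show "(\<integral>t\<in>E. support_fun \<xi> (F t) \<partial>M) \<le> (\<integral>t\<in>E. - support_fun (\<lambda>x. - \<xi> x) (F t) \<partial>M)"
        if E: "E \<in> sets M" for E
      proof -
        have "(\<integral>t\<in>E. - support_fun (\<lambda>x. - \<xi> x) (F t) \<partial>M) = - (\<integral>t\<in>E. support_fun (\<lambda>x. - \<xi> x) (F t) \<partial>M)"
          unfolding set_lebesgue_integral_def by simp
        then show ?thesis
          using i ni E by simp
      qed
    qed
    then have eq: "AE t in M. \<xi> (f t) = support_fun \<xi> (F t)"
      using AE_space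
    proof eventually_elim
      case (elim t)
      have "\<xi> (f t) \<le> support_fun \<xi> (F t)" "- \<xi> (f t) \<le> support_fun (\<lambda>x. - \<xi> x) (F t)"
        using F[OF elim(2)] f[OF elim(2)] support_fun_ck(1)[OF _ \<xi>] support_fun_ck(1)[OF _ n\<xi>] by auto
      then show ?case
        using elim(1) by simp
    qed
    have sm[measurable]: "(\<lambda>t. support_fun \<xi> (F t)) \<in> borel_measurable M"
      using i by blast
    have fm[measurable]: "(\<lambda>t. \<xi> (f t)) \<in> borel_measurable M"
      by (rule borel_measurable_AE_eq[OF sm eq])
    have "integrable M (\<lambda>t. \<xi> (f t))"
      using i integrable_cong_AE[OF fm sm eq] by blast
    moreover have "(\<integral>t\<in>E. \<xi> (f t) \<partial>M) = \<xi> (m E)" if E: "E \<in> sets M" for E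
    proof -
      have "AE t in M. indicat_real E t *\<^sub>R \<xi> (f t) = indicat_real E t *\<^sub>R support_fun \<xi> (F t)"
        using eq by eventually_elim simp
      then have "(\<integral>t\<in>E. \<xi> (f t) \<partial>M) = (\<integral>t\<in>E. support_fun \<xi> (F t) \<partial>M)"
        unfolding set_lebesgue_integral_def using E fm sm
        by (intro integral_cong_AE borel_measurable_scaleR borel_measurable_indicator) auto
      then show ?thesis
        using i E by simp
    qed
    ultimately show ?thesis
      by blast
  qed
  have fQ: "f t \<in> Q" if "t \<in> space M" for t
    using F[OF that] f[OF that] by blast
  have I: "integrable M (\<lambda>t. \<xi> (f t))" if "\<xi> \<in> topological_dual" for \<xi>
    using main[OF that] by blast
  have mE: "(\<integral>t\<in>E. \<xi> (f t) \<partial>M) = \<xi> (m E)" if "\<xi> \<in> topological_dual" "E \<in> sets M" for \<xi> E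
    using main[OF that(1)] that(2) by blast
  note * = ck_valued_integrable[where f = f, OF Q fQ I mE]
  show "integrable_by_seminorm M f" "measurable_by_seminorm M f"
    by (rule *; assumption)+
  show "seminorm_integral M E f = m E" if E: "E \<in> sets M"
    by (rule seminorm_integral_eqI[OF complete_M _ E]) (rule *(3)[OF _ _ _ _ E]; assumption)
qed

text \<open>
  For the seminorm \<open>\<bar>\<xi>\<bar>\<close>, membership of \<open>f t\<close> in \<open>F t\<close> modulo the kernel still implies
  \<open>\<xi> (f t) \<le> support_fun \<xi> (F t)\<close>. Integration over \<open>E\<close> and separation of points from \<open>C\<close> do the rest.
\<close>

lemma seminorm_integral_of_selector:
  assumes complete: "complete_measure M" and F: "\<And>t. t \<in> space M \<Longrightarrow> F t \<in> ck"
    and C: "C \<in> ck" and E: "E \<in> sets M"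
    and int: "\<And>\<xi>. \<xi> \<in> topological_dual \<Longrightarrow> integrable M (\<lambda>t. support_fun \<xi> (F t)) \<and>
       (\<integral>t\<in>E. support_fun \<xi> (F t) \<partial>M) = support_fun \<xi> C"
    and f: "integrable_by_seminorm_selector M F f"
  shows "seminorm_integral M E f \<in> C"
proof -
  obtain x where x: "is_seminorm_integral M E f x"
    using f integrable_by_seminormD[OF _ E] unfolding integrable_by_seminorm_selector_def by blast
  have "\<xi> x \<le> support_fun \<xi> C" if \<xi>: "\<xi> \<in> topological_dual" for \<xi>
  proof -
    note d = dual_seminorm_integral[OF complete x E \<xi>]
    let ?p = "\<lambda>x. \<bar>\<xi> x\<bar>"
    obtain Z where Z: "Z \<in> null_sets M" "\<And>t. t \<in> space M - Z \<Longrightarrow> quot_map ?p (f t) \<in> quot_map ?p ` F t"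
      using f abs_dual_continuous_seminorm[OF \<xi>]
      unfolding integrable_by_seminorm_selector_def measurable_by_seminorm_selector_def
        strongly_measurable_selector_def by blast
    have le: "\<xi> (f t) \<le> support_fun \<xi> (F t)" if t: "t \<in> space M - Z" for t
    proof -
      obtain y where y: "y \<in> F t" "quot_map ?p (f t) = quot_map ?p y"
        using Z(2)[OF t] by blast
      have "f t \<in> quot_map ?p (f t)"
        unfolding quot_map_def using topological_dualD(6)[OF \<xi>] by simp
      then have "\<xi> (f t - y) = 0"
        unfolding y(2) unfolding quot_map_def by simp
      then have "\<xi> (f t) = \<xi> y"
        using topological_dualD(4)[OF \<xi>] by simp
      then show ?thesis
        using support_fun_ck(1)[OF F \<xi> y(1)] t by simp
    qed
    have "(\<integral>t\<in>E. \<xi> (f t) \<partial>M) \<le> (\<integral>t\<in>E. support_fun \<xi> (F t) \<partial>M)"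
      unfolding set_lebesgue_integral_def
    proof (rule integral_mono_AE)
      show "integrable M (\<lambda>t. indicat_real E t *\<^sub>R \<xi> (f t))"
        by (rule integrable_mult_indicator[OF E d(1)])
      show "integrable M (\<lambda>t. indicat_real E t *\<^sub>R support_fun \<xi> (F t))"
        using int[OF \<xi>] by (intro integrable_mult_indicator[OF E]) blast
      have "AE t in M. t \<notin> Z"
        by (rule AE_not_in[OF Z(1)])
      then show "AE t in M. indicat_real E t *\<^sub>R \<xi> (f t) \<le> indicat_real E t *\<^sub>R support_fun \<xi> (F t)"
        using AE_space by eventually_elim (use le in \<open>auto split: split_indicator\<close>)
    qed
    then show ?thesis
      using d(2) int[OF \<xi>] by simp
  qed
  then have "x \<in> C"
    using mem_ck_iff_support_fun[OF C] by blast
  then show ?thesis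
    using seminorm_integral_eqI[OF complete x E] by simp
qed

end

section \<open>Representation of a dominated strong multimeasure\<close>

theorem theorem4p4:
  fixes \<mu> :: "'w measure"
    and M :: "'w set \<Rightarrow> 'a::locally_convex_space set"
    and Q :: "'a set"
  assumes "finite_measure \<mu>"
    and "complete_measure \<mu>"
    and "complete (UNIV :: 'a set)"
    and "B_locally_convex \<mu> TYPE('a)"
    and "\<forall>E\<in>sets \<mu>. M E \<in> ck"
    and "strong_multimeasure \<mu> M"
    and "Q \<in> ck"
    and "\<forall>E\<in>sets \<mu>. M E \<subseteq> (\<lambda>x. measure \<mu> E *\<^sub>R x) ` Q"
  shows "\<exists>F :: 'w \<Rightarrow> 'a set.
    (\<forall>t\<in>space \<mu>. F t \<in> ck) \<and>
    Pettis_integrable \<mu> F \<and>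
    (\<forall>m. selector_of \<mu> M m \<and> countably_additive_vec \<mu> m \<longrightarrow>
       (\<exists>f. integrable_by_seminorm_selector \<mu> F f \<and>
            (\<forall>E\<in>sets \<mu>. m E = seminorm_integral \<mu> E f))) \<and>
    (\<forall>E\<in>sets \<mu>.
       M E = Pettis_integral \<mu> E F \<and>
       Pettis_integral \<mu> E F =
         {seminorm_integral \<mu> E f | f. integrable_by_seminorm_selector \<mu> F f})"
proof -
  interpret finite_measure \<mu>
    by (rule assms(1))
  note complete = assms(2) and ck = assms(5) and Q = assms(7)
  have M: "dominated_multimeasure Q M"
    by (rule strong_multimeasure_dominated[OF assms(6,5,8)])
  obtain \<Phi> where "set_density_operator Q \<Phi>"
    using multimeasure_density[OF complete Q] .
  note \<Phi>_ck = set_density_operatorD(1)[OF this] and \<Phi>_int = set_density_operatorD(2)[OF this]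
    and \<Phi>_mono = set_density_operatorD(3)[OF this]
  let ?F = "\<Phi> M"
  have F_ck: "?F t \<in> ck" if "t \<in> space \<mu>" for t
    using \<Phi>_ck[OF M that] by blast
  have is_P: "is_Pettis_integral \<mu> E ?F (M E)" if "E \<in> sets \<mu>" for E
    using ck that \<Phi>_int[OF M] unfolding is_Pettis_integral_def by auto
  have P_eq: "Pettis_integral \<mu> E ?F = M E" if E: "E \<in> sets \<mu>" for E
    unfolding Pettis_integral_def
  proof (rule the_equality[where P = "is_Pettis_integral \<mu> E ?F", OF is_P[OF E]])
    show "C = M E" if C: "is_Pettis_integral \<mu> E ?F C" for C
      using C is_P[OF E] unfolding is_Pettis_integral_def by (intro ck_eqI_support_fun) auto
  qed
  have Pettis: "Pettis_integrable \<mu> ?F"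
    unfolding Pettis_integrable_def using is_P \<Phi>_int[OF M] by blast
  have density: "\<exists>f. integrable_by_seminorm_selector \<mu> ?F f \<and> (\<forall>E\<in>sets \<mu>. m E = seminorm_integral \<mu> E f)"
    if sel: "\<And>E. E \<in> sets \<mu> \<Longrightarrow> m E \<in> M E"
      and add: "\<And>A B. A \<in> sets \<mu> \<Longrightarrow> B \<in> sets \<mu> \<Longrightarrow> A \<inter> B = {} \<Longrightarrow> m (A \<union> B) = m A + m B" for m
  proof -
    \<comment> \<open>any choice \<open>f t \<in> \<Phi> N t\<close> is a density of \<open>m\<close>, and \<open>\<Phi> N t \<subseteq> \<Phi> M t\<close> by monotonicity\<close>
    define N where "N E = {m E}" for E
    have N: "dominated_multimeasure Q N"
      unfolding N_def using M sel add by (rule dominated_multimeasure_selector)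
    have "\<exists>x. x \<in> \<Phi> N t" if "t \<in> space \<mu>" for t
      using \<Phi>_ck[OF N that] ckD(1) by blast
    then obtain f where f: "\<And>t. t \<in> space \<mu> \<Longrightarrow> f t \<in> \<Phi> N t"
      by metis
    have int: "integrable \<mu> (\<lambda>t. support_fun \<xi> (\<Phi> N t)) \<and>
       (\<forall>E\<in>sets \<mu>. (\<integral>t\<in>E. support_fun \<xi> (\<Phi> N t) \<partial>\<mu>) = \<xi> (m E))" if "\<xi> \<in> topological_dual" for \<xi>
      using \<Phi>_int[OF N that] by (simp add: N_def support_fun_singleton)
    have fF: "f t \<in> ?F t" if t: "t \<in> space \<mu>" for t
      using f[OF t] \<Phi>_mono[OF N M _ t] sel unfolding N_def by blast
    note f_props = point_valued_density[where F = "\<Phi> N" and f = f and m = m, OF complete Q]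
    have meas: "measurable_by_seminorm \<mu> f"
      using \<Phi>_ck[OF N] int f by (rule f_props(2))
    have "strongly_measurable_selector \<mu> p ?F f" if "p \<in> continuous_seminorms" for p
      unfolding strongly_measurable_selector_def
      using meas that fF unfolding measurable_by_seminorm_def by (auto intro!: bexI[of _ "{}"])
    moreover have "integrable_by_seminorm \<mu> f"
      using \<Phi>_ck[OF N] int f by (rule f_props(1))
    ultimately have "integrable_by_seminorm_selector \<mu> ?F f"
      unfolding integrable_by_seminorm_selector_def measurable_by_seminorm_selector_def using meas by blast
    moreover have "seminorm_integral \<mu> E f = m E" if "E \<in> sets \<mu>" for E
      using \<Phi>_ck[OF N] int f that by (rule f_props(3))
    ultimately show ?thesis
      by auto
  qed
  have "M E = {seminorm_integral \<mu> E f | f. integrable_by_seminorm_selector \<mu> ?F f}" if E: "E \<in> sets \<mu>" for E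
  proof (intro subset_antisym subsetI)
    fix x
    assume "x \<in> M E"
    then obtain m where m: "\<And>E. E \<in> sets \<mu> \<Longrightarrow> m E \<in> M E" "m E = x"
      "\<And>A B. A \<in> sets \<mu> \<Longrightarrow> B \<in> sets \<mu> \<Longrightarrow> A \<inter> B = {} \<Longrightarrow> m (A \<union> B) = m A + m B"
      using additive_selector_through_point[OF M E] by blast
    obtain f where "integrable_by_seminorm_selector \<mu> ?F f" "\<forall>E\<in>sets \<mu>. m E = seminorm_integral \<mu> E f"
      using density[OF m(1,3)] by blast
    then show "x \<in> {seminorm_integral \<mu> E f | f. integrable_by_seminorm_selector \<mu> ?F f}"
      using m(2) E by blast
  next
    fix x
    assume "x \<in> {seminorm_integral \<mu> E f | f. integrable_by_seminorm_selector \<mu> ?F f}"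
    then obtain f where f: "integrable_by_seminorm_selector \<mu> ?F f" "x = seminorm_integral \<mu> E f"
      by blast
    have "seminorm_integral \<mu> E f \<in> M E"
      using F_ck ck E \<Phi>_int[OF M] f(1) by (intro seminorm_integral_of_selector[where F = ?F, OF complete]) auto
    then show "x \<in> M E"
      using f(2) by simp
  qed
  moreover have "\<exists>f. integrable_by_seminorm_selector \<mu> ?F f \<and> (\<forall>E\<in>sets \<mu>. m E = seminorm_integral \<mu> E f)"
    if m: "selector_of \<mu> M m" "countably_additive_vec \<mu> m" for m
  proof (rule density)
    show sel: "m E \<in> M E" if "E \<in> sets \<mu>" for E
      using m(1) that unfolding selector_of_def by blast
    have "m {} = 0"
      using sel[of "{}"] dominated_multimeasure_empty[OF M] by simp
    then show "m (A \<union> B) = m A + m B" if "A \<in> sets \<mu>" "B \<in> sets \<mu>" "A \<inter> B = {}" for A B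
      using countably_additive_vec_additive[OF m(2)] that by blast
  qed
  ultimately show ?thesis
    using F_ck Pettis P_eq by (intro exI[of _ ?F]) simp
qed

end
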